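(* Let $m\geq 2$ and let $G_m^{M}$ be the flip graph of non-crossing perfect matchings on $2m$ points in convex position (defined in the context). Then: (i) if $m$ is odd, then $G_m^{M}$ has no $1$-rainbow cycle; (ii) if $m\in\{6,8,10\}$, then $G_m^{M}$ has no $1$-rainbow cycle; (iii) if $m\in\{2,4\}$, then $G_m^{M}$ has a $1$-rainbow cycle, and if $m\in\{6,8\}$, then $G_m^{M}$ has a $2$-rainbow cycle.
   Context: Let $n=2m$ points be in convex position (say equally spaced on a circle), labeled clockwise $1,\dots,n$. A non-crossing perfect matching is a perfect matching on these points whose edges, drawn as straight segments, do not cross. The directed graph $G_m^{M}$ has these matchings as vertices, and an arc $(M,M')$ whenever $M'$ is obtained from $M$ by replacing two edges $\{a,b\},\{c,d\}\in M$ by the edges $\{a,c\},\{b,d\}$ (a flip); this arc is labeled with the two entering edges $\{a,c\}$ and $\{b,d\}$. The set of all possible labels is $E_m=\{\{i,j\}: i,j\in[n],\ j-i \text{ odd}\}$. For an integer $r\geq 1$, an $r$-rainbow cycle in $G_m^{M}$ is a directed cycle (no repeated vertices) along which every element of $E_m$ appears exactly $r$ times among the arc labels. *)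

theory Defs
  imports "HOL-Analysis.Analysis" "Graph_Theory.Arc_Walk"
begin

definition circle_point :: "nat \<Rightarrow> nat \<Rightarrow> complex" where
  "circle_point m i = cis (- (2 * pi * real i / real (2 * m)))"

definition edge_segment :: "nat \<Rightarrow> nat set \<Rightarrow> complex set" where
  "edge_segment m e = convex hull (circle_point m ` e)"

definition perfect_matching :: "nat \<Rightarrow> nat set set \<Rightarrow> bool" where
  "perfect_matching m M \<longleftrightarrow>
     (\<forall>e\<in>M. e \<subseteq> {1..2 * m} \<and> card e = 2) \<and> (\<forall>i\<in>{1..2 * m}. \<exists>!e. e \<in> M \<and> i \<in> e)"

text \<open>Distinct edges of a perfect matching have no common endpoint, so two of their segments cross
  as soon as they have a point in common.\<close>

definition noncrossing :: "nat \<Rightarrow> nat set set \<Rightarrow> bool" where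
  "noncrossing m M \<longleftrightarrow>
     (\<forall>e\<in>M. \<forall>f\<in>M. e \<noteq> f \<longrightarrow> edge_segment m e \<inter> edge_segment m f = {})"

definition noncrossing_matchings :: "nat \<Rightarrow> nat set set set" where
  "noncrossing_matchings m = {M. perfect_matching m M \<and> noncrossing m M}"

definition flip :: "nat set set \<Rightarrow> nat set set \<Rightarrow> bool" where
  "flip M M' \<longleftrightarrow>
     (\<exists>a b c d. {a, b} \<in> M \<and> {c, d} \<in> M \<and> {a, b} \<noteq> {c, d} \<and>
        M' = (M - {{a, b}, {c, d}}) \<union> {{a, c}, {b, d}})"

definition matching_flip_graph ::
  "nat \<Rightarrow> (nat set set, nat set set \<times> nat set set) pre_digraph" where
  "matching_flip_graph m =
     \<lparr> verts = noncrossing_matchings m,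
       arcs = {(M, M'). M \<in> noncrossing_matchings m \<and> M' \<in> noncrossing_matchings m \<and> flip M M'},
       tail = fst,
       head = snd \<rparr>"

text \<open>The two edges entering by a flip of a perfect matching are never edges of that matching, so
  they are exactly the elements of the set difference below.\<close>

definition entering_edges :: "nat set set \<times> nat set set \<Rightarrow> nat set set" where
  "entering_edges a = snd a - fst a"

definition odd_edges :: "nat \<Rightarrow> nat set set" where
  "odd_edges m = {{i, j} | i j. i \<in> {1..2 * m} \<and> j \<in> {1..2 * m} \<and> odd (int j - int i)}"

text \<open>The library notion of a cycle admits directed cycles of length two, such as the
  two-way exchange between the two matchings on four points.\<close>

definition rainbow_cycle :: "nat \<Rightarrow> nat \<Rightarrow> (nat set set \<times> nat set set) list \<Rightarrow> bool" where
  "rainbow_cycle m r C \<longleftrightarrow>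
     pre_digraph.cycle (matching_flip_graph m) C \<and>
     (\<forall>e\<in>odd_edges m. length (filter (\<lambda>a. e \<in> entering_edges a) C) = r)"

end

theory Submission
  imports Defs
begin

text \<open>Each flip has two entering edges and there are \<open>m\<^sup>2\<close> labels, so a
  1-rainbow cycle has \<open>m\<^sup>2 / 2\<close> flips and \<open>m\<close> is even. In such a
  cycle every edge enters once and leaves once, and summing the lengths of all entering and
  leaving edges shows that every flip takes place at a quadrilateral that contains the centre.
  Hence only edges that are visible from the centre can leave, and everything behind an edge is
  frozen while the edge is present. For \<open>m = 6, 8, 10\<close> this leaves a search which
  starts at an arbitrary flip, reveals the unknown matching only where an edge leaves, and forbids
  edges to enter twice. It stays small by the cycle lemma: give weights to entering and leaving
  edges by their lengths such that the total over the cycle is zero; then the start can be chosen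
  so that no partial sum is negative. The 1-rainbow cycles for \<open>m = 2, 4\<close> and the
  2-rainbow cycles for \<open>m = 6, 8\<close> are explicit.\<close>

section \<open>Chords of the circle\<close>

text \<open>Edges have odd length, so for even \<open>m\<close> none is a diameter. Each length 1,
  3, ..., \<open>m - 1\<close> occurs \<open>2 * m\<close> times, hence the mean length is
  \<open>m / 2\<close> and the four edges of a flip average \<open>2 * m\<close>, which the four
  sides of a quadrilateral never exceed; this is why no flip can miss the centre. The obstacle for
  \<open>m = 10\<close> is size: there are 16796 matchings and a cycle would have 50 flips. The
  search therefore knows neither the whole matching nor its rotation on the circle. It has no depth
  bound and never tests whether the walk closes up: the periodic walk is followed for ever, each of
  its flips is one of the branches, and so a finite search tree contradicts it. Apart from the
  weights, the period acts only through local rules. An edge that changed since the start may enter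
  only if all edges at its endpoints have changed too, because each of them has entered meanwhile.
  Whatever is revealed inside an unknown block has been there since the start, so it must be an edge
  with no recorded change.\<close>

definition angle_point :: "nat \<Rightarrow> int \<Rightarrow> complex" where
  "angle_point m x = cis (- (pi * of_int x / real m))"

definition chord_dir :: "nat \<Rightarrow> int \<Rightarrow> int \<Rightarrow> complex" where
  "chord_dir m a c = cis (- (pi * (of_int a + of_int c) / (2 * real m)))"

text \<open>Signed distance of \<open>z\<close> from the line through the positions \<open>a\<close>
  and \<open>c\<close>, positive on the side of the clockwise arc from \<open>a\<close> to
  \<open>c\<close>: \<open>chord_dir\<close> is the unit vector towards the middle of this arc, and
  the cosine is the height of the chord in that direction.\<close>

definition chord_height :: "nat \<Rightarrow> int \<Rightarrow> int \<Rightarrow> complex \<Rightarrow> real" where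
  "chord_height m a c z = Re (cnj (chord_dir m a c) * z) - cos (pi * (of_int c - of_int a) / (2 *
      real m))"

lemma dir_angle_point:
  assumes "m > 0"
  shows "cnj (chord_dir m a c) * angle_point m x = cis (pi * (of_int a + of_int c - 2 * of_int x)
      / (2 * real m))"
proof -
  have "pi * (real_of_int a + real_of_int c) / (2 * real m) - pi * real_of_int x / real m
      = pi * (of_int a + of_int c - 2 * of_int x) / (2 * real m)"
    using assms by (simp add: field_simps)
  then show ?thesis
    by (simp add: chord_dir_def angle_point_def cis_cnj cis_mult)
qed

lemma chord_height_angle_point:
  assumes "m > 0"
  shows "chord_height m a c (angle_point m x)
    = cos (pi * (2 * of_int x - of_int a - of_int c) / (2 * real m)) - cos (pi * (of_int c -
        of_int a) / (2 * real m))"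
proof -
  have "pi * (of_int a + of_int c - 2 * of_int x) / (2 * real m) = - (pi * (2 * of_int x - of_int
      a - of_int c) / (2 * real m))"
    unfolding minus_divide_left by (simp add: algebra_simps)
  then show ?thesis using assms
    by (simp add: chord_height_def dir_angle_point del: minus_divide_left)
qed

lemma chord_height_ends:
  assumes "m > 0"
  shows "chord_height m a c (angle_point m a) = 0" "chord_height m a c (angle_point m c) = 0"
proof -
  have "pi * (2 * of_int a - of_int a - of_int c) / (2 * real m) = - (pi * (of_int c - of_int a) /
      (2 * real m))"
    unfolding minus_divide_left by (simp add: algebra_simps)
  then show "chord_height m a c (angle_point m a) = 0"
    using assms by (simp add: chord_height_angle_point del: minus_divide_left)
  show "chord_height m a c (angle_point m c) = 0"
    using assms by (simp add: chord_height_angle_point)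
qed

lemma chord_height_inside:
  assumes "m > 0" "a < x" "x < c" "c < a + 2 * int m"
  shows "chord_height m a c (angle_point m x) > 0"
proof -
  define s where "s = pi * (2 * of_int x - of_int a - of_int c) / (2 * real m)"
  define t where "t = pi * (of_int c - of_int a) / (2 * real m)"
  have "\<bar>2 * x - a - c\<bar> < c - a" using assms by linarith
  then have "\<bar>2 * real_of_int x - of_int a - of_int c\<bar> < of_int c - of_int a" by linarith
  then have st: "\<bar>s\<bar> < t"
    using assms(1) by (simp add: s_def t_def abs_mult divide_strict_right_mono)
  have "real_of_int c - of_int a \<le> 2 * real m" using assms by linarith
  then have "t \<le> pi" using assms(1) by (simp add: t_def pos_divide_le_eq)
  then have "cos t < cos \<bar>s\<bar>" using st by (intro cos_monotone_0_pi) auto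
  then have "cos t < cos s" by simp
  then show ?thesis using assms(1) by (simp add: chord_height_angle_point s_def t_def)
qed

lemma chord_height_outside:
  assumes "m > 0" "a < c" "c < x" "x < a + 2 * int m"
  shows "chord_height m a c (angle_point m x) < 0"
proof -
  define s where "s = pi * (2 * of_int x - of_int a - of_int c) / (2 * real m)"
  define t where "t = pi * (of_int c - of_int a) / (2 * real m)"
  have t0: "0 \<le> t" using assms by (simp add: t_def)
  have ts: "t < s" unfolding s_def t_def using assms by (intro divide_strict_right_mono
      mult_strict_left_mono) auto
  have "real_of_int (2 * x - a - c) < 4 * real m - of_int (c - a)" using assms by linarith
  then have "pi * (2 * of_int x - of_int a - of_int c) < pi * (4 * real m - (of_int c - of_int a))"
    by simp
  then have "s < pi * (4 * real m - (of_int c - of_int a)) / (2 * real m)"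
    unfolding s_def using assms(1) by (intro divide_strict_right_mono) auto
  also have "\<dots> = 2 * pi - t" using assms(1) by (simp add: t_def field_simps)
  finally have st: "s < 2 * pi - t" .
  \<comment> \<open>\<open>s\<close> lies between \<open>t\<close> and \<open>2 * pi - t\<close>.
    Cosine decreases only up to \<open>pi\<close>, so a larger \<open>s\<close> is reflected to
    \<open>2 * pi - s\<close>, which still exceeds \<open>t\<close>.\<close>
  have "cos s < cos t"
  proof (cases "s \<le> pi")
    case True
    then show ?thesis using ts t0 by (intro cos_monotone_0_pi)
  next
    case False
    have "cos (2 * pi - s) < cos t"
      using False ts t0 st by (intro cos_monotone_0_pi) auto
    then show ?thesis by (simp add: cos_diff)
  qed
  then show ?thesis using assms(1) by (simp add: chord_height_angle_point s_def t_def)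
qed

lemma chord_height_combination:
  assumes "u + v = 1"
  shows "chord_height m a c (u *\<^sub>R z + v *\<^sub>R w) = u * chord_height m a c z + v * chord_height m a
      c w"
proof -
  have "cos t = u * cos t + v * cos t" for t
    using assms by (metis distrib_right mult_1)
  from this[of "pi * (of_int c - of_int a) / (2 * real m)"] show ?thesis
    unfolding chord_height_def
    by (simp add: algebra_simps scaleR_conv_of_real)
qed

lemma hull_two_iff:
  "z \<in> convex hull {p, q} \<longleftrightarrow> (\<exists>u v. u \<ge> 0 \<and> v \<ge> 0 \<and> u + v = 1 \<and> z = u *\<^sub>R p + v *\<^sub>R q)"
  by (auto simp: convex_hull_2)

text \<open>The ends \<open>b\<close> and \<open>d\<close> lie on different sides of the line
  through \<open>a\<close> and \<open>c\<close>, so the segment between them has a point on this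
  line. That point is in the unit disc, and the disc cuts exactly the chord from \<open>a\<close> to
  \<open>c\<close> out of the line.\<close>

lemma crossing_chords_meet:
  assumes "a < b" "b < c" "c < d" "d < a + 2 * int m"
  shows "convex hull {angle_point m a, angle_point m c} \<inter> convex hull {angle_point m b,
      angle_point m d} \<noteq> {}"
proof -
  have m: "m > 0" using assms by linarith
  define P where "P = chord_height m a c (angle_point m b)"
  define Q where "Q = - chord_height m a c (angle_point m d)"
  have P: "P > 0" using chord_height_inside[OF m, of a b c] assms by (simp add: P_def)
  have Q: "Q > 0" using chord_height_outside[OF m, of a c d] assms by (simp add: Q_def)
  \<comment> \<open>The convex weights for which the heights \<open>P\<close> and \<open>- Q\<close>
    cancel.\<close>
  define u v where "u = Q / (P + Q)" and "v = P / (P + Q)"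
  have uv: "u \<ge> 0" "v \<ge> 0" "u + v = 1"
    using P Q by (auto simp: u_def v_def add_divide_distrib[symmetric])
  define p where "p = u *\<^sub>R angle_point m b + v *\<^sub>R angle_point m d"
  have p_bd: "p \<in> convex hull {angle_point m b, angle_point m d}"
    using uv by (auto simp: hull_two_iff p_def)
  have "chord_height m a c p = u * P - v * Q"
    using uv by (simp add: p_def chord_height_combination P_def Q_def)
  then have p0: "chord_height m a c p = 0" by (simp add: u_def v_def)
  have np: "norm p \<le> 1"
  proof -
    have "norm p \<le> u * norm (angle_point m b) + v * norm (angle_point m d)"
      unfolding p_def using uv norm_triangle_ineq[of "u *\<^sub>R angle_point m b" "v *\<^sub>R angle_point m
          d"] by simp
    then show ?thesis using uv by (simp add: angle_point_def)
  qed
  define t where "t = pi * (of_int c - of_int a) / (2 * real m)"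
  have "0 < t" using assms m by (simp add: t_def)
  have "real_of_int c - of_int a < 2 * real m" using assms by linarith
  then have "t < pi" using m by (simp add: t_def pos_divide_less_eq)
  have s: "sin t > 0" using \<open>0 < t\<close> \<open>t < pi\<close> by (rule sin_gt_zero)
  define w where "w = cnj (chord_dir m a c) * p"
  have wr: "Re w = cos t" using p0 by (simp add: chord_height_def w_def t_def)
  have "norm w = norm p" by (simp add: w_def norm_mult chord_dir_def)
  then have "(Re w)\<^sup>2 + (Im w)\<^sup>2 \<le> 1"
    using np by (metis cmod_power2 norm_ge_zero power_le_one)
  then have "(Im w)\<^sup>2 \<le> (sin t)\<^sup>2" using wr by (simp add: sin_squared_eq)
  then have y: "\<bar>Im w\<bar> \<le> sin t" using s by (simp add: abs_le_square_iff[symmetric])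
  \<comment> \<open>After rotation by \<open>chord_dir\<close> the chord is the vertical segment
    between \<open>cis t\<close> and \<open>cis (- t)\<close>; these are the barycentric coordinates
    of \<open>w\<close> on it, read off from the imaginary part.\<close>
  define \<alpha> \<beta> where "\<alpha> = (1 - Im w / sin t) / 2" and "\<beta> = (1 + Im w / sin t) / 2"
  have ab: "\<alpha> \<ge> 0" "\<beta> \<ge> 0" "\<alpha> + \<beta> = 1"
    using y s by (auto simp: \<alpha>_def \<beta>_def field_simps abs_le_iff)
  have A: "cnj (chord_dir m a c) * angle_point m a = cis t"
    unfolding dir_angle_point[OF m] t_def by simp
  have C: "cnj (chord_dir m a c) * angle_point m c = cis (- t)"
  proof -
    have "pi * (real_of_int a - real_of_int c) / (2 * real m) = - t"
      unfolding t_def minus_divide_left by (simp add: algebra_simps)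
    then show ?thesis unfolding dir_angle_point[OF m] by simp
  qed
  have "w = \<beta> *\<^sub>R cis t + \<alpha> *\<^sub>R cis (- t)"
  proof (rule complex_eqI)
    show "Re w = Re (\<beta> *\<^sub>R cis t + \<alpha> *\<^sub>R cis (- t))"
      using ab(3) distrib_right[of \<beta> \<alpha> "cos t"] by (simp add: wr add.commute)
    show "Im w = Im (\<beta> *\<^sub>R cis t + \<alpha> *\<^sub>R cis (- t))"
      using s by (simp add: \<alpha>_def \<beta>_def field_simps)
  qed
  also have "\<dots> = cnj (chord_dir m a c) * (\<beta> *\<^sub>R angle_point m a + \<alpha> *\<^sub>R angle_point m c)"
    by (simp only: A[symmetric] C[symmetric]) (simp add: distrib_left)
  finally have "p = \<beta> *\<^sub>R angle_point m a + \<alpha> *\<^sub>R angle_point m c"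
    by (simp add: w_def chord_dir_def)
  then have "p \<in> convex hull {angle_point m a, angle_point m c}"
    unfolding hull_two_iff using ab by (intro exI[of _ \<beta>] exI[of _ \<alpha>]) simp
  then show ?thesis using p_bd by blast
qed

lemma circle_point_eq: "circle_point m i = angle_point m (int i)"
  by (simp add: circle_point_def angle_point_def)

lemma edge_segment_pair:
  "edge_segment m {i, j} = convex hull {angle_point m (int i), angle_point m (int j)}"
  by (simp add: edge_segment_def circle_point_eq)

text \<open>The height over the chord \<open>a b\<close> vanishes on that chord and has a strict
  constant sign at \<open>c\<close> and \<open>d\<close>, hence on the whole second segment.\<close>

lemma separated_segments_disjoint:
  assumes "a < b" "b < a + 2 * m"
    and "(a < c \<and> c < b) \<and> a < d \<and> d < b \<or> (b < c \<and> c < a + 2 * m) \<and> b < d \<and> d < a + 2 * m"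
  shows "edge_segment m {a, b} \<inter> edge_segment m {c, d} = {}"
proof -
  let ?f = "chord_height m (int a) (int b)"
  have m: "m > 0" using assms by linarith
  have combination: "\<exists>u v. u \<ge> 0 \<and> v \<ge> 0 \<and> u + v = 1 \<and>
      ?f z = u * ?f (angle_point m (int i)) + v * ?f (angle_point m (int j))"
    if "z \<in> edge_segment m {i, j}" for z i j
  proof -
    from that obtain u v where "u \<ge> 0" "v \<ge> 0" "u + v = 1"
      "z = u *\<^sub>R angle_point m (int i) + v *\<^sub>R angle_point m (int j)"
      unfolding edge_segment_pair hull_two_iff by blast
    then show ?thesis by (intro exI[of _ u] exI[of _ v]) (simp add: chord_height_combination)
  qed
  have zero: "?f z = 0" if z: "z \<in> edge_segment m {a, b}" for z
    using combination[OF z] by (auto simp: chord_height_ends[OF m])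
  have "?f z \<noteq> 0" if z: "z \<in> edge_segment m {c, d}" for z
  proof -
    obtain u v where uv: "u \<ge> 0" "v \<ge> 0" "u + v = 1"
      and f: "?f z = u * ?f (angle_point m (int c)) + v * ?f (angle_point m (int d))"
      using combination[OF z] by blast
    have pos: "u * x + v * y > 0" if "x > 0" "y > 0" for x y :: real
    proof (cases "u = 0")
      case False
      then have "u * x > 0" using uv that by simp
      moreover have "v * y \<ge> 0" using uv that by simp
      ultimately show ?thesis by linarith
    qed (use uv that in simp)
    consider (inside) "a < c" "c < b" "a < d" "d < b"
      | (outside) "b < c" "c < a + 2 * m" "b < d" "d < a + 2 * m"
      using assms(3) by blast
    then show ?thesis
    proof cases
      case inside
      then have "?f (angle_point m (int c)) > 0" "?f (angle_point m (int d)) > 0"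
        using assms(2) by (intro chord_height_inside[OF m]; simp)+
      then have "?f z > 0" unfolding f by (rule pos)
      then show ?thesis by simp
    next
      case outside
      then have "?f (angle_point m (int c)) < 0" "?f (angle_point m (int d)) < 0"
        using assms(1) by (intro chord_height_outside[OF m]; simp)+
      then have "- ?f z > 0"
        using pos[of "- ?f (angle_point m (int c))" "- ?f (angle_point m (int d))"] unfolding f by
            simp
      then show ?thesis by simp
    qed
  qed
  then show ?thesis using zero by blast
qed

section \<open>Non-crossing matchings and flips on integer positions\<close>

text \<open>Integer positions unroll the circle, so that cyclic order becomes
  \<open>a < b < c < d < a + 2 * m\<close> without a special case at the label 1. The shifts by 1
  make the residues run through 1 to \<open>2 * m\<close> instead of starting at 0.\<close>

definition pt :: "nat \<Rightarrow> int \<Rightarrow> nat" where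
  "pt m x = nat ((x - 1) mod (2 * int m)) + 1"

lemma pt_range: "m > 0 \<Longrightarrow> pt m x \<in> {1..2 * m}"
  using pos_mod_bound[of "2 * int m" "x - 1"] pos_mod_sign[of "2 * int m" "x - 1"]
  unfolding pt_def atLeastAtMost_iff by linarith

lemma pt_int: "i \<in> {1..2 * m} \<Longrightarrow> pt m (int i) = i"
  by (auto simp: pt_def)

lemma pt_add: "pt m (x + 2 * int m) = pt m x"
proof -
  have "(x + 2 * int m - 1) mod (2 * int m) = (x - 1 + 2 * int m) mod (2 * int m)"
    by (simp add: algebra_simps)
  then show ?thesis by (simp add: pt_def)
qed

lemma pt_cong: "m > 0 \<Longrightarrow> int (pt m x) mod (2 * int m) = x mod (2 * int m)"
proof -
  assume "m > 0"
  then have "int (pt m x) = (x - 1) mod (2 * int m) + 1"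
    using pos_mod_sign[of "2 * int m" "x - 1"] by (simp add: pt_def)
  then show ?thesis by (simp add: mod_add_left_eq)
qed

lemma pt_eqD: "m > 0 \<Longrightarrow> pt m x = pt m y \<Longrightarrow> (2 * int m) dvd (y - x)"
  using pt_cong[of m x] pt_cong[of m y] by (metis mod_eq_dvd_iff)

lemma pt_inj:
  assumes "pt m x = pt m y" "x \<le> y" "y < x + 2 * int m"
  shows "x = y"
proof -
  have m: "m > 0" using assms by linarith
  have "(2 * int m) dvd (y - x)" using pt_eqD[OF m assms(1)] .
  then show ?thesis using assms zdvd_imp_le[of "2 * int m" "y - x"] by fastforce
qed

lemma pt_surj:
  assumes "i \<in> {1..2 * m}"
  obtains y where "x \<le> y" "y < x + 2 * int m" "pt m y = i"
proof -
  have m: "2 * int m > 0" using assms by auto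
  define y where "y = x + (int i - x) mod (2 * int m)"
  have "pt m y = i"
  proof -
    have "(y - 1) mod (2 * int m) = (int i - 1) mod (2 * int m)"
    proof -
      have "(y - 1) mod (2 * int m) = (x - 1 + (int i - x) mod (2 * int m)) mod (2 * int m)"
        by (simp add: y_def algebra_simps)
      also have "\<dots> = (x - 1 + (int i - x)) mod (2 * int m)" by (simp only: mod_add_right_eq)
      finally show ?thesis by simp
    qed
    then have "pt m y = pt m (int i)" by (simp add: pt_def)
    then show ?thesis using assms by (simp add: pt_int)
  qed
  moreover have "x \<le> y" "y < x + 2 * int m"
    using m by (auto simp: y_def)
  ultimately show thesis using that by blast
qed

lemma pt_even_diff:
  assumes "m > 0"
  shows "even (int (pt m x) - x)"
proof -
  have "(2 * int m) dvd (int (pt m x) - x)"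
    using pt_cong[OF assms, of x] by (metis mod_eq_dvd_iff)
  then show ?thesis by (rule dvd_trans[rotated]) simp
qed

lemma angle_point_add: "m > 0 \<Longrightarrow> angle_point m (x + k * (2 * int m)) = angle_point m x"
proof -
  assume m: "m > 0"
  have e: "- (pi * of_int (x + k * (2 * int m)) / real m) = - (pi * of_int x / real m) + 2 * pi *
      of_int (- k)"
    using m by (simp add: field_simps)
  have "cis (2 * pi * real_of_int (- k)) = 1"
    by (intro cis_multiple_2pi) simp
  then show ?thesis by (simp only: angle_point_def e cis_mult[symmetric] mult_1_right)
qed

lemma circle_point_pt: "m > 0 \<Longrightarrow> circle_point m (pt m x) = angle_point m x"
proof -
  assume m: "m > 0"
  have "(2 * int m) dvd (int (pt m x) - x)"
    using pt_cong[OF m, of x] by (metis mod_eq_dvd_iff)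
  then obtain k where "int (pt m x) = x + k * (2 * int m)"
    by (metis dvdE add.commute diff_eq_eq mult.commute)
  then show ?thesis by (simp add: circle_point_eq angle_point_add m)
qed

section \<open>Partners in a non-crossing matching\<close>

definition joined :: "nat \<Rightarrow> nat set set \<Rightarrow> int \<Rightarrow> int \<Rightarrow> bool" where
  "joined m M x y \<longleftrightarrow> {pt m x, pt m y} \<in> M"

lemma joined_sym: "joined m M x y \<longleftrightarrow> joined m M y x"
  by (simp add: joined_def insert_commute)

lemma joined_add [simp]:
  "joined m M (x + 2 * int m) y \<longleftrightarrow> joined m M x y"
  "joined m M x (y + 2 * int m) \<longleftrightarrow> joined m M x y"
  by (simp_all add: joined_def pt_add)

context
  fixes m :: nat and M :: "nat set set"
  assumes M: "M \<in> noncrossing_matchings m" and m: "m > 0"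
begin

lemma perfect: "perfect_matching m M"
  using M by (simp add: noncrossing_matchings_def)

lemma edge_disjoint:
  assumes "e \<in> M" "f \<in> M" "i \<in> e" "i \<in> f"
  shows "e = f"
  using assms perfect unfolding perfect_matching_def by blast

lemma edge_card: "e \<in> M \<Longrightarrow> card e = 2"
  using perfect by (simp add: perfect_matching_def)

lemma edge_range: "e \<in> M \<Longrightarrow> e \<subseteq> {1..2 * m}"
  using perfect by (simp add: perfect_matching_def)

lemma finite_matching: "finite M"
  by (rule finite_subset[of _ "Pow {1..2 * m}"]) (use edge_range in blast, simp)

lemma joined_distinct: "joined m M x y \<Longrightarrow> pt m x \<noteq> pt m y"
  using edge_card by (fastforce simp: joined_def)

lemma joined_unique: "joined m M x y \<Longrightarrow> joined m M x z \<Longrightarrow> pt m y = pt m z"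
  using edge_disjoint[of "{pt m x, pt m y}" "{pt m x, pt m z}" "pt m x"]
  by (auto simp: joined_def doubleton_eq_iff)

lemma joined_ex: "\<exists>y. x < y \<and> y < x + 2 * int m \<and> joined m M x y"
proof -
  obtain e where e: "e \<in> M" "pt m x \<in> e"
    using perfect pt_range[OF m, of x] unfolding perfect_matching_def by blast
  obtain p q where pq: "e = {p, q}" "p \<noteq> q" using edge_card[OF e(1)] by (meson card_2_iff)
  then obtain i where i: "e = {pt m x, i}" "i \<noteq> pt m x" using e(2) by blast
  then have "i \<in> {1..2 * m}" using edge_range[OF e(1)] by blast
  then obtain y where y: "x \<le> y" "y < x + 2 * int m" "pt m y = i" by (rule pt_surj)
  then show ?thesis using i e by (intro exI[of _ y]) (auto simp: joined_def order_le_less)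
qed

lemma joined_noncrossing:
  assumes "a < b" "b < c" "c < d" "d < a + 2 * int m"
  shows "\<not> (joined m M a c \<and> joined m M b d)"
proof
  assume j: "joined m M a c \<and> joined m M b d"
  let ?e = "{pt m a, pt m c}" and ?f = "{pt m b, pt m d}"
  have "pt m a \<noteq> pt m b" "pt m a \<noteq> pt m d"
    using pt_inj[of m a b] pt_inj[of m a d] assms by auto
  then have "?e \<noteq> ?f" by (auto simp: doubleton_eq_iff)
  moreover have "?e \<in> M" "?f \<in> M" using j by (auto simp: joined_def)
  ultimately have "edge_segment m ?e \<inter> edge_segment m ?f = {}"
    using M by (auto simp: noncrossing_matchings_def noncrossing_def)
  moreover have "edge_segment m {pt m x, pt m y} = convex hull {angle_point m x, angle_point m y}"
      for x y
    by (simp add: edge_segment_def circle_point_pt m)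
  ultimately show False using crossing_chords_meet[OF assms] by simp
qed

text \<open>Non-crossing forces the points strictly between two partners to be matched among
  themselves, so their number is even.\<close>

lemma joined_odd:
  assumes "joined m M x y"
  shows "odd (y - x)"
proof -
  have linear: "odd (j - i)" if e: "{pt m i, pt m j} \<in> M" and ij: "i < j" "j < i + 2 * int m" for
      i j
  proof -
    have J: "joined m M i j" using e by (simp add: joined_def)
    define I where "I = {i<..<j}"
    define C where "C = {e \<in> M. e \<subseteq> pt m ` I}"
    have inj: "inj_on (pt m) I"
    proof (rule inj_onI)
      fix u v assume "u \<in> I" "v \<in> I" "pt m u = pt m v"
      then show "u = v" using pt_inj[of m u v] pt_inj[of m v u] ij by (cases "u \<le> v") (auto simp:
          I_def)
    qed
    have "\<Union> C = pt m ` I"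
    proof
      show "pt m ` I \<subseteq> \<Union> C"
      proof
        fix p assume "p \<in> pt m ` I"
        then obtain u where u: "u \<in> I" "p = pt m u" by blast
        obtain v0 where v0: "joined m M u v0" using joined_ex by blast
        obtain v where v: "i \<le> v" "v < i + 2 * int m" "pt m v = pt m v0"
          using pt_surj[OF pt_range[OF m]] by metis
        have uv: "joined m M u v" using v0 v by (simp add: joined_def)
        have "v \<noteq> i" "v \<noteq> j"
        proof -
          have "pt m u \<noteq> pt m i" "pt m u \<noteq> pt m j"
            using pt_inj[of m i u] pt_inj[of m u j] u ij by (auto simp: I_def)
          then show "v \<noteq> i" "v \<noteq> j"
            using joined_unique[of v u j] joined_unique[of v u i] uv J joined_sym[of m M] by metis+
        qed
        moreover have "\<not> j < v"
          using joined_noncrossing[of i u j v] u v J uv by (auto simp: I_def)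
        ultimately have "v \<in> I" using v by (auto simp: I_def)
        then have "{pt m u, pt m v} \<in> C" using u uv by (auto simp: C_def joined_def)
        then show "p \<in> \<Union> C" using u by blast
      qed
    qed (auto simp: C_def)
    moreover have "2 * card C = card (\<Union> C)"
    proof (rule card_partition)
      show "finite C" using finite_matching by (simp add: C_def)
      show "finite (\<Union> C)" unfolding \<open>\<Union> C = pt m ` I\<close> by (simp add: I_def)
    qed (use edge_card edge_disjoint in \<open>auto simp: C_def\<close>)
    ultimately have "even (card I)" by (metis card_image dvd_triv_left inj)
    then show ?thesis using ij by (simp add: I_def nat_diff_distrib even_nat_iff)
  qed
  obtain z where z: "x \<le> z" "z < x + 2 * int m" "pt m z = pt m y"
    using pt_surj[OF pt_range[OF m]] by metis
  have "z \<noteq> x" using joined_distinct[OF assms] z by auto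
  then have "odd (z - x)" using linear[of x z] z assms by (auto simp: joined_def)
  moreover have "even (z - y)" using pt_even_diff[OF m, of z] pt_even_diff[OF m, of y] z(3) by
      (auto simp: algebra_simps)
  ultimately show ?thesis by simp
qed

end

text \<open>Of the six orders of \<open>y\<close>, \<open>z\<close>, \<open>w\<close> after
  \<open>x\<close>, two make the old edges cross and two make the new edges cross. In the remaining
  two, leaving and entering edges alternate around the quadrilateral; the naming is fixed so that
  \<open>a b\<close> and \<open>c d\<close> leave.\<close>

lemma flip_quadrilateral:
  assumes M: "M \<in> noncrossing_matchings m" and M': "M' \<in> noncrossing_matchings m" and m: "m > 0"
    and "flip M M'"
  obtains a b c d where "a < b" "b < c" "c < d" "d < a + 2 * int m"
    "joined m M a b" "joined m M c d"
    "M' = M - {{pt m a, pt m b}, {pt m c, pt m d}} \<union> {{pt m b, pt m c}, {pt m d, pt m a}}"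
proof -
  obtain p q r s where pq: "{p, q} \<in> M" and rs: "{r, s} \<in> M" and ne: "{p, q} \<noteq> {r, s}"
    and M'_eq: "M' = (M - {{p, q}, {r, s}}) \<union> {{p, r}, {q, s}}"
    using assms(4) unfolding flip_def by blast
  have dist: "p \<noteq> q" "r \<noteq> s" using edge_card[OF M m pq] edge_card[OF M m rs] by auto
  have disj: "{p, q} \<inter> {r, s} = {}" using edge_disjoint[OF M m pq rs] ne by blast
  have range: "p \<in> {1..2 * m}" "q \<in> {1..2 * m}" "r \<in> {1..2 * m}" "s \<in> {1..2 * m}"
    using edge_range[OF M m pq] edge_range[OF M m rs] by auto
  define x where "x = int p"
  have x: "pt m x = p" using range by (simp add: x_def pt_int)
  obtain y where y: "x \<le> y" "y < x + 2 * int m" "pt m y = q" using pt_surj[OF range(2)] .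
  obtain z where z: "x \<le> z" "z < x + 2 * int m" "pt m z = r" using pt_surj[OF range(3)] .
  obtain w where w: "x \<le> w" "w < x + 2 * int m" "pt m w = s" using pt_surj[OF range(4)] .
  have lt: "x < y" "x < z" "x < w" and neq: "y \<noteq> z" "y \<noteq> w" "z \<noteq> w"
    using dist disj x y z w by (auto simp: order_le_less)
  have j: "joined m M x y" "joined m M z w" "joined m M' x z" "joined m M' y w"
    using pq rs x y z w by (auto simp: joined_def M'_eq)
  have nc: "\<not> (x < z \<and> z < y \<and> y < w)" "\<not> (x < w \<and> w < y \<and> y < z)"
    "\<not> (x < y \<and> y < z \<and> z < w)" "\<not> (x < w \<and> w < z \<and> z < y)"
    using joined_noncrossing[OF M m, of x z y w] joined_noncrossing[OF M m, of x w y z]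
      joined_noncrossing[OF M' m, of x y z w] joined_noncrossing[OF M' m, of x w z y]
      j joined_sym[of m] y z w by blast+
  consider "y < w" "w < z" | "z < w" "w < y" using lt neq nc by linarith
  then show thesis
  proof cases
    case 1
    have "M' = M - {{pt m x, pt m y}, {pt m w, pt m z}} \<union> {{pt m y, pt m w}, {pt m z, pt m x}}"
      using M'_eq x y z w by (simp add: insert_commute)
    then show thesis using that[of x y w z] 1 lt j z joined_sym[of m M] by blast
  next
    case 2
    \<comment> \<open>Here the order is \<open>x < z < w < y\<close>. Starting at \<open>y\<close>
      and moving the other corners one turn ahead gives the required alternation.\<close>
    let ?n = "2 * int m"
    have "M' = M - {{pt m y, pt m (x + ?n)}, {pt m (z + ?n), pt m (w + ?n)}}
        \<union> {{pt m (x + ?n), pt m (z + ?n)}, {pt m (w + ?n), pt m y}}"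
      using M'_eq x y z w by (simp add: insert_commute pt_add)
    moreover have "joined m M y (x + ?n)" "joined m M (z + ?n) (w + ?n)"
      using j joined_sym[of m M] by simp_all
    ultimately show thesis using that[of y "x + ?n" "z + ?n" "w + ?n"] 2 lt y by linarith
  qed
qed

section \<open>Cyclic sequences of flips\<close>

lemma cas_nth:
  assumes "pre_digraph.cas G u p v" "i < length p"
  shows "tail G (p ! 0) = u \<and> head G (p ! i) = (if Suc i < length p then tail G (p ! Suc i) else v)"
  using assms
proof (induction p arbitrary: u i)
  case (Cons a p)
  interpret pre_digraph G .
  show ?case
  proof (cases i)
    case 0
    then show ?thesis using Cons.prems by (cases p) auto
  next
    case (Suc j)
    then show ?thesis using Cons.IH[of "head G a" j] Cons.prems by auto
  qed
qed simp

text \<open>Indices are taken modulo the length, which yields a sequence over all times that can be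
  started anywhere and followed past the end of the period.\<close>

lemma rainbow_cycle_sequence:
  assumes "rainbow_cycle m r C"
  obtains T M where "T > 0" "\<forall>t. M t \<in> noncrossing_matchings m" "\<forall>t. flip (M t) (M (Suc t))"
    "\<forall>t. M (t + T) = M t"
    "\<forall>e\<in>odd_edges m. card {t. t < T \<and> e \<in> M (Suc t) - M t} = r"
proof -
  let ?G = "matching_flip_graph m"
  define T where "T = length C"
  define M where "M t = fst (C ! (t mod T))" for t
  obtain u where u: "pre_digraph.cas ?G u C u" "set C \<subseteq> arcs ?G" "C \<noteq> []"
    using assms unfolding rainbow_cycle_def pre_digraph.cycle_def pre_digraph.awalk_def by blast
  have T: "T > 0" using u by (simp add: T_def)
  have th: "tail ?G = fst" "head ?G = snd" by (simp_all add: matching_flip_graph_def)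
  have next_arc: "snd (C ! i) = M (Suc i)" if "i < T" for i
  proof (cases "Suc i < T")
    case True
    then show ?thesis using cas_nth[OF u(1), of i] that by (simp add: M_def th T_def)
  next
    case False
    then have "Suc i = T" using that by simp
    then show ?thesis using cas_nth[OF u(1), of i] that by (simp add: M_def th T_def)
  qed
  have Suc_mod: "M (Suc (t mod T)) = M (Suc t)" for t
    by (simp add: M_def mod_Suc_eq)
  have arc: "(M t, M (Suc t)) \<in> arcs ?G" for t
  proof -
    have "C ! (t mod T) \<in> arcs ?G" using u(2) T nth_mem[of "t mod T" C] by (auto simp: T_def)
    moreover have "C ! (t mod T) = (M t, M (Suc t))"
      using next_arc[of "t mod T"] T Suc_mod[of t] by (simp add: M_def prod_eq_iff)
    ultimately show ?thesis by simp
  qed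
  have "card {t. t < T \<and> e \<in> M (Suc t) - M t} = r" if "e \<in> odd_edges m" for e
  proof -
    have "r = card {t. t < T \<and> e \<in> entering_edges (C ! t)}"
      using assms that by (simp add: rainbow_cycle_def length_filter_conv_card T_def)
    also have "{t. t < T \<and> e \<in> entering_edges (C ! t)} = {t. t < T \<and> e \<in> M (Suc t) - M t}"
      using next_arc by (auto simp: entering_edges_def M_def)
    finally show ?thesis by simp
  qed
  moreover have "M (t + T) = M t" for t by (simp add: M_def)
  ultimately show thesis using that[of T M] T arc by (auto simp: matching_flip_graph_def)
qed

section \<open>The labels and their number\<close>

lemma matching_odd_edges:
  assumes "M \<in> noncrossing_matchings m" "m > 0"
  shows "M \<subseteq> odd_edges m"
proof
  fix e assume e: "e \<in> M"
  then obtain i j where ij: "e = {i, j}" using edge_card[OF assms] by (meson card_2_iff)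
  then have r: "i \<in> {1..2 * m}" "j \<in> {1..2 * m}" using edge_range[OF assms e] by auto
  then have "joined m M (int i) (int j)" using e ij by (simp add: joined_def pt_int)
  then have "odd (int j - int i)" by (rule joined_odd[OF assms])
  then show "e \<in> odd_edges m" unfolding odd_edges_def using r ij by blast
qed

lemma finite_odd_edges: "finite (odd_edges m)"
  by (rule finite_subset[of _ "Pow {1..2 * m}"]) (auto simp: odd_edges_def)

lemma card_odd_edges: "card (odd_edges m) = m * m"
proof -
  let ?f = "\<lambda>(i, j). {2 * i + 1, 2 * j + 2 :: nat}"
  have "odd_edges m = ?f ` ({..<m} \<times> {..<m})"
  proof
    show "odd_edges m \<subseteq> ?f ` ({..<m} \<times> {..<m})"
    proof
      fix e assume "e \<in> odd_edges m"
      then obtain i j where ij: "e = {i, j}" "i \<in> {1..2 * m}" "j \<in> {1..2 * m}" "odd (int j - int i)"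
        unfolding odd_edges_def by blast
      obtain p q where e: "e = {p, q}" "odd p" "even q" "p \<in> {1..2 * m}" "q \<in> {1..2 * m}"
      proof (cases "odd i")
        case True
        then show thesis using that[of i j] ij by simp
      next
        case False
        then show thesis using that[of j i] ij by (simp add: insert_commute)
      qed
      obtain i where "p = 2 * i + 1" using e(2) by (elim oddE)
      moreover obtain j where "q = 2 * j + 2"
      proof -
        obtain k where "q = 2 * k" using e(3) by (elim evenE)
        then show thesis using that[of "k - 1"] e(5) by auto
      qed
      ultimately show "e \<in> ?f ` ({..<m} \<times> {..<m})" using e by (auto intro!: image_eqI[of _ _ "(i,
          j)"])
    qed
    show "?f ` ({..<m} \<times> {..<m}) \<subseteq> odd_edges m"
    proof
      fix e assume "e \<in> ?f ` ({..<m} \<times> {..<m})"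
      then obtain i j where ij: "i < m" "j < m" "e = {2 * i + 1, 2 * j + 2}" by auto
      have "2 * i + 1 \<in> {1..2 * m}" "2 * j + 2 \<in> {1..2 * m}" "odd (int (2 * j + 2) - int (2 * i +
          1))"
        using ij by simp_all
      then show "e \<in> odd_edges m" unfolding odd_edges_def ij(3) by blast
    qed
  qed
  moreover have "inj_on ?f ({..<m} \<times> {..<m})"
    by (auto simp: inj_on_def doubleton_eq_iff) presburger+
  ultimately show ?thesis by (simp add: card_image)
qed

text \<open>Start where the partial sums are smallest.\<close>

lemma cycle_lemma:
  fixes f :: "nat \<Rightarrow> int"
  assumes per: "\<And>t. f (t + T) = f t" and T: "T > 0" and zero: "(\<Sum>t<T. f t) = 0"
  obtains s where "\<forall>k. (\<Sum>i<k. f (s + i)) \<ge> 0"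
proof -
  define P where "P k = (\<Sum>i<k. f i)" for k
  have split: "P (s + k) = P s + (\<Sum>i<k. f (s + i))" for s k
    by (induction k) (auto simp: P_def)
  have "P (T + k) = P k" for k
    using split[of T k] zero per by (simp add: P_def add.commute[of T])
  then have shift: "P (k + T) = P k" for k by (metis add.commute)
  have mult: "P (k mod T + T * j) = P (k mod T)" for k j
  proof (induction j)
    case (Suc j)
    then show ?case using shift[of "k mod T + T * j"] by (simp add: add.assoc add.commute[of T])
  qed simp
  have P_mod: "P k = P (k mod T)" for k using mult[of k "k div T"] by simp
  have "Min (P ` {..<T}) \<in> P ` {..<T}" using T by (intro Min_in) auto
  then obtain s where s: "Min (P ` {..<T}) = P s" by blast
  have le: "P s \<le> P k" if "k < T" for k using that unfolding s[symmetric] by (intro Min_le) auto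
  have "(\<Sum>i<k. f (s + i)) \<ge> 0" for k
    using split[of s k] le[of "(s + k) mod T"] P_mod[of "s + k"] T by simp
  then show thesis using that by blast
qed

section \<open>1-rainbow cycles as periodic sequences\<close>

locale flip_cycle =
  fixes m T :: nat and M :: "nat \<Rightarrow> nat set set"
  assumes m: "m > 0" and T: "T > 0"
    and matching: "\<And>t. M t \<in> noncrossing_matchings m"
    and flip: "\<And>t. flip (M t) (M (Suc t))"
    and period: "\<And>t. M (t + T) = M t"
    and once: "\<And>e. e \<in> odd_edges m \<Longrightarrow> card {t. t < T \<and> e \<in> M (Suc t) - M t} = 1"
begin

definition enters :: "nat \<Rightarrow> nat set \<Rightarrow> bool" where
  "enters t e \<longleftrightarrow> e \<in> M (Suc t) - M t"

definition quad :: "nat \<Rightarrow> int \<Rightarrow> int \<Rightarrow> int \<Rightarrow> int \<Rightarrow> bool" where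
  "quad t a b c d \<longleftrightarrow> a < b \<and> b < c \<and> c < d \<and> d < a + 2 * int m \<and>
     joined m (M t) a b \<and> joined m (M t) c d \<and>
     M (Suc t) = M t - {{pt m a, pt m b}, {pt m c, pt m d}} \<union> {{pt m b, pt m c}, {pt m d, pt m a}}"

lemma quad_ex: obtains a b c d where "quad t a b c d"
  using flip_quadrilateral[OF matching matching m flip, of t] unfolding quad_def by metis

lemma quad_distinct:
  assumes "quad t a b c d"
  shows "distinct [pt m a, pt m b, pt m c, pt m d]"
  using assms pt_inj[of m a b] pt_inj[of m a c] pt_inj[of m a d] pt_inj[of m b c] pt_inj[of m b d]
      pt_inj[of m c d]
  by (auto simp: quad_def)

lemma quad_enters:
  assumes q: "quad t a b c d"
  shows "M (Suc t) - M t = {{pt m b, pt m c}, {pt m d, pt m a}}"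
    and "M t - M (Suc t) = {{pt m a, pt m b}, {pt m c, pt m d}}"
proof -
  have d: "distinct [pt m a, pt m b, pt m c, pt m d]" using quad_distinct[OF q] .
  have old: "{pt m a, pt m b} \<in> M t" "{pt m c, pt m d} \<in> M t"
    and new: "M (Suc t) = M t - {{pt m a, pt m b}, {pt m c, pt m d}} \<union> {{pt m b, pt m c}, {pt m d,
        pt m a}}"
    using q by (auto simp: quad_def joined_def)
  have "{pt m b, pt m c} \<notin> M t"
    using edge_disjoint[OF matching m old(1), of "{pt m b, pt m c}" "pt m b"] d by (auto simp:
        doubleton_eq_iff)
  moreover have "{pt m d, pt m a} \<notin> M t"
    using edge_disjoint[OF matching m old(1), of "{pt m d, pt m a}" "pt m a"] d by (auto simp:
        doubleton_eq_iff)
  ultimately show "M (Suc t) - M t = {{pt m b, pt m c}, {pt m d, pt m a}}" using new by auto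
  show "M t - M (Suc t) = {{pt m a, pt m b}, {pt m c, pt m d}}"
    using new old d by (auto simp: doubleton_eq_iff)
qed

lemma period_mult: "M (t + k * T) = M t"
  by (induction k) (auto simp: period add.assoc[symmetric] add.commute[of T])

lemma period_mod: "M (t mod T) = M t"
  using period_mult[of "t mod T" "t div T"] by simp

lemma enters_mod: "enters t e \<longleftrightarrow> enters (t mod T) e"
proof -
  have "M (Suc t) = M (Suc (t mod T))" by (metis mod_Suc_eq period_mod)
  then show ?thesis by (simp add: enters_def period_mod)
qed

lemma finite_M: "finite (M t)" using finite_matching[OF matching m] .

lemma M_odd: "M t \<subseteq> odd_edges m" using matching_odd_edges[OF matching m] .

lemma sum_entering:
  fixes w :: "nat set \<Rightarrow> int"
  shows "(\<Sum>t<T. \<Sum>e\<in>M (Suc t) - M t. w e) = (\<Sum>e\<in>odd_edges m. w e)"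
proof -
  have "(\<Sum>e\<in>M (Suc t) - M t. w e) = (\<Sum>e\<in>odd_edges m. if e \<in> M (Suc t) - M t then w e else 0)" for t
  proof -
    have "M (Suc t) - M t = odd_edges m \<inter> (M (Suc t) - M t)" using M_odd by blast
    then show ?thesis by (metis finite_odd_edges sum.inter_restrict)
  qed
  then have "(\<Sum>t<T. \<Sum>e\<in>M (Suc t) - M t. w e) = (\<Sum>t<T. \<Sum>e\<in>odd_edges m. if e \<in> M (Suc t) - M t then
      w e else 0)"
    by simp
  also have "\<dots> = (\<Sum>e\<in>odd_edges m. \<Sum>t<T. if e \<in> M (Suc t) - M t then w e else 0)"
    by (rule sum.swap)
  also have "\<dots> = (\<Sum>e\<in>odd_edges m. w e)"
  proof (rule sum.cong)
    fix e assume "e \<in> odd_edges m"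
    have "(\<Sum>t<T. if e \<in> M (Suc t) - M t then w e else 0) = (\<Sum>t\<in>{t. t < T \<and> e \<in> M (Suc t) - M t}. w
        e)"
      by (rule sum.mono_neutral_cong_right) auto
    also have "\<dots> = w e" using once[OF \<open>e \<in> odd_edges m\<close>] unfolding sum_constant by simp
    finally show "(\<Sum>t<T. if e \<in> M (Suc t) - M t then w e else 0) = w e" .
  qed simp
  finally show ?thesis .
qed

text \<open>Entering minus leaving weight telescopes to the weight of \<open>M T\<close> minus that
  of \<open>M 0\<close>, which is 0; hence each label counts once among the leaving edges as
  well.\<close>

lemma sum_leaving:
  fixes w :: "nat set \<Rightarrow> int"
  shows "(\<Sum>t<T. \<Sum>e\<in>M t - M (Suc t). w e) = (\<Sum>e\<in>odd_edges m. w e)"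
proof -
  have step: "(\<Sum>e\<in>M (Suc t) - M t. w e) - (\<Sum>e\<in>M t - M (Suc t). w e) = (\<Sum>e\<in>M (Suc t). w e) - (\<Sum>e\<in>M
      t. w e)" for t
    using sum.Int_Diff[OF finite_M, of w "Suc t" "M t"] sum.Int_Diff[OF finite_M, of w t "M (Suc
        t)"]
    by (simp add: Int_commute)
  have "(\<Sum>t<T. (\<Sum>e\<in>M (Suc t) - M t. w e) - (\<Sum>e\<in>M t - M (Suc t). w e)) = (\<Sum>e\<in>M T. w e) - (\<Sum>e\<in>M 0. w
      e)"
    unfolding step by (rule sum_lessThan_telescope)
  also have "\<dots> = 0" using period[of 0] by simp
  finally show ?thesis using sum_entering[of w] by (simp add: sum_subtractf)
qed

lemma twice_T: "2 * T = m * m"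
proof -
  have "card (M (Suc t) - M t) = 2" for t
  proof -
    obtain a b c d where q: "quad t a b c d" by (rule quad_ex)
    show ?thesis using quad_distinct[OF q] by (simp add: quad_enters[OF q] doubleton_eq_iff)
  qed
  then have "(\<Sum>t<T. \<Sum>e\<in>M (Suc t) - M t. 1::int) = 2 * int T" by simp
  then have "2 * int T = int (card (odd_edges m))" using sum_entering[of "\<lambda>_. 1"] by simp
  then show ?thesis by (simp add: card_odd_edges) (metis of_nat_eq_iff of_nat_mult of_nat_numeral)
qed

lemma even_m: "even m"
  using twice_T by (metis dvd_triv_left even_mult_iff)

lemma enters_once:
  assumes "enters t e" "enters t' e" "t < t'"
  shows "t + T \<le> t'"
proof -
  have "e \<in> odd_edges m" using assms M_odd by (auto simp: enters_def)
  then obtain s where s: "{t. t < T \<and> e \<in> M (Suc t) - M t} = {s}"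
    using once by (metis card_1_singletonE)
  have "t mod T \<in> {t. t < T \<and> e \<in> M (Suc t) - M t}" "t' mod T \<in> {t. t < T \<and> e \<in> M (Suc t) - M t}"
    using assms enters_mod T by (simp_all add: enters_def)
  then have "t mod T = t' mod T" unfolding s by simp
  then have "T dvd (t' - t)" using assms(3) by (metis mod_eq_dvd_iff_nat less_imp_le)
  then have "T \<le> t' - t" using assms(3) by (intro dvd_imp_le) auto
  then show ?thesis using assms(3) by simp
qed

lemma enters_window:
  assumes "e \<in> odd_edges m"
  obtains t where "s \<le> t" "t < s + T" "enters t e"
proof -
  obtain t0 where t0: "t0 < T" "enters t0 e"
    using once[OF assms] by (auto simp: enters_def card_1_singleton_iff)
  \<comment> \<open>The residue \<open>t0\<close> taken in the block of \<open>s\<close>, or in the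
    next block if it has already passed there.\<close>
  define t where "t = (if s mod T \<le> t0 then s - s mod T + t0 else s - s mod T + T + t0)"
  have le: "s mod T \<le> s" by simp
  have lt: "s mod T < T" using T by simp
  have "s - s mod T = T * (s div T)" by (simp add: minus_mod_eq_mult_div)
  then have "t mod T = t0" using t0 by (auto simp: t_def add.assoc)
  then have "enters t e" using t0 enters_mod[of t e] by simp
  moreover have "s \<le> t \<and> t < s + T"
  proof -
    define r where "r = s mod T"
    have "r \<le> s" "r < T" using le lt by (simp_all add: r_def)
    then show ?thesis using t0(1) unfolding t_def r_def[symmetric] by (cases "r \<le> t0") auto
  qed
  ultimately show thesis using that by blast
qed

lemma enters_between:
  assumes "e \<notin> M s" "e \<in> M t" "s \<le> t"
  obtains u where "s \<le> u" "u < t" "enters u e"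
proof -
  have "\<exists>u. s \<le> u \<and> u < t \<and> enters u e"
    using assms(3,2)
  proof (induction t rule: dec_induct)
    case (step n)
    then show ?case by (cases "e \<in> M n") (auto simp: enters_def less_Suc_eq)
  qed (use assms(1) in simp)
  then show thesis using that by blast
qed

end

section \<open>Every flip is centred\<close>

definition edge_len :: "nat \<Rightarrow> nat set \<Rightarrow> nat" where
  "edge_len m e = min (Max e - Min e) (2 * m - (Max e - Min e))"

lemma edge_len_pt:
  assumes "x < y" "y < x + 2 * int m"
  shows "int (edge_len m {pt m x, pt m y}) = min (y - x) (2 * int m - (y - x))"
proof -
  have m: "m > 0" using assms by linarith
  define p q where "p = int (pt m x)" and "q = int (pt m y)"
  have pq: "1 \<le> p" "p \<le> 2 * int m" "1 \<le> q" "q \<le> 2 * int m"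
    using pt_range[OF m, of x] pt_range[OF m, of y] by (auto simp: p_def q_def)
  have "(q - p) mod (2 * int m) = (y - x) mod (2 * int m)"
    unfolding p_def q_def using pt_cong[OF m, of x] pt_cong[OF m, of y] by (rule
        mod_diff_cong[rotated])
  then have "(2 * int m) dvd ((q - p) - (y - x))" by (simp add: mod_eq_dvd_iff)
  then obtain k where k: "q - p = (y - x) + 2 * int m * k" by (metis dvdE diff_eq_eq add.commute)
  \<comment> \<open>Both labels lie in one turn, so \<open>q - p\<close> is the clockwise distance
    \<open>y - x\<close> itself or that distance minus one turn.\<close>
  have "k = 0 \<or> k = - 1"
  proof -
    have "2 * int m * k < 2 * int m * 1" "2 * int m * k > 2 * int m * (- 2)" using k pq assms by
        linarith+
    then have "k < 1" "k > - 2" using m by (metis mult_less_cancel_left_pos of_nat_0_less_iff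
        mult_pos_pos zero_less_numeral)+
    then show ?thesis by linarith
  qed
  then have "\<bar>q - p\<bar> = y - x \<or> \<bar>q - p\<bar> = 2 * int m - (y - x)" using k assms by auto
  moreover have "int (Max {pt m x, pt m y} - Min {pt m x, pt m y}) = \<bar>q - p\<bar>"
    by (auto simp: p_def q_def max_def min_def)
  moreover have "\<bar>q - p\<bar> \<le> 2 * int m" using pq by linarith
  ultimately show ?thesis unfolding edge_len_def by (auto simp: of_nat_diff min_def)
qed

text \<open>Every edge has a unique endpoint from which the clockwise way to the other end is the
  short one, because the odd lengths differ from the even number \<open>2 * h\<close>. So edges
  correspond to a start \<open>s\<close> and an index \<open>k < h\<close>, and each length occurs
  \<open>4 * h\<close> times.\<close>

lemma sum_odd_edges:
  fixes w :: "nat \<Rightarrow> int"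
  assumes h: "h > 0"
  shows "(\<Sum>e\<in>odd_edges (2 * h). w (edge_len (2 * h) e)) = 4 * int h * (\<Sum>k<h. w (2 * k + 1))"
proof -
  let ?m = "2 * h"
  let ?f = "\<lambda>(s, k). {pt ?m (int s), pt ?m (int s + 2 * int k + 1)}"
  let ?D = "{1..2 * ?m} \<times> {..<h}"
  have len: "edge_len ?m (?f (s, k)) = 2 * k + 1" if "k < h" for s k
    using edge_len_pt[of "int s" "int s + 2 * int k + 1" ?m] that by auto
  have inj: "inj_on ?f ?D"
  proof (rule inj_onI)
    fix u v assume u: "u \<in> ?D" and v: "v \<in> ?D" and eq: "?f u = ?f v"
    obtain s k s' k' where uv: "u = (s, k)" "v = (s', k')" by fastforce
    have r: "s \<in> {1..2 * ?m}" "s' \<in> {1..2 * ?m}" "k < h" "k' < h" using u v uv by auto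
    have "2 * k + 1 = 2 * k' + 1" using len[OF r(3), of s] len[OF r(4), of s'] eq uv by simp
    then have k: "k = k'" by simp
    have m0: "?m > 0" using h by simp
    have "pt ?m (int s) = pt ?m (int s')"
    proof (rule ccontr)
      assume "pt ?m (int s) \<noteq> pt ?m (int s')"
      then have "pt ?m (int s) = pt ?m (int s' + 2 * int k + 1)" "pt ?m (int s') = pt ?m (int s +
          2 * int k + 1)"
        using eq uv k by (auto simp: doubleton_eq_iff)
      then have "(2 * int ?m) dvd (int s' + 2 * int k + 1 - int s)" "(2 * int ?m) dvd (int s + 2 *
          int k + 1 - int s')"
        using pt_eqD[OF m0] by blast+
      then have "(2 * int ?m) dvd ((int s' + 2 * int k + 1 - int s) + (int s + 2 * int k + 1 - int
          s'))" by (rule dvd_add)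
      \<comment> \<open>If start and end could be exchanged, the two short ways would add up to full
        turns, but \<open>4 * k + 2\<close> is not divisible by 4.\<close>
      then have "4 * int h dvd 4 * int k + 2" by (simp add: algebra_simps)
      then have "(4::int) dvd 4 * int k + 2" by (metis dvd_mult_left)
      then show False by presburger
    qed
    then show "u = v" using r k uv by (simp add: pt_int)
  qed
  have img: "?f ` ?D = odd_edges ?m"
  proof
    show "?f ` ?D \<subseteq> odd_edges ?m"
    proof
      fix e assume "e \<in> ?f ` ?D"
      then obtain s k where e: "e = {pt ?m (int s), pt ?m (int s + 2 * int k + 1)}" by auto
      have m0: "?m > 0" using h by simp
      have "odd (int (pt ?m (int s + 2 * int k + 1)) - int (pt ?m (int s)))"
        using pt_even_diff[OF m0, of "int s"] pt_even_diff[OF m0, of "int s + 2 * int k + 1"] by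
            simp
      then show "e \<in> odd_edges ?m" unfolding odd_edges_def e using pt_range[OF m0] by blast
    qed
    show "odd_edges ?m \<subseteq> ?f ` ?D"
    proof
      fix e assume "e \<in> odd_edges ?m"
      then obtain i0 j0 where e0: "e = {i0, j0}" "i0 \<in> {1..2 * ?m}" "j0 \<in> {1..2 * ?m}" "odd (int
          j0 - int i0)"
        unfolding odd_edges_def by blast
      obtain i j where e: "e = {i, j}" "i \<in> {1..2 * ?m}" "j \<in> {1..2 * ?m}" "odd (int j - int i)"
          "i < j"
      proof (cases "i0 < j0")
        case True
        then show thesis using that[of i0 j0] e0 by simp
      next
        case False
        then have "j0 < i0" using e0(4) by (cases "i0 = j0") auto
        then show thesis using that[of j0 i0] e0 by (simp add: insert_commute)
      qed
      define d where "d = j - i"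
      have d: "odd d" "j = i + d" using e by (auto simp: d_def)
      then obtain k where k: "d = 2 * k + 1" by (elim oddE)
      show "e \<in> ?f ` ?D"
      proof (cases "k < h")
        case True
        have "int i + 2 * int k + 1 = int j" using d k by simp
        then have "e = ?f (i, k)" using e by (simp add: pt_int)
        then show ?thesis using True e by blast
      next
        case False
        \<comment> \<open>The way from \<open>i\<close> to \<open>j\<close> is the long one; the
          index \<open>k'\<close> belongs to the way from \<open>j\<close> back to
          \<open>i\<close>.\<close>
        define k' where "k' = 2 * h - 1 - k"
        have k': "k' < h" "k + k' + 1 = 2 * h" using False e d k by (auto simp: k'_def)
        then have "int j + 2 * int k' + 1 = int i + 2 * int ?m" using d k by simp
        then have "e = ?f (j, k')" using e pt_add[of ?m "int i"] by (simp add: pt_int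
            insert_commute)
        then show ?thesis using k' e by blast
      qed
    qed
  qed
  have "(\<Sum>e\<in>odd_edges ?m. w (edge_len ?m e)) = (\<Sum>u\<in>?D. w (edge_len ?m (?f u)))"
    unfolding img[symmetric] by (rule sum.reindex[OF inj, unfolded o_def])
  also have "\<dots> = (\<Sum>(s, k)\<in>?D. w (2 * k + 1))"
    by (rule sum.cong) (use len in auto)
  also have "\<dots> = (\<Sum>s\<in>{1..2 * ?m}. \<Sum>k<h. w (2 * k + 1))"
    by (rule sum.cartesian_product[symmetric])
  also have "\<dots> = 4 * int h * (\<Sum>k<h. w (2 * k + 1))" by simp
  finally show ?thesis .
qed

lemma sum_odd_squares: "(\<Sum>k<h. int (2 * k + 1)) = int h * int h"
  by (induction h) (auto simp: algebra_simps)

locale even_flip_cycle = flip_cycle +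
  fixes h :: nat
  assumes m_eq: "m = 2 * h"
begin

lemma h_pos: "h > 0" using m m_eq by simp

lemma sum_flips:
  fixes w :: "nat \<Rightarrow> int"
  shows "(\<Sum>t<T. \<Sum>e\<in>M (Suc t) - M t. w (edge_len m e)) = 4 * int h * (\<Sum>k<h. w (2 * k + 1))"
    and "(\<Sum>t<T. \<Sum>e\<in>M t - M (Suc t). w (edge_len m e)) = 4 * int h * (\<Sum>k<h. w (2 * k + 1))"
  unfolding sum_entering sum_leaving using sum_odd_edges[OF h_pos, of w] m_eq by simp_all

lemma sum_quad:
  fixes v w :: "nat \<Rightarrow> int"
  assumes q: "quad t a b c d"
  shows "(\<Sum>e\<in>M (Suc t) - M t. w (edge_len m e)) = w (edge_len m {pt m b, pt m c}) + w (edge_len m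
      {pt m d, pt m a})"
    and "(\<Sum>e\<in>M t - M (Suc t). v (edge_len m e)) = v (edge_len m {pt m a, pt m b}) + v (edge_len m
        {pt m c, pt m d})"
  unfolding quad_enters[OF q] using quad_distinct[OF q] by (simp_all add: doubleton_eq_iff)

text \<open>The four lengths at a flip add up to at most \<open>2 * m\<close>, with equality only
  if the quadrilateral contains the centre; averaged over the cycle they add up to exactly
  \<open>2 * m\<close>.\<close>

lemma quad_lengths:
  assumes q: "quad t a b c d"
  shows "int (edge_len m {pt m b, pt m c}) = min (c - b) (2 * int m - (c - b))"
    and "int (edge_len m {pt m d, pt m a}) = min (a + 2 * int m - d) (d - a)"
    and "int (edge_len m {pt m a, pt m b}) = min (b - a) (2 * int m - (b - a))"
    and "int (edge_len m {pt m c, pt m d}) = min (d - c) (2 * int m - (d - c))"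
  using q edge_len_pt[of b c m] edge_len_pt[of d "a + 2 * int m" m] edge_len_pt[of a b m]
      edge_len_pt[of c d m]
  by (auto simp: quad_def pt_add)

definition total_len :: "nat \<Rightarrow> int" where
  "total_len t = (\<Sum>e\<in>M (Suc t) - M t. int (edge_len m e)) + (\<Sum>e\<in>M t - M (Suc t). int (edge_len m
      e))"

lemma total_len_quad:
  assumes q: "quad t a b c d"
  shows "total_len t = min (b - a) (2 * int m - (b - a)) + min (c - b) (2 * int m - (c - b))
    + min (d - c) (2 * int m - (d - c)) + min (a + 2 * int m - d) (d - a)"
  unfolding total_len_def sum_quad[OF q, of int] quad_lengths[OF q] by simp

lemma total_len: "total_len t = 2 * int m"
proof -
  have le: "total_len t \<le> 2 * int m" for t
  proof -
    obtain a b c d where q: "quad t a b c d" by (rule quad_ex)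
    show ?thesis unfolding total_len_quad[OF q] by linarith
  qed
  \<comment> \<open>Entering and leaving edges contribute \<open>4 * h\<close> times the sum
    \<open>h * h\<close> of the first \<open>h\<close> odd numbers each. With
    \<open>2 * h * h\<close> flips this meets the upper bound, so every single bound is
    attained.\<close>
  have "(\<Sum>t<T. total_len t) = 8 * int h * int h * int h"
    unfolding total_len_def sum.distrib using sum_flips[of int] sum_odd_squares[of h] by (simp
        add: algebra_simps)
  moreover have "int T * (2 * int m) = 8 * int h * int h * int h"
  proof -
    have "2 * T = 4 * h * h" using twice_T m_eq by simp
    then have "2 * int T = 4 * int h * int h" by (metis of_nat_mult of_nat_numeral)
    then have "(2 * int T) * (2 * int h) = (4 * int h * int h) * (2 * int h)" by simp
    moreover have "int m = 2 * int h" using m_eq by simp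
    ultimately show ?thesis by simp
  qed
  ultimately have "(\<Sum>t<T. 2 * int m - total_len t) = 0"
    by (simp add: sum_subtractf)
  then have "total_len t = 2 * int m" if "t < T" for t
    using le that by (subst (asm) sum_nonneg_eq_0_iff) auto
  moreover have "total_len t = total_len (t mod T)"
  proof -
    have "M (Suc t) = M (Suc (t mod T))" by (metis mod_Suc_eq period_mod)
    then show ?thesis by (simp add: total_len_def period_mod)
  qed
  ultimately show ?thesis using T by simp
qed

text \<open>Attaining the bound only gives sides of at most \<open>m\<close> steps; strictness comes
  from parity, as the sides are odd and \<open>m\<close> is even.\<close>

lemma quad_centered:
  assumes q: "quad t a b c d"
  shows "b - a < int m" "c - b < int m" "d - c < int m" "a + 2 * int m - d < int m"
    and "odd (b - a)" "odd (c - b)" "odd (d - c)" "odd (d - a)"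
proof -
  have j: "joined m (M t) a b" "joined m (M t) c d" "joined m (M (Suc t)) b c" "joined m (M (Suc
      t)) a d"
    using q by (auto simp: quad_def joined_def insert_commute)
  show o: "odd (b - a)" "odd (c - b)" "odd (d - c)" "odd (d - a)"
    using j joined_odd[OF matching m] by blast+
  have le: "b - a \<le> int m" "c - b \<le> int m" "d - c \<le> int m" "a + 2 * int m - d \<le> int m"
    using total_len[of t] total_len_quad[OF q] by linarith+
  have "int m = 2 * int h" using m_eq by simp
  then have "b - a \<noteq> int m" "c - b \<noteq> int m" "d - c \<noteq> int m" "a + 2 * int m - d \<noteq> int m"
    using o by presburger+
  then show "b - a < int m" "c - b < int m" "d - c < int m" "a + 2 * int m - d < int m"
    using le by auto
qed

end

section \<open>Edges that changed since a start time\<close>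

locale anchored_flip_cycle = even_flip_cycle +
  fixes t0 :: nat
  assumes two_le_h: "2 \<le> h"
begin

definition touched :: "nat \<Rightarrow> nat set \<Rightarrow> bool" where
  "touched t e \<longleftrightarrow> (\<exists>s. t0 \<le> s \<and> s < t \<and> (e \<in> M s) \<noteq> (e \<in> M (Suc s)))"

lemma enters_touched: "enters s e \<Longrightarrow> t0 \<le> s \<Longrightarrow> s < t \<Longrightarrow> touched t e"
  by (auto simp: touched_def enters_def)

lemma touched_Suc: "t0 \<le> t \<Longrightarrow> touched (Suc t) e \<longleftrightarrow> touched t e \<or> (e \<in> M t) \<noteq> (e \<in> M (Suc t))"
  by (auto simp: touched_def less_Suc_eq)

text \<open>If \<open>e\<close> also entered at an earlier time since \<open>t0\<close>, a full
  period lies between the two entries, in which \<open>f\<close> enters. Otherwise \<open>e\<close>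
  was present at \<open>t0\<close>; an entry of \<open>f\<close> only after \<open>t\<close> would
  push \<open>e\<close> out, so that \<open>e\<close> had to enter again before
  \<open>t0 + T\<close>, less than a period after \<open>t\<close>. The second case makes the rule
  valid even though nothing is known from before \<open>t0\<close>.\<close>

lemma touched_reenters:
  assumes "t0 \<le> t" "enters t e" "touched t e" "f \<in> odd_edges m" "i \<in> e" "i \<in> f"
  shows "touched t f"
proof (cases "f = e")
  case False
  have excl: "e \<notin> M s" if "f \<in> M s" for s
    using edge_disjoint[OF matching m that _ assms(6,5)] False by blast
  show ?thesis
  proof (cases "\<exists>s. t0 \<le> s \<and> s < t \<and> enters s e")
    case True
    then obtain s where s: "t0 \<le> s" "s < t" "enters s e" by blast
    then have "s + T \<le> t" using enters_once assms(2) by blast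
    moreover obtain u where "s \<le> u" "u < s + T" "enters u f" using enters_window[OF assms(4)] .
    ultimately show ?thesis using s by (auto intro: enters_touched)
  next
    case never: False
    then obtain s where s: "t0 \<le> s" "s < t" "e \<in> M s"
      using assms(3) by (auto simp: touched_def enters_def)
    have e0: "e \<in> M t0"
    proof (rule ccontr)
      assume "e \<notin> M t0"
      then obtain u where "t0 \<le> u" "u < s" "enters u e" using enters_between s by blast
      then show False using never s by (meson less_trans)
    qed
    obtain u where u: "t0 \<le> u" "u < t0 + T" "enters u f" using enters_window[OF assms(4)] .
    show ?thesis
    proof (cases "u < t")
      case True
      then show ?thesis using u by (auto intro: enters_touched)
    next
      case False
      have "e \<notin> M (Suc u)" using u(3) excl by (simp add: enters_def)
      moreover have "e \<in> M (t0 + T)" using e0 by (simp add: period)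
      ultimately obtain v where v: "Suc u \<le> v" "v < t0 + T" "enters v e"
        using enters_between u by (metis Suc_leI)
      then have "t + T \<le> v" using enters_once[OF assms(2), of v] False by simp
      then show ?thesis using v assms(1) by simp
    qed
  qed
qed (use assms in simp)

text \<open>The edge \<open>e\<close> entered at some \<open>s\<close> after the start, and
  \<open>f\<close>, which needs \<open>e\<close>, enters within a period from \<open>s\<close>. If
  that happened only after \<open>e\<close> left at \<open>t\<close>, then \<open>e\<close> would
  have to enter a second time within this period.\<close>

lemma touched_outer:
  assumes "t0 \<le> t" "touched t e" "e \<in> M t" "e \<notin> M (Suc t)" "f \<in> odd_edges m"
    and inner: "\<And>s. f \<in> M s \<Longrightarrow> e \<in> M s"
  shows "touched t f"
proof -
  obtain s where s: "t0 \<le> s" "s < t" "enters s e"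
  proof -
    obtain r where r: "t0 \<le> r" "r < t" "(e \<in> M r) \<noteq> (e \<in> M (Suc r))"
      using assms(2) by (auto simp: touched_def)
    show thesis
    proof (cases "e \<in> M (Suc r)")
      case True
      then show thesis using that[of r] r by (auto simp: enters_def)
    next
      case False
      then obtain u where "Suc r \<le> u" "u < t" "enters u e"
        using enters_between[of e "Suc r" t] assms(3) r by auto
      then show thesis using that[of u] r by simp
    qed
  qed
  obtain u where u: "s \<le> u" "u < s + T" "enters u f" using enters_window[OF assms(5)] .
  have eu: "e \<in> M (Suc u)" using u(3) inner by (simp add: enters_def)
  have "u < t"
  proof (rule ccontr)
    assume "\<not> u < t"
    then obtain v where v: "Suc t \<le> v" "v < Suc u" "enters v e"
      using enters_between[of e "Suc t" "Suc u"] assms(4) eu by auto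
    then show False using enters_once[OF s(3) v(3)] s u by simp
  qed
  then show ?thesis using s u by (auto intro: enters_touched)
qed

end

section \<open>The search\<close>

text \<open>The search works with partial knowledge of the matchings, gathered since a fixed start
  time. Around the centre, a matching is a cyclic list of arcs of odd clockwise length less than
  \<open>m\<close>, and an arc of length \<open>2 * l + 1\<close> is indexed by \<open>l\<close>.
  Every point carries a row which records for each \<open>l\<close> whether the edge from the
  point to its \<open>(2 * l + 1)\<close>-th successor has entered or left since the start;
  \<open>Rest\<close> stands for an infinite tail of edges that have not. Positions of points are
  never stored.\<close>

datatype row = Rest | New row | Old row

fun old_at :: "nat \<Rightarrow> row \<Rightarrow> bool" where
  "old_at l Rest = False"
| "old_at 0 (New r) = False"
| "old_at 0 (Old r) = True"
| "old_at (Suc l) (New r) = old_at l r"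
| "old_at (Suc l) (Old r) = old_at l r"

fun mark :: "nat \<Rightarrow> row \<Rightarrow> row" where
  "mark 0 Rest = Old Rest"
| "mark 0 (New r) = Old r"
| "mark 0 (Old r) = Old r"
| "mark (Suc l) Rest = New (mark l Rest)"
| "mark (Suc l) (New r) = New (mark l r)"
| "mark (Suc l) (Old r) = Old (mark l r)"

lemma old_at_mark: "old_at k (mark l r) \<longleftrightarrow> k = l \<or> old_at k r"
  by (induction l r arbitrary: k rule: mark.induct; case_tac k) auto

definition all_old :: "nat \<Rightarrow> row \<Rightarrow> bool" where
  "all_old h r \<longleftrightarrow> (\<forall>l<h. old_at l r)"

definition is_new :: "nat \<Rightarrow> nat \<Rightarrow> row \<Rightarrow> bool" where
  "is_new h l r \<longleftrightarrow> l < h \<and> \<not> old_at l r"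

text \<open>If an edge enters for the second time, then the edges at its endpoints have been
  through a full period.\<close>

definition may_enter :: "nat \<Rightarrow> nat \<Rightarrow> row \<Rightarrow> bool" where
  "may_enter h l r \<longleftrightarrow> l < h \<and> (old_at l r \<longrightarrow> all_old h r)"

lemma all_old_eqs:
  "all_old 0 r = True" "all_old (Suc h) Rest = False" "all_old (Suc h) (New r) = False"
  "all_old (Suc h) (Old r) = all_old h r"
  by (auto simp: all_old_def less_Suc_eq_0_disj)

lemma is_new_eqs:
  "is_new h l Rest = (l < h)"
  "is_new 0 l (New r) = False" "is_new 0 l (Old r) = False"
  "is_new (Suc h) 0 (New r) = True" "is_new (Suc h) 0 (Old r) = False"
  "is_new (Suc h) (Suc l) (New r) = is_new h l r" "is_new (Suc h) (Suc l) (Old r) = is_new h l r"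
  by (auto simp: is_new_def)

text \<open>Past a \<open>New\<close> entry the row can no longer be entirely old, so the entering
  edge itself must be new; this is why the recursion switches to \<open>is_new\<close>.\<close>

lemma may_enter_eqs:
  "may_enter h l Rest = (l < h)"
  "may_enter 0 l (New r) = False" "may_enter 0 l (Old r) = False"
  "may_enter (Suc h) 0 (New r) = True" "may_enter (Suc h) 0 (Old r) = all_old h r"
  "may_enter (Suc h) (Suc l) (New r) = is_new h l r" "may_enter (Suc h) (Suc l) (Old r) =
      may_enter h l r"
  by (auto simp: may_enter_def is_new_def all_old_eqs)

text \<open>An \<open>Arc l a b k\<close> is an edge that entered after the start, with the rows
  of its two endpoints and the items below it; \<open>Free ps\<close> is a block of points which
  are matched among each other in an unknown way that has not changed since the start.\<close>

datatype item = Arc nat row row "item list" | Free "row list"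

text \<open>In \<open>Cut (Gap w l b) (Sides A a k R)\<close>, an arc of index \<open>l\<close>
  with endpoint rows \<open>a\<close>, \<open>b\<close> and items \<open>k\<close> below it
  leaves; \<open>A\<close> lists the items before it in reverse order, they comprise \<open>2 *
  w\<close> points, and \<open>R\<close> lists the items after it.\<close>

datatype gap = Gap nat nat row
datatype sides = Sides "item list" row "item list" "item list"
datatype cut = Cut gap sides

fun rev_onto :: "'a list \<Rightarrow> 'a list \<Rightarrow> 'a list" where
  "rev_onto [] ys = ys"
| "rev_onto (x # xs) ys = rev_onto xs (x # ys)"

lemma rev_onto_eq: "rev_onto xs ys = rev xs @ ys"
  by (induction xs arbitrary: ys) auto

fun free :: "row list \<Rightarrow> item list \<Rightarrow> item list" where
  "free [] its = its"
| "free (x # xs) its = Free (x # xs) # its"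

fun cons_if :: "bool \<Rightarrow> 'a \<Rightarrow> 'a list \<Rightarrow> 'a list" where
  "cons_if True x xs = x # xs"
| "cons_if False x xs = xs"

text \<open>An edge of length 3 can only be present together with the edge of length 1 below it.
  Hence an edge of length 1 that entered after the start cannot leave before the edge of length 3
  above it was used.\<close>

fun leaf_ok :: "nat \<Rightarrow> row \<Rightarrow> bool" where
  "leaf_ok 0 p = old_at (Suc 0) p"
| "leaf_ok (Suc l) p = True"

text \<open>Possible edges inside a free block with left end \<open>a\<close>: \<open>k\<close>
  holds the \<open>2 * l\<close> points skipped so far in reverse, and two points are skipped at a
  time, as the points below an edge are matched among themselves. An edge in such a block has not
  changed since the start, so an old entry in the row rules it out; \<open>mark\<close> records that
  it leaves now.\<close>

fun cuts_at :: "item list \<Rightarrow> nat \<Rightarrow> row \<Rightarrow> row list \<Rightarrow> nat \<Rightarrow> row list \<Rightarrow> item list \<Rightarrow> cut list" where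
  "cuts_at A w a k l (b # c # ps) its =
     cons_if (\<not> old_at l a)
       (Cut (Gap w l b) (Sides A (mark l a) (free (rev_onto k []) []) (Free (c # ps) # its)))
       (cuts_at A w a (c # b # k) (Suc l) ps its)"
| "cuts_at A w a k l [b] its =
     cons_if (\<not> old_at l a) (Cut (Gap w l b) (Sides A (mark l a) (free (rev_onto k []) []) its)) []"
| "cuts_at A w a k l [] its = []"

text \<open>An arc can only leave as a whole, since everything below it is hidden. In a free block
  the left end advances by two points, so that the points before the edge can be matched among
  themselves. The row \<open>p\<close> of the preceding point is carried along for
  \<open>leaf_ok\<close>.\<close>

function (sequential) cuts :: "item list \<Rightarrow> nat \<Rightarrow> row \<Rightarrow> item list \<Rightarrow> cut list"
  and free_cuts :: "item list \<Rightarrow> nat \<Rightarrow> row list \<Rightarrow> row \<Rightarrow> row list \<Rightarrow> item list \<Rightarrow> cut list" where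
  "cuts A w p [] = []"
| "cuts A w p (Arc l a b k # its) =
     cons_if (leaf_ok l p) (Cut (Gap w l b) (Sides A a k its)) (cuts (Arc l a b k # A) (Suc (l +
         w)) b its)"
| "cuts A w p (Free ps # its) = free_cuts A w [] p ps its"
| "free_cuts A w q p (a # b # ps) its =
     cuts_at (free (rev_onto q []) A) w a [] 0 (b # ps) its @ free_cuts A (Suc w) (b # a # q) b ps
         its"
| "free_cuts A w q p ps its = cuts (free (rev_onto q []) A) w p its"
  by pat_completeness auto
termination by size_change

fun width :: "item list \<Rightarrow> nat" where
  "width [] = 0"
| "width (Arc l a b k # its) = 2 * l + 2 + width its"
| "width (Free ps # its) = length ps + width its"

fun last_row :: "row \<Rightarrow> item list \<Rightarrow> row" where
  "last_row p [] = p"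
| "last_row p (Arc l a b k # its) = last_row b its"
| "last_row p (Free ps # its) = last_row (last ps) its"

fun proper :: "item list \<Rightarrow> bool" where
  "proper [] = True"
| "proper (Arc l a b k # its) = proper its"
| "proper (Free ps # its) = (ps \<noteq> [] \<and> even (length ps) \<and> proper its)"

lemma width_append [simp]: "width (A @ B) = width A + width B"
  by (induction A rule: width.induct) auto

lemma width_free [simp]: "width (free ps its) = length ps + width its"
  by (cases ps) auto

lemma even_width: "proper its \<Longrightarrow> even (width its)"
  by (induction its rule: width.induct) auto

lemma free_cuts_skip:
  assumes "even (length ps)"
  shows "set (cuts (free (rev q @ ps) A) (w + length ps div 2) (last (p # ps)) its) \<subseteq> set
      (free_cuts A w q p ps its)"
  using assms
proof (induction "length ps" arbitrary: ps q w p rule: less_induct)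
  case less
  show ?case
  proof (cases ps)
    case Nil
    then show ?thesis by (simp add: rev_onto_eq)
  next
    case (Cons a ps')
    then obtain b ps'' where ps: "ps = a # b # ps''" using less.prems by (cases ps') auto
    show ?thesis using less.hyps[of ps'' "b # a # q" "Suc w" b] less.prems ps by (auto simp:
        rev_onto_eq)
  qed
qed

lemma cuts_Free_skip:
  assumes "ps \<noteq> []" "even (length ps)"
  shows "set (cuts (Free ps # A) (w + length ps div 2) (last ps) its) \<subseteq> set (cuts A w p (Free ps #
      its))"
  using free_cuts_skip[OF assms(2), of "[]" A w p its] assms by (cases ps) auto

text \<open>Inclusion suffices throughout: for a refutation every possible cut has to be listed, and
  listing impossible ones does no harm.\<close>

lemma cuts_skip:
  assumes "proper its1"
  shows "set (cuts (rev its1 @ A) (w + width its1 div 2) (last_row p its1) its2) \<subseteq> set (cuts A w p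
      (its1 @ its2))"
  using assms
proof (induction its1 arbitrary: A w p)
  case (Cons it its1)
  show ?case
  proof (cases it)
    case (Arc l a b k)
    have "set (cuts (rev its1 @ it # A) (Suc (l + w) + width its1 div 2) (last_row b its1) its2)
        \<subseteq> set (cuts (it # A) (Suc (l + w)) b (its1 @ its2))"
      using Cons.IH[of "it # A" "Suc (l + w)" b] Cons.prems Arc by simp
    also have "\<dots> \<subseteq> set (cuts A w p (it # its1 @ its2))"
      unfolding Arc cuts.simps by (cases "leaf_ok l p") auto
    finally show ?thesis using Arc by (simp add: ac_simps)
  next
    case (Free ps)
    have p: "ps \<noteq> []" "even (length ps)" "proper its1" using Cons.prems Free by auto
    have "set (cuts (rev its1 @ it # A) (w + length ps div 2 + width its1 div 2) (last_row (last
        ps) its1) its2)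
        \<subseteq> set (cuts (it # A) (w + length ps div 2) (last ps) (its1 @ its2))"
      using Cons.IH[OF p(3)] .
    also have "\<dots> \<subseteq> set (cuts A w p (it # its1 @ its2))"
      unfolding Free using cuts_Free_skip[OF p(1,2)] .
    finally show ?thesis using Free p div_plus_div_distrib_dvd_left[of 2 "length ps" "width its1"]
      by (simp add: ac_simps)
  qed
qed simp

lemma cuts_Arc:
  assumes "proper its1" "leaf_ok l (last_row p its1)"
  shows "Cut (Gap (w + width its1 div 2) l b) (Sides (rev its1 @ A) a k its2)
    \<in> set (cuts A w p (its1 @ Arc l a b k # its2))"
  using cuts_skip[OF assms(1), of A w p "Arc l a b k # its2"] assms(2) by auto

lemma cuts_at_mem:
  assumes "even (length k')" "\<not> old_at (l + length k' div 2) a"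
  shows "Cut (Gap w (l + length k' div 2) b) (Sides A (mark (l + length k' div 2) a) (free (rev k
      @ k') []) (free r its))
    \<in> set (cuts_at A w a k l (k' @ b # r) its)"
  using assms
proof (induction "length k'" arbitrary: k' k l rule: less_induct)
  case less
  show ?case
  proof (cases k')
    case Nil
    then show ?thesis using less.prems by (cases r) (auto simp: rev_onto_eq)
  next
    case (Cons c k1)
    then obtain d k2 where k': "k' = c # d # k2" using less.prems by (cases k1) auto
    have "Cut (Gap w (Suc l + length k2 div 2) b) (Sides A (mark (Suc l + length k2 div 2) a)
        (free (rev (d # c # k) @ k2) []) (free r its)) \<in> set (cuts_at A w a (d # c # k) (Suc l)
            (k2 @ b # r) its)"
      using less.hyps[of k2 "Suc l" "d # c # k"] less.prems k' by auto
    moreover have "set (cuts_at A w a (d # c # k) (Suc l) (k2 @ b # r) its) \<subseteq> set (cuts_at A w a k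
        l (k' @ b # r) its)"
      using k' by (cases "old_at l a") auto
    ultimately show ?thesis using k' by auto
  qed
qed

lemma free_cuts_mem:
  assumes "even (length q')" "even (length k)" "\<not> old_at (length k div 2) a"
  shows "Cut (Gap (w + length q' div 2) (length k div 2) b)
      (Sides (free (rev q @ q') A) (mark (length k div 2) a) (free k []) (free r its))
    \<in> set (free_cuts A w q p (q' @ a # k @ b # r) its)"
  using assms(1)
proof (induction "length q'" arbitrary: q' q w p rule: less_induct)
  case less
  show ?case
  proof (cases q')
    case Nil
    obtain c s where cs: "k @ b # r = c # s" by (cases k) auto
    have "set (cuts_at (free (rev q) A) w a [] 0 (k @ b # r) its) \<subseteq> set (free_cuts A w q p (a # k
        @ b # r) its)"
      unfolding cs by (simp add: rev_onto_eq)
    then show ?thesis using cuts_at_mem[OF assms(2), of 0 a w b "free (rev q) A" "[]" r its]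
        assms(3) Nil by auto
  next
    case (Cons c q1)
    then obtain d q2 where q': "q' = c # d # q2" using less.prems by (cases q1) auto
    then show ?thesis using less.hyps[of q2 "Suc w" "d # c # q" d] less.prems by auto
  qed
qed

lemma cuts_Free:
  assumes "proper its1" "even (length q)" "even (length k)" "\<not> old_at (length k div 2) a"
  shows "Cut (Gap (w + width its1 div 2 + length q div 2) (length k div 2) b)
      (Sides (free q (rev its1 @ A)) (mark (length k div 2) a) (free k []) (free r its2))
    \<in> set (cuts A w p (its1 @ Free (q @ a # k @ b # r) # its2))"
  using cuts_skip[OF assms(1), of A w p "Free (q @ a # k @ b # r) # its2"]
    free_cuts_mem[OF assms(2-4), of "w + width its1 div 2" b "[]" "rev its1 @ A" r its2 "last_row
        p its1"]
  by auto

text \<open>Weights of the entering (\<open>enter_weight\<close>) and the leaving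
  (\<open>leave_weight\<close>) edges by length, found by local search so as to make the search
  tree small. All that matters is that they add up to \<open>0\<close> for each of \<open>h = 3,
  4, 5\<close>.\<close>

definition enter_weight :: "nat \<Rightarrow> nat \<Rightarrow> int" where
  "enter_weight h l = (if h = 3 then [-34, 28, 8] else if h = 4 then [-13, 0, 3, 14] else [-59, 0,
      15, 11, 17]) ! l"

definition leave_weight :: "nat \<Rightarrow> nat \<Rightarrow> int" where
  "leave_weight h l = (if h = 3 then [8, 4, -14] else if h = 4 then [-2, 15, -1, -16] else [-19,
      51, 8, -12, -12]) ! l"

section \<open>One step of the search\<close>

datatype state = State int row "item list"
datatype verdict = Reject | Accept int nat
datatype first_cut = First nat nat row int
datatype flip_data = Flip first_cut sides gap sides

fun verdict_if :: "bool \<Rightarrow> int \<Rightarrow> nat \<Rightarrow> verdict" where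
  "verdict_if False W l4 = Reject"
| "verdict_if True W l4 = Accept W l4"

fun check_weight :: "int \<Rightarrow> nat \<Rightarrow> verdict" where
  "check_weight W l4 = verdict_if (0 \<le> W) W l4"

fun check_fourth :: "bool \<Rightarrow> nat \<Rightarrow> nat \<Rightarrow> int \<Rightarrow> verdict" where
  "check_fourth False h l4 V = Reject"
| "check_fourth True h l4 V = check_weight (V + enter_weight h l4) l4"

fun check_length :: "nat \<Rightarrow> nat \<Rightarrow> row \<Rightarrow> int \<Rightarrow> verdict" where
  "check_length l4 h d V = check_fourth (may_enter h l4 d) h l4 V"

fun check_second :: "bool \<Rightarrow> first_cut \<Rightarrow> gap \<Rightarrow> verdict" where
  "check_second False x g = Reject"
| "check_second True (First h r b V) (Gap l2 l3 d) = check_length (r - l2 - l3) h d (V +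
    (enter_weight h l2 + leave_weight h l3))"

fun check :: "first_cut \<Rightarrow> gap \<Rightarrow> verdict" where
  "check (First h r b V) (Gap l2 l3 d) = check_second (may_enter h l2 b) (First h r b V) (Gap l2
      l3 d)"

text \<open>The new state is read from the corner \<open>a\<close>. Items below the two leaving
  edges come to the surface; those between the leaving edges move below the entering ones. The last
  arc passes the old starting point, so it covers \<open>C\<close> and then the items
  \<open>A\<close> from before \<open>a\<close>.\<close>

fun emit :: "verdict \<Rightarrow> flip_data \<Rightarrow> state list \<Rightarrow> state list" where
  "emit Reject f acc = acc"
| "emit (Accept W l4) (Flip (First h r b V) (Sides A a k1 R) (Gap l2 l3 d) (Sides B c k3 C)) acc =
    State W a (k1 @ Arc l2 (mark l2 b) c (rev_onto B []) #
      (k3 @ [Arc l4 (mark l4 d) a (C @ rev_onto A [])])) # acc"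

fun second_cuts :: "first_cut \<Rightarrow> sides \<Rightarrow> cut list \<Rightarrow> state list \<Rightarrow> state list" where
  "second_cuts x s [] acc = acc"
| "second_cuts x s (Cut g s' # ds) acc = emit (check x g) (Flip x s g s') (second_cuts x s ds acc)"

text \<open>The indices of the four sides add up to \<open>2 * h - 2\<close>, because their lengths
  add up to \<open>4 * h\<close>; what remains after the first side is passed on and determines the
  fourth. The second leaving edge is sought only after the first.\<close>

fun first_cuts :: "nat \<Rightarrow> int \<Rightarrow> cut list \<Rightarrow> state list" where
  "first_cuts h W [] = []"
| "first_cuts h W (Cut (Gap w l b) (Sides A a k its) # ds) =
   second_cuts (First h (h + h - Suc (Suc l)) b (W + leave_weight h l)) (Sides A a k []) (cuts []
       0 b its) (first_cuts h W ds)"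

lemma check_eq:
  assumes "may_enter h l2 b" "l4 = r - l2 - l3" "may_enter h l4 d" "W = V + enter_weight h l2 +
      leave_weight h l3 + enter_weight h l4" "W \<ge> 0"
  shows "check (First h r b V) (Gap l2 l3 d) = Accept W l4"
  using assms by (simp add: add.assoc)

lemma emit_mono: "set acc \<subseteq> set (emit v (Flip x s g s') acc)"
  by (cases v; cases x; cases s; cases g; cases s') auto

lemma second_cuts_mono: "set acc \<subseteq> set (second_cuts x s ds acc)"
proof (induction ds)
  case (Cons y ds)
  obtain g s' where y: "y = Cut g s'" by (cases y)
  show ?case unfolding y second_cuts.simps using Cons emit_mono by (rule subset_trans)
qed simp

lemma second_cuts_mem:
  assumes "Cut g s' \<in> set ds" "check x g = Accept W l4"
    and "x = First h r b V" "s = Sides A a k1 R" "g = Gap l2 l3 d" "s' = Sides B c k3 C"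
  shows "State W a (k1 @ Arc l2 (mark l2 b) c (rev B) # (k3 @ [Arc l4 (mark l4 d) a (C @ rev A)]))
    \<in> set (second_cuts x s ds acc)"
  using assms(1)
proof (induction ds)
  case (Cons y ds)
  obtain g' s'' where y: "y = Cut g' s''" by (cases y)
  show ?case
  proof (cases "y = Cut g s'")
    case True
    then show ?thesis using assms(2-) by (simp add: rev_onto_eq)
  next
    case False
    then show ?thesis using Cons y emit_mono by fastforce
  qed
qed simp

lemma first_cuts_mem:
  assumes "Cut (Gap w l1 b) (Sides A a k1 R) \<in> set ds" "Cut (Gap l2 l3 d) (Sides B c k3 C) \<in> set
      (cuts [] 0 b R)"
    and "may_enter h l2 b" "l4 = h + h - Suc (Suc l1) - l2 - l3" "may_enter h l4 d"
    and "W' = W + leave_weight h l1 + enter_weight h l2 + leave_weight h l3 + enter_weight h l4"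
        "W' \<ge> 0"
  shows "State W' a (k1 @ Arc l2 (mark l2 b) c (rev B) # (k3 @ [Arc l4 (mark l4 d) a (C @ rev A)]))
    \<in> set (first_cuts h W ds)"
  using assms(1)
proof (induction ds)
  case (Cons y ds)
  obtain w' l' b' A' a' k' its where y: "y = Cut (Gap w' l' b') (Sides A' a' k' its)"
    by (metis cut.exhaust gap.exhaust sides.exhaust)
  show ?case
  proof (cases "y = Cut (Gap w l1 b) (Sides A a k1 R)")
    case True
    have "check (First h (h + h - Suc (Suc l1)) b (W + leave_weight h l1)) (Gap l2 l3 d) = Accept
        W' l4"
      using assms(3-7) by (intro check_eq) auto
    then show ?thesis using True second_cuts_mem[OF assms(2)] by auto
  next
    case False
    then show ?thesis using Cons y second_cuts_mono by fastforce
  qed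
qed simp

text \<open>Being inductive, it holds only if the search tree is finite, and its induction rule
  replaces a depth bound.\<close>

inductive refuted :: "nat \<Rightarrow> state \<Rightarrow> bool" where
  "list_all (refuted h) (first_cuts h W (cuts [] 0 p its)) \<Longrightarrow> refuted h (State W p its)"

lemma refuted_eq: "refuted h (State W p its) = list_all (refuted h) (first_cuts h W (cuts [] 0 p
    its))"
  by (subst refuted.simps) auto

text \<open>The state after the first flip, at a quadrilateral with sides of lengths \<open>2 * l1
  + 1\<close>, ..., \<open>2 * l4 + 1\<close>, the first and the third of which leave.\<close>

definition initial_state :: "nat \<Rightarrow> nat \<Rightarrow> nat \<Rightarrow> nat \<Rightarrow> nat \<Rightarrow> state" where
  "initial_state h l1 l2 l3 l4 = State (leave_weight h l1 + enter_weight h l2 + leave_weight h l3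
      + enter_weight h l4) (mark l1 Rest)
     (free (replicate (2 * l1) Rest) [Arc l2 (mark l2 Rest) (mark l3 Rest) (free (replicate (2 *
         l2) Rest) [])]
      @ free (replicate (2 * l3) Rest) [Arc l4 (mark l4 Rest) (mark l1 Rest) (free (replicate (2 *
          l4) Rest) [])])"

text \<open>Starting at the other leaving edge exchanges \<open>(l1, l2)\<close> with
  \<open>(l3, l4)\<close>, so only the lexicographically larger choice is kept. A negative first
  gain is excluded by the choice of the start.\<close>

definition initial_states :: "nat \<Rightarrow> state list" where
  "initial_states h = map (\<lambda>(l1, l2, l3, l4). initial_state h l1 l2 l3 l4)
     (filter (\<lambda>(l1, l2, l3, l4). l1 + l2 + l3 + l4 + 2 = h + h \<and> (l3 < l1 \<or> l3 = l1 \<and> l4 \<le> l2) \<and>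
         0 \<le> leave_weight h l1 + enter_weight h l2 + leave_weight h l3 + enter_weight h l4)
       (List.product [0..<h] (List.product [0..<h] (List.product [0..<h] [0..<h]))))"

lemma initial_states_mem:
  assumes "l1 < h" "l2 < h" "l3 < h" "l4 < h" "l1 + l2 + l3 + l4 + 2 = h + h" "l3 < l1 \<or> l3 = l1 \<and>
      l4 \<le> l2"
    and "0 \<le> leave_weight h l1 + enter_weight h l2 + leave_weight h l3 + enter_weight h l4"
  shows "initial_state h l1 l2 l3 l4 \<in> set (initial_states h)"
  unfolding initial_states_def set_map by (rule image_eqI[of _ _ "(l1, l2, l3, l4)"]) (use assms
      in auto)

text \<open>The functions above are tailored to evaluation by the simplifier: numbers are unary,
  conditions are dispatched on before their branches are built, and large arguments are passed on
  as they are.\<close>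

lemma enter_weight_eqs:
  "enter_weight (Suc (Suc (Suc 0))) 0 = -34" "enter_weight (Suc (Suc (Suc 0))) (Suc 0) = 28"
      "enter_weight (Suc (Suc (Suc 0))) (Suc (Suc 0)) = 8"
  "enter_weight (Suc (Suc (Suc (Suc 0)))) 0 = -13" "enter_weight (Suc (Suc (Suc (Suc 0)))) (Suc 0)
      = 0" "enter_weight (Suc (Suc (Suc (Suc 0)))) (Suc (Suc 0)) = 3" "enter_weight (Suc (Suc (Suc
      (Suc 0)))) (Suc (Suc (Suc 0))) = 14"
  "enter_weight (Suc (Suc (Suc (Suc (Suc 0))))) 0 = -59" "enter_weight (Suc (Suc (Suc (Suc (Suc
      0))))) (Suc 0) = 0" "enter_weight (Suc (Suc (Suc (Suc (Suc 0))))) (Suc (Suc 0)) = 15"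
      "enter_weight (Suc (Suc (Suc (Suc (Suc 0))))) (Suc (Suc (Suc 0))) = 11" "enter_weight (Suc
      (Suc (Suc (Suc (Suc 0))))) (Suc (Suc (Suc (Suc 0)))) = 17"
  by (simp_all add: enter_weight_def)

lemma leave_weight_eqs:
  "leave_weight (Suc (Suc (Suc 0))) 0 = 8" "leave_weight (Suc (Suc (Suc 0))) (Suc 0) = 4"
      "leave_weight (Suc (Suc (Suc 0))) (Suc (Suc 0)) = -14"
  "leave_weight (Suc (Suc (Suc (Suc 0)))) 0 = -2" "leave_weight (Suc (Suc (Suc (Suc 0)))) (Suc 0)
      = 15" "leave_weight (Suc (Suc (Suc (Suc 0)))) (Suc (Suc 0)) = -1" "leave_weight (Suc (Suc
      (Suc (Suc 0)))) (Suc (Suc (Suc 0))) = -16"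
  "leave_weight (Suc (Suc (Suc (Suc (Suc 0))))) 0 = -19" "leave_weight (Suc (Suc (Suc (Suc (Suc
      0))))) (Suc 0) = 51" "leave_weight (Suc (Suc (Suc (Suc (Suc 0))))) (Suc (Suc 0)) = 8"
      "leave_weight (Suc (Suc (Suc (Suc (Suc 0))))) (Suc (Suc (Suc 0))) = -12" "leave_weight (Suc
      (Suc (Suc (Suc (Suc 0))))) (Suc (Suc (Suc (Suc 0)))) = -12"
  by (simp_all add: leave_weight_def)

lemmas search_simps =
  old_at.simps mark.simps all_old_eqs is_new_eqs may_enter_eqs rev_onto.simps free.simps
      cons_if.simps leaf_ok.simps
  cuts_at.simps cuts.simps free_cuts.simps verdict_if.simps check_weight.simps check_fourth.simps
      check_length.simps
  check_second.simps check.simps emit.simps second_cuts.simps first_cuts.simps refuted_eq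
      list.pred_inject append.simps
  enter_weight_eqs leave_weight_eqs add_Suc_shift add_0 diff_Suc_Suc minus_nat.diff_0 diff_0_eq_0
      Suc_less_eq zero_less_Suc not_less0
  arith_simps arith_special Num.inc.simps numeral_One rel_simps order_refl simp_thms
      not_True_eq_False not_False_eq_True

lemmas initial_simps = initial_states_def initial_state_def numeral_eq_Suc upt_rec
    enter_weight_eqs leave_weight_eqs

lemma refuted_initial_3: "list_all (refuted 3) (initial_states 3)"
  by (simp add: initial_simps, simp only: search_simps)

lemma refuted_initial_4: "list_all (refuted 4) (initial_states 4)"
  by (simp add: initial_simps, simp only: search_simps)

lemma refuted_initial_5: "list_all (refuted 5) (initial_states 5)"
  by (simp add: initial_simps, simp only: search_simps)

section \<open>Soundness of the search\<close>

context anchored_flip_cycle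
begin

abbreviation J :: "nat \<Rightarrow> int \<Rightarrow> int \<Rightarrow> bool" where
  "J t \<equiv> joined m (M t)"

definition used :: "nat \<Rightarrow> int \<Rightarrow> nat \<Rightarrow> bool" where
  "used t x l \<longleftrightarrow> touched t {pt m x, pt m (x + 2 * int l + 1)}"

definition row_ok :: "nat \<Rightarrow> int \<Rightarrow> row \<Rightarrow> bool" where
  "row_ok t x r \<longleftrightarrow> (\<forall>l<h. old_at l r \<longleftrightarrow> used t x l)"

text \<open>One partner \<open>v\<close> serves all times \<open>s\<close>: the matching of the
  region is unknown but frozen since \<open>t0\<close>.\<close>

definition closed_region :: "nat \<Rightarrow> int \<Rightarrow> int \<Rightarrow> bool" where
  "closed_region t x y \<longleftrightarrow> (\<forall>u. x \<le> u \<and> u < y \<longrightarrow>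
     (\<exists>v. x \<le> v \<and> v < y \<and> (\<forall>s. t0 \<le> s \<and> s \<le> t \<longrightarrow> J s u v)))"

definition free_ok :: "nat \<Rightarrow> int \<Rightarrow> row list \<Rightarrow> bool" where
  "free_ok t x ps \<longleftrightarrow> length ps < m \<and> (\<forall>i<length ps. row_ok t (x + int i) (ps ! i)) \<and>
     closed_region t x (x + int (length ps))"

fun fits :: "nat \<Rightarrow> int \<Rightarrow> item list \<Rightarrow> bool" where
  "fits t x [] = True"
| "fits t x (Arc l a b k # its) \<longleftrightarrow> l < h \<and> J t x (x + 2 * int l + 1) \<and> used t x l \<and>
     row_ok t x a \<and> row_ok t (x + 2 * int l + 1) b \<and> width k = 2 * l \<and>
     fits t (x + 1) k \<and> fits t (x + 2 * int l + 2) its"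
| "fits t x (Free ps # its) \<longleftrightarrow> ps \<noteq> [] \<and> free_ok t x ps \<and> fits t (x + int (length ps)) its"

lemma fits_append: "fits t x (A @ B) \<longleftrightarrow> fits t x A \<and> fits t (x + int (width A)) B"
proof (induction A arbitrary: x)
  case (Cons it A)
  then show ?case by (cases it) (simp_all add: ac_simps)
qed simp

lemma fits_free: "fits t x (free ps its) \<longleftrightarrow> free_ok t x ps \<and> fits t (x + int (length ps)) its"
  using m by (cases ps) (auto simp: free_ok_def closed_region_def)

lemma joined_shift: "J t (x + 2 * int m) (y + 2 * int m) = J t x y"
  by simp

lemma used_shift: "used t (x + 2 * int m) l = used t x l"
proof -
  have "x + 2 * int m + 2 * int l + 1 = x + 2 * int l + 1 + 2 * int m" by simp
  then show ?thesis unfolding used_def by (metis pt_add)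
qed

lemma row_ok_shift: "row_ok t (x + 2 * int m) r = row_ok t x r"
  by (simp add: row_ok_def used_shift)

lemma closed_region_shift:
  assumes "closed_region t x y"
  shows "closed_region t (x + 2 * int m) (y + 2 * int m)"
  unfolding closed_region_def
proof (intro allI impI)
  fix u assume u: "x + 2 * int m \<le> u \<and> u < y + 2 * int m"
  then obtain v where v: "x \<le> v" "v < y" "\<forall>s. t0 \<le> s \<and> s \<le> t \<longrightarrow> J s (u - 2 * int m) v"
    using assms unfolding closed_region_def by (metis le_diff_eq diff_less_eq)
  have "J s u (v + 2 * int m)" if "J s (u - 2 * int m) v" for s
    using that joined_add(1)[of m "M s" "u - 2 * int m" v] by simp
  then show "\<exists>v. x + 2 * int m \<le> v \<and> v < y + 2 * int m \<and> (\<forall>s. t0 \<le> s \<and> s \<le> t \<longrightarrow> J s u v)"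
    using v by (intro exI[of _ "v + 2 * int m"]) auto
qed

lemma free_ok_shift: "free_ok t x ps \<Longrightarrow> free_ok t (x + 2 * int m) ps"
proof -
  assume a: "free_ok t x ps"
  have "row_ok t (x + 2 * int m + int i) r = row_ok t (x + int i) r" for i r
    using row_ok_shift[of t "x + int i" r] by (simp add: algebra_simps)
  moreover have "closed_region t (x + 2 * int m) (x + 2 * int m + int (length ps))"
    using closed_region_shift[of t x "x + int (length ps)"] a by (simp add: free_ok_def
        algebra_simps)
  ultimately show ?thesis using a by (simp add: free_ok_def)
qed

text \<open>Needed when the start of the state moves: items before the new start are read again one
  turn later.\<close>

lemma fits_shift: "fits t x its \<Longrightarrow> fits t (x + 2 * int m) its"
proof (induction t x its rule: fits.induct)
  case (2 t x l a b k its)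
  have e: "x + 2 * int m + 2 * int l + 1 = x + 2 * int l + 1 + 2 * int m"
    "x + 2 * int m + 2 * int l + 2 = x + 2 * int l + 2 + 2 * int m" "x + 2 * int m + 1 = x + 1 + 2
        * int m"
    by simp_all
  show ?case unfolding fits.simps e using 2 by (simp only: fits.simps row_ok_shift used_shift
      joined_shift)
next
  case (3 t x ps its)
  have e: "x + 2 * int m + int (length ps) = x + int (length ps) + 2 * int m" by simp
  show ?case unfolding fits.simps e using 3 free_ok_shift by simp
qed simp

section \<open>What a flip leaves unchanged\<close>

definition corner :: "int \<Rightarrow> int \<Rightarrow> int \<Rightarrow> int \<Rightarrow> int \<Rightarrow> bool" where
  "corner a b c d u \<longleftrightarrow> pt m u \<in> {pt m a, pt m b, pt m c, pt m d}"

lemma noncorner_edge: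
  assumes "quad t a b c d" "\<not> corner a b c d u"
  shows "{pt m u, i} \<in> M (Suc t) \<longleftrightarrow> {pt m u, i} \<in> M t"
  using assms by (auto simp: quad_def corner_def doubleton_eq_iff)

lemma noncorner_touched:
  assumes "quad t a b c d" "\<not> corner a b c d u" "t0 \<le> t"
  shows "touched (Suc t) {pt m u, i} \<longleftrightarrow> touched t {pt m u, i}"
  using noncorner_edge[OF assms(1,2)] by (simp add: touched_Suc[OF assms(3)])

lemma noncorner_row_ok:
  assumes "quad t a b c d" "\<not> corner a b c d u" "t0 \<le> t" "row_ok t u r"
  shows "row_ok (Suc t) u r"
  using assms(4) noncorner_touched[OF assms(1-3)] by (simp add: row_ok_def used_def)

lemma noncorner_closed_region:
  assumes q: "quad t a b c d" and nc: "\<And>u. x \<le> u \<Longrightarrow> u < y \<Longrightarrow> \<not> corner a b c d u" and "t0 \<le> t"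
    and cl: "closed_region t x y"
  shows "closed_region (Suc t) x y"
  unfolding closed_region_def
proof (intro allI impI)
  fix u assume u: "x \<le> u \<and> u < y"
  then obtain v where v: "x \<le> v" "v < y" "\<forall>s. t0 \<le> s \<and> s \<le> t \<longrightarrow> J s u v"
    using cl unfolding closed_region_def by blast
  have "J (Suc t) u v" using noncorner_edge[OF q nc[of u]] u v assms(3) by (simp add: joined_def)
  then show "\<exists>v. x \<le> v \<and> v < y \<and> (\<forall>s. t0 \<le> s \<and> s \<le> Suc t \<longrightarrow> J s u v)"
    using v by (intro exI[of _ v]) (auto simp: le_Suc_eq)
qed

lemma noncorner_free_ok:
  assumes q: "quad t a b c d" and nc: "\<And>u. x \<le> u \<Longrightarrow> u < x + int (length ps) \<Longrightarrow> \<not> corner a b c d u"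
      and "t0 \<le> t"
    and "free_ok t x ps"
  shows "free_ok (Suc t) x ps"
  using assms(4) noncorner_closed_region[OF q nc assms(3)] noncorner_row_ok[OF q nc assms(3)]
  by (simp add: free_ok_def)

lemma noncorner_fits:
  assumes q: "quad t a b c d" and t: "t0 \<le> t"
    and "fits t x its" "\<And>u. x \<le> u \<Longrightarrow> u < x + int (width its) \<Longrightarrow> \<not> corner a b c d u"
  shows "fits (Suc t) x its"
  using assms
proof (induction t x its rule: fits.induct)
  case (2 t x l a' b' k its)
  let ?y = "x + 2 * int l + 1"
  have f: "l < h" "J t x ?y" "used t x l" "row_ok t x a'" "row_ok t ?y b'" "width k = 2 * l"
    "fits t (x + 1) k" "fits t (x + 2 * int l + 2) its"
    using "2.prems"(3) by auto
  note q = "2.prems"(1) and t = "2.prems"(2) and nc = "2.prems"(4)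
  have c: "\<not> corner a b c d x" "\<not> corner a b c d ?y" using nc[of x] nc[of ?y] by auto
  have "J (Suc t) x ?y" using noncorner_edge[OF q c(1)] f by (simp add: joined_def)
  moreover have "used (Suc t) x l" using noncorner_touched[OF q c(1) t] f by (simp add: used_def)
  moreover have "fits (Suc t) (x + 1) k"
    using "2.IH"(1)[OF q t f(7)] nc f(6) by fastforce
  moreover have "fits (Suc t) (x + 2 * int l + 2) its"
    using "2.IH"(2)[OF q t f(8)] nc by fastforce
  ultimately show ?case using f noncorner_row_ok[OF q c(1) t] noncorner_row_ok[OF q c(2) t] by simp
next
  case (3 t x ps its)
  have "free_ok (Suc t) x ps"
    using noncorner_free_ok[OF "3.prems"(1) _ "3.prems"(2)] 3 by auto
  moreover have "fits (Suc t) (x + int (length ps)) its"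
    using "3.IH"[OF "3.prems"(1,2)] 3 by fastforce
  ultimately show ?case using "3.prems"(3) by simp
qed simp

text \<open>An edge spanning fewer than \<open>m\<close> steps has the centre on its other side, so
  the condition says that no edge separates \<open>y z\<close> from the centre.\<close>

definition visible :: "nat \<Rightarrow> int \<Rightarrow> int \<Rightarrow> bool" where
  "visible t y z \<longleftrightarrow> \<not> (\<exists>u v. u < y \<and> z < v \<and> v - u < int m \<and> J t u v)"

lemma joined_partner: "J t x y \<Longrightarrow> J t x z \<Longrightarrow> pt m y = pt m z"
  using joined_unique[OF matching m] .

lemma joined_partner': "J t x y \<Longrightarrow> J t z y \<Longrightarrow> pt m x = pt m z"
  using joined_partner joined_sym[of m] by metis

lemma pt_neq: "x < y \<Longrightarrow> y < x + 2 * int m \<Longrightarrow> pt m x \<noteq> pt m y"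
  using pt_inj[of m x y] by auto

lemma joined_cross: "J t a c \<Longrightarrow> J t b d \<Longrightarrow> a < b \<Longrightarrow> b < c \<Longrightarrow> c < d \<Longrightarrow> d < a + 2 * int m \<Longrightarrow> False"
  using joined_noncrossing[OF matching m] by blast

lemma quad_rotate:
  assumes "quad t a b c d"
  shows "quad t c d (a + 2 * int m) (b + 2 * int m)"
  using assms by (auto simp: quad_def pt_add insert_commute)

lemma quad_shift:
  assumes "quad t a b c d"
  shows "quad t (a + k * (2 * int m)) (b + k * (2 * int m)) (c + k * (2 * int m)) (d + k * (2 *
      int m))"
proof -
  have "pt m (x + k * (2 * int m)) = pt m x" for x
  proof -
    have "(x + k * (2 * int m) - 1) mod (2 * int m) = (x - 1 + k * (2 * int m)) mod (2 * int m)"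
      by (simp add: algebra_simps)
    then show ?thesis by (simp add: pt_def)
  qed
  then show ?thesis using assms by (auto simp: quad_def joined_def)
qed

lemma quad_new: "quad t a b c d \<Longrightarrow> J (Suc t) b c" "quad t a b c d \<Longrightarrow> J (Suc t) a d"
  by (auto simp: quad_def joined_def insert_commute)

text \<open>A covering edge \<open>u v\<close> survives the flip. To cross neither of the entering
  edges \<open>b c\<close> and \<open>a d\<close> it must reach beyond \<open>d\<close>; then it
  spans more than \<open>d - a\<close>, which exceeds \<open>m\<close> because the quadrilateral
  contains the centre.\<close>

lemma quad_visible:
  assumes q: "quad t a b c d"
  shows "visible t a b"
  unfolding visible_def
proof
  assume "\<exists>u v. u < a \<and> b < v \<and> v - u < int m \<and> J t u v"
  then obtain u v where uv: "u < a" "b < v" "v - u < int m" "J t u v" by blast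
  have o: "a < b" "b < c" "c < d" "d < a + 2 * int m" using q by (auto simp: quad_def)
  have g: "c - b < int m" "d - c < int m" "a + 2 * int m - d < int m" using quad_centered[OF q] by
      blast+
  have ua: "pt m u \<noteq> pt m a" and ub: "pt m u \<noteq> pt m b" using pt_neq[of u a] pt_neq[of u b] uv o by
      auto
  have av: "pt m a \<noteq> pt m v" and bv: "pt m b \<noteq> pt m v" using pt_neq[of a v] pt_neq[of b v] uv o by
      auto
  have u': "pt m (u + 2 * int m) = pt m u" by (rule pt_add)
  have "\<not> (pt m u = pt m c \<and> pt m v = pt m d)"
  proof
    assume "pt m u = pt m c \<and> pt m v = pt m d"
    then have "c = u + 2 * int m" "v = d"
      using pt_neq[of c "u + 2 * int m"] pt_neq[of "u + 2 * int m" c] pt_neq[of d v] pt_neq[of v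
          d] u' uv o g by force+
    then show False using uv o by linarith
  qed
  moreover have "\<not> (pt m u = pt m d \<and> pt m v = pt m c)"
  proof
    assume "pt m u = pt m d \<and> pt m v = pt m c"
    then have "d = u + 2 * int m" "v = c"
      using pt_neq[of d "u + 2 * int m"] pt_neq[of "u + 2 * int m" d] pt_neq[of c v] pt_neq[of v
          c] u' uv o g by force+
    then show False using uv o g by linarith
  qed
  ultimately have J': "J (Suc t) u v"
    using uv(4) q ua ub unfolding quad_def joined_def by (auto simp: doubleton_eq_iff)
  have bc: "J (Suc t) b c" and ad: "J (Suc t) a d" using quad_new[OF q] by blast+
  have "c < v"
  proof (rule ccontr)
    assume "\<not> c < v"
    moreover have "c \<noteq> v" using joined_partner'[OF J', of b] bc ub by auto
    moreover have "c < u + 2 * int m" using g uv o by linarith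
    ultimately show False using joined_cross[OF J' bc] uv o by linarith
  qed
  moreover have "d \<noteq> v" using joined_partner'[OF J', of a] ad ua by auto
  moreover have "d < u + 2 * int m" using g uv o calculation by linarith
  ultimately show False using joined_cross[OF J' ad] uv o g by linarith
qed

text \<open>This is how an unknown block is revealed: an outermost edge leaves three regions that no
  edge connects, and since partners are frozen, the edge itself has been present since
  \<open>t0\<close>.\<close>

lemma closed_region_split:
  assumes cl: "closed_region t x z" and t: "t0 \<le> t" and yw: "x \<le> y" "y < w" "w < z" "z \<le> x + int m"
    and J: "J t y w" and nocover: "\<And>u v. x \<le> u \<Longrightarrow> u < y \<Longrightarrow> w < v \<Longrightarrow> v < z \<Longrightarrow> \<not> J t u v"
  shows "closed_region t x y" "closed_region t (y + 1) w" "closed_region t (w + 1) z"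
    and "\<And>s. t0 \<le> s \<Longrightarrow> s \<le> t \<Longrightarrow> J s y w"
proof -
  have part: "\<exists>v. x \<le> v \<and> v < z \<and> J t u v \<and> (\<forall>s. t0 \<le> s \<and> s \<le> t \<longrightarrow> J s u v)" if "x \<le> u" "u < z" for u
    using cl that t unfolding closed_region_def by blast
  have endp: "v \<noteq> y \<and> v \<noteq> w" if "J t u v" "x \<le> u" "u < z" "u \<noteq> y" "u \<noteq> w" for u v
  proof -
    have "pt m u \<noteq> pt m y" "pt m u \<noteq> pt m w"
      using pt_neq[of u y] pt_neq[of y u] pt_neq[of u w] pt_neq[of w u] that yw m by (auto simp:
          neq_iff)
    then show ?thesis
      using joined_partner'[OF that(1), of w] joined_partner'[OF that(1), of y] J joined_sym[of m
          "M t" y w] by auto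
  qed
  show "closed_region t x y" unfolding closed_region_def
  proof (intro allI impI)
    fix u assume u: "x \<le> u \<and> u < y"
    then obtain v where v: "x \<le> v" "v < z" "J t u v" "\<forall>s. t0 \<le> s \<and> s \<le> t \<longrightarrow> J s u v" using part[of
        u] yw by auto
    have "v < y"
    proof (rule ccontr)
      assume "\<not> v < y"
      moreover have "v \<noteq> y" "v \<noteq> w" using endp[OF v(3)] u yw by auto
      moreover have "\<not> w < v" using nocover[of u v] u v by auto
      ultimately have "y < v" "v < w" by auto
      then show False using joined_cross[OF v(3) J] u yw by linarith
    qed
    then show "\<exists>v. x \<le> v \<and> v < y \<and> (\<forall>s. t0 \<le> s \<and> s \<le> t \<longrightarrow> J s u v)" using v by blast
  qed
  show "closed_region t (y + 1) w" unfolding closed_region_def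
  proof (intro allI impI)
    fix u assume u: "y + 1 \<le> u \<and> u < w"
    then obtain v where v: "x \<le> v" "v < z" "J t u v" "\<forall>s. t0 \<le> s \<and> s \<le> t \<longrightarrow> J s u v" using part[of
        u] yw by auto
    have "v \<noteq> y" "v \<noteq> w" using endp[OF v(3)] u yw by auto
    moreover have "\<not> v < y"
      using joined_cross[of t v u y w] J v(3) joined_sym[of m "M t" u v] u yw v by auto
    moreover have "\<not> w < v" using joined_cross[OF J v(3)] u yw v by auto
    ultimately have "y < v" "v < w" by auto
    then show "\<exists>v. y + 1 \<le> v \<and> v < w \<and> (\<forall>s. t0 \<le> s \<and> s \<le> t \<longrightarrow> J s u v)" using v by (intro exI[of _
        v]) auto
  qed
  show "closed_region t (w + 1) z" unfolding closed_region_def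
  proof (intro allI impI)
    fix u assume u: "w + 1 \<le> u \<and> u < z"
    then obtain v where v: "x \<le> v" "v < z" "J t u v" "\<forall>s. t0 \<le> s \<and> s \<le> t \<longrightarrow> J s u v" using part[of
        u] yw by auto
    have vu: "J t v u" using v(3) joined_sym[of m "M t" u v] by simp
    have "v \<noteq> y" "v \<noteq> w" using endp[OF v(3)] u yw by auto
    moreover have "\<not> v < y" using nocover[of v u] vu u v by auto
    moreover have "\<not> (y < v \<and> v < w)" using joined_cross[OF J vu] u yw v by auto
    ultimately have "w < v" by auto
    then show "\<exists>v. w + 1 \<le> v \<and> v < z \<and> (\<forall>s. t0 \<le> s \<and> s \<le> t \<longrightarrow> J s u v)" using v by (intro exI[of _
        v]) auto
  qed
  obtain v where v: "x \<le> v" "v < z" "J t y v" "\<forall>s. t0 \<le> s \<and> s \<le> t \<longrightarrow> J s y v" using part[of y] yw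
      by auto
  have "pt m v = pt m w" using joined_partner[OF v(3) J] .
  then have "v = w" using pt_neq[of v w] pt_neq[of w v] v yw m by (cases v w rule: linorder_cases)
      auto
  then show "J s y w" if "t0 \<le> s" "s \<le> t" for s using v that by blast
qed

lemma closed_region_even:
  assumes "closed_region t x y" "t0 \<le> t" "x \<le> y" "y \<le> x + int m"
  shows "even (y - x)"
  using assms
proof (induction "nat (y - x)" arbitrary: x rule: less_induct)
  case less
  show ?case
  proof (cases "x = y")
    case False
    then have "x < y" using less.prems by simp
    then obtain v where v: "x \<le> v" "v < y" "J t x v" using less.prems unfolding closed_region_def
        by blast
    have "x \<noteq> v" using joined_distinct[OF matching m v(3)] by auto
    then have xv: "x < v" using v by simp
    have "closed_region t (v + 1) y"
      using closed_region_split(3)[OF less.prems(1,2) _ xv v(2) less.prems(4) v(3)] by auto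
    then have "even (y - (v + 1))" using less.hyps[of "v + 1"] less.prems xv v by auto
    moreover have "odd (v - x)" using joined_odd[OF matching m v(3)] .
    ultimately show ?thesis by simp
  qed simp
qed

lemma fits_proper: "fits t x its \<Longrightarrow> t0 \<le> t \<Longrightarrow> proper its"
proof (induction its arbitrary: x)
  case (Cons it its)
  show ?case
  proof (cases it)
    case (Free ps)
    then have "closed_region t x (x + int (length ps))" "length ps < m" using Cons.prems by (auto
        simp: free_ok_def)
    then have "even (length ps)" using closed_region_even[of t x "x + int (length ps)"] Cons.prems
        by simp
    then show ?thesis using Cons Free by auto
  qed (use Cons in auto)
qed simp

lemma last_row_ok:
  "fits t x its \<Longrightarrow> row_ok t (x - 1) p \<Longrightarrow> row_ok t (x + int (width its) - 1) (last_row p its)"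
proof (induction its arbitrary: x p)
  case (Cons it its)
  show ?case
  proof (cases it)
    case (Arc l a b k)
    then show ?thesis using Cons.IH[of "x + 2 * int l + 2" b] Cons.prems by (simp add: ac_simps)
  next
    case (Free ps)
    then have ps: "ps \<noteq> []" "free_ok t x ps" using Cons.prems by auto
    then have "row_ok t (x + int (length ps - 1)) (ps ! (length ps - 1))" by (simp add: free_ok_def)
    moreover have "int (length ps - 1) = int (length ps) - 1" using ps by (cases ps) auto
    ultimately have "row_ok t (x + int (length ps) - 1) (last ps)" using ps by (simp add:
        last_conv_nth add_diff_eq)
    then show ?thesis using Cons.IH[of "x + int (length ps)" "last ps"] Cons.prems Free by (simp
        add: ac_simps)
  qed
qed simp

lemma split_two:
  assumes "i < j" "j < length ps"
  obtains q a k b r where "ps = q @ a # k @ b # r" "length q = i" "length k = j - i - 1"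
proof -
  have "ps = take i ps @ ps ! i # drop (Suc i) ps" using assms by (intro id_take_nth_drop) simp
  moreover have "drop (Suc i) ps = take (j - i - 1) (drop (Suc i) ps) @ (drop (Suc i) ps) ! (j - i
      - 1) # drop (Suc (j - i - 1)) (drop (Suc i) ps)"
    using assms by (intro id_take_nth_drop) simp
  ultimately have "ps = take i ps @ ps ! i # take (j - i - 1) (drop (Suc i) ps) @ (drop (Suc i)
      ps) ! (j - i - 1)
      # drop (Suc (j - i - 1)) (drop (Suc i) ps)"
    by simp
  then show thesis by (rule that) (use assms in auto)
qed

text \<open>A point below an arc is hidden by it, so a visible edge starting in an arc is that arc;
  one starting in a free block ends there, because the block is closed.\<close>

lemma locate:
  assumes "fits t x its" "t0 \<le> t" "visible t y w" "J t y w" "y < w" "w - y < int m" "x \<le> y" "y < x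
      + int (width its)"
  shows "(\<exists>A l a b k B. its = A @ Arc l a b k # B \<and> y = x + int (width A) \<and> w = y + 2 * int l + 1) \<or>
    (\<exists>A q a k b r B. its = A @ Free (q @ a # k @ b # r) # B \<and>
       y = x + int (width A) + int (length q) \<and> w = y + 1 + int (length k))"
    (is "?P its x")
  using assms(1,7,8)
proof (induction its arbitrary: x)
  case (Cons it its)
  have step: "?P (it # its) x" if "?P its (x + int (width [it]))"
    using that
  proof (elim disjE exE conjE)
    fix A l a b k B
    assume "its = A @ Arc l a b k # B" "y = x + int (width [it]) + int (width A)" "w = y + 2 * int
        l + 1"
    then show ?thesis
      using width_append[of "[it]" A] by (intro disjI1 exI[of _ "it # A"] exI[of _ l] exI[of _ a]
          exI[of _ b] exI[of _ k] exI[of _ B]) simp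
  next
    fix A q a k b r B
    assume "its = A @ Free (q @ a # k @ b # r) # B" "y = x + int (width [it]) + int (width A) +
        int (length q)"
      "w = y + 1 + int (length k)"
    then show ?thesis
      using width_append[of "[it]" A]
      by (intro disjI2 exI[of _ "it # A"] exI[of _ q] exI[of _ a] exI[of _ k] exI[of _ b] exI[of _
          r] exI[of _ B]) simp
  qed
  show ?case
  proof (cases "x + int (width [it]) \<le> y")
    case True
    have f: "fits t (x + int (width [it])) its" using Cons.prems(1) fits_append[of t x "[it]" its]
        by simp
    have y: "y < x + int (width [it]) + int (width its)"
      using Cons.prems(3) width_append[of "[it]" its] by simp
    show ?thesis by (rule step, rule Cons.IH[OF f True y])
  next
    case near: False
    show ?thesis
    proof (cases it)
      case (Arc l a b k)
      let ?z = "x + 2 * int l + 1"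
      have l: "l < h" "J t x ?z" using Cons.prems Arc by auto
      have lm: "2 * int l + 1 < int m" using l m_eq by simp
      have "y = x"
      proof (rule ccontr)
        assume "y \<noteq> x"
        then have xy: "x < y" "y \<le> ?z" using Cons.prems near Arc by auto
        show False
        proof (cases "y = ?z")
          case True
          have "J t ?z x" using l joined_sym[of m] by simp
          then have "pt m w = pt m (x + 2 * int m)" using joined_partner[of t ?z w x] assms(4)
              True by (simp add: pt_add)
          then show False using pt_neq[of w "x + 2 * int m"] assms xy lm True by force
        next
          case False
          then have yz: "y < ?z" using xy by simp
          have "w \<noteq> ?z" using joined_partner'[OF l(2), of y] assms(4) pt_neq[of x y] xy lm by auto
          moreover have "\<not> ?z < w" using joined_cross[OF l(2) assms(4)] xy yz assms lm by auto
          moreover have "\<not> w < ?z" using assms(3) l(2) xy lm unfolding visible_def by force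
          ultimately show False by simp
        qed
      qed
      moreover have "w = ?z"
      proof -
        have "pt m w = pt m ?z" using joined_partner[of t x w ?z] assms(4) l(2) \<open>y = x\<close> by simp
        then show ?thesis using pt_neq[of w ?z] pt_neq[of ?z w] assms \<open>y = x\<close> lm by (cases w ?z
            rule: linorder_cases) auto
      qed
      ultimately show ?thesis using Arc by (intro disjI1 exI[of _ "[]"]) auto
    next
      case (Free ps)
      let ?L = "int (length ps)"
      have f: "closed_region t x (x + ?L)" "length ps < m" using Cons.prems Free by (auto simp:
          free_ok_def)
      have yl: "x \<le> y" "y < x + ?L" using Cons.prems near Free by auto
      then obtain v where v: "x \<le> v" "v < x + ?L" "J t y v"
        using f(1) assms(2) unfolding closed_region_def by blast
      have vw: "pt m v = pt m w" using joined_partner[OF v(3) assms(4)] .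
      have "v \<noteq> y" using joined_distinct[OF matching m v(3)] by auto
      moreover have "\<not> v < y"
      proof
        assume "v < y"
        moreover have "pt m (v + 2 * int m) = pt m w" using vw by (simp add: pt_add)
        ultimately show False using pt_neq[of w "v + 2 * int m"] v yl f assms by force
      qed
      ultimately have "y < v" by simp
      then have "v = w" using vw pt_neq[of v w] pt_neq[of w v] assms v yl f by (cases v w rule:
          linorder_cases) auto
      then have w: "w < x + ?L" using v by simp
      define i j where "i = nat (y - x)" and "j = nat (w - x)"
      have ij: "i < j" "j < length ps" "int i = y - x" "int j = w - x" using yl w assms by (auto
          simp: i_def j_def)
      obtain q a k b r where ps: "ps = q @ a # k @ b # r" "length q = i" "length k = j - i - 1"
        using split_two[OF ij(1,2)] .
      have "int (length k) = int j - int i - 1" using ps(3) ij by simp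
      then have "y = x + int (width []) + int (length q)" "w = y + 1 + int (length k)" using ps ij
          by auto
      then show ?thesis using Free ps(1) by (intro disjI2 exI[of _ "[]"] exI[of _ q]) auto
    qed
  qed
qed simp

lemma pt_odd_edge: "odd (v - u) \<Longrightarrow> {pt m u, pt m v} \<in> odd_edges m"
proof -
  assume "odd (v - u)"
  then have "odd (int (pt m v) - int (pt m u))"
    using pt_even_diff[OF m, of u] pt_even_diff[OF m, of v] by simp
  then show ?thesis unfolding odd_edges_def using pt_range[OF m] by blast
qed

text \<open>The edge of length 3 leaves only the points \<open>y\<close> and \<open>y + 1\<close>
  below it, and they must be partners. Hence \<open>touched_outer\<close> applies, which is the
  reason for \<open>leaf_ok\<close>.\<close>

lemma leaf_used:
  assumes t: "t0 \<le> t" and "used t y 0" "J t y (y + 1)" "\<not> J (Suc t) y (y + 1)"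
  shows "used t (y - 1) 1"
proof -
  have n: "4 \<le> int m" using two_le_h m_eq by simp
  let ?e = "{pt m y, pt m (y + 1)}" and ?f = "{pt m (y - 1), pt m (y + 2)}"
  have "touched t ?f"
  proof (rule touched_outer[OF t, of ?e])
    show "?f \<in> odd_edges m" by (rule pt_odd_edge) simp
    fix s assume "?f \<in> M s"
    then have f: "J s (y - 1) (y + 2)" by (simp add: joined_def)
    obtain z where z: "y < z" "z < y + 2 * int m" "J s y z" using joined_ex[OF matching m] by blast
    have "z \<noteq> y + 2" using joined_partner'[OF f, of y] z(3) pt_neq[of "y - 1" y] n by auto
    moreover have "z \<noteq> y - 1 + 2 * int m"
    proof
      assume "z = y - 1 + 2 * int m"
      then have "J s y (y - 1)" using z(3) joined_add(2)[of m "M s" y "y - 1"] by simp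
      then have "J s (y - 1) y" using joined_sym[of m] by simp
      then show False using joined_partner[OF f, of y] pt_neq[of y "y + 2"] n by auto
    qed
    moreover have "\<not> (y + 2 < z \<and> z < y - 1 + 2 * int m)" using joined_cross[OF f z(3)] by auto
    ultimately have "z = y + 1" using z by linarith
    then show "?e \<in> M s" using z(3) by (simp add: joined_def)
  qed (use assms in \<open>auto simp: used_def joined_def\<close>)
  then show ?thesis by (simp add: used_def algebra_simps)
qed

lemma free_rev: "free q (rev A) = rev (A @ free q [])"
  by (cases q) auto

lemma free_ok_parts:
  assumes "free_ok t x (q @ a # k @ b # r)"
    and "closed_region t x (x + int (length q))"
    and "closed_region t (x + int (length q) + 1) (x + int (length q) + 1 + int (length k))"
    and "closed_region t (x + int (length q) + int (length k) + 2) (x + int (length (q @ a # k @ b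
        # r)))"
  shows "free_ok t x q" "row_ok t (x + int (length q)) a" "free_ok t (x + int (length q) + 1) k"
    "row_ok t (x + int (length q) + 1 + int (length k)) b" "free_ok t (x + int (length q) + int
        (length k) + 2) r"
proof -
  let ?ps = "q @ a # k @ b # r"
  have len: "length ?ps < m" and rows: "\<And>i. i < length ?ps \<Longrightarrow> row_ok t (x + int i) (?ps ! i)"
    using assms(1) by (auto simp: free_ok_def)
  have "row_ok t (x + int i) (q ! i)" if "i < length q" for i using rows[of i] that by (simp add:
      nth_append)
  then show "free_ok t x q" using assms(2) len by (simp add: free_ok_def)
  show "row_ok t (x + int (length q)) a" using rows[of "length q"] by (simp add: nth_append)
  have "row_ok t (x + int (length q) + 1 + int i) (k ! i)" if "i < length k" for i
    using rows[of "length q + 1 + i"] that by (simp add: nth_append ac_simps)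
  then show "free_ok t (x + int (length q) + 1) k" using assms(3) len by (simp add: free_ok_def)
  show "row_ok t (x + int (length q) + 1 + int (length k)) b"
    using rows[of "length q + 1 + length k"] by (simp add: nth_append ac_simps)
  have "row_ok t (x + int (length q) + int (length k) + 2 + int i) (r ! i)" if "i < length r" for i
    using rows[of "length q + length k + 2 + i"] that by (simp add: nth_append ac_simps)
  then show "free_ok t (x + int (length q) + int (length k) + 2) r" using assms(4) len by (simp
      add: free_ok_def ac_simps)
qed

lemma cut_exists:
  assumes fit: "fits t x its" and t: "t0 \<le> t" and p: "row_ok t (x - 1) p"
    and vis: "visible t y w" and yw: "J t y w" "\<not> J (Suc t) y w" "y < w" "w - y < int m" "x \<le> y"
        "y < x + int (width its)"
  obtains A a k b R l where
    "Cut (Gap (nat (y - x) div 2) l b) (Sides (rev A) a k R) \<in> set (cuts [] 0 p its)"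
    "w = y + 2 * int l + 1" "l < h" "int (width A) = y - x" "fits t x A" "fits t (y + 1) k" "width
        k = 2 * l"
    "row_ok t w b" "\<forall>j<h. old_at j a \<longleftrightarrow> used t y j \<or> j = l" "fits t (w + 1) R"
    "width its = width A + 2 * l + 2 + width R"
  using locate[OF fit t vis yw(1,3-6)]
proof (elim disjE exE conjE)
  fix A l a b k B
  assume its: "its = A @ Arc l a b k # B" and y: "y = x + int (width A)" and w: "w = y + 2 * int l
      + 1"
  have fA: "fits t x A" and arc: "fits t y (Arc l a b k # B)" using fit unfolding its fits_append
      y by auto
  have "leaf_ok l (last_row p A)"
  proof (cases l)
    case 0
    then have wy: "w = y + 1" using w by simp
    have "used t y 0" using arc 0 by simp
    then have "used t (y - 1) 1" by (rule leaf_used[OF t]) (use yw(1,2) wy in simp_all)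
    moreover have "row_ok t (y - 1) (last_row p A)" using last_row_ok[OF fA p] unfolding y .
    ultimately have "old_at 1 (last_row p A)" using two_le_h unfolding row_ok_def by auto
    then show ?thesis using 0 by simp
  qed simp
  from this have mem: "Cut (Gap (0 + width A div 2) l b) (Sides (rev A @ []) a k B) \<in> set (cuts []
      0 p (A @ Arc l a b k # B))"
    by (rule cuts_Arc[OF fits_proper[OF fA t]])
  have half: "nat (y - x) div 2 = 0 + width A div 2" unfolding y by simp
  have cut: "Cut (Gap (nat (y - x) div 2) l b) (Sides (rev A) a k B) \<in> set (cuts [] 0 p its)"
    using mem unfolding its half append_Nil2 .
  show thesis
  proof (rule that[OF cut w])
    \<comment> \<open>An arc entered after the start, so its entry is set already and no
      \<open>mark\<close> is needed.\<close>
    show "\<forall>j<h. old_at j a \<longleftrightarrow> used t y j \<or> j = l"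
      using arc by (auto simp: row_ok_def)
    show "l < h" "fits t (y + 1) k" "width k = 2 * l" "row_ok t w b" "fits t (w + 1) B"
      using arc unfolding w by (simp_all add: add.assoc)
    show "int (width A) = y - x" unfolding y by simp
    show "width its = width A + 2 * l + 2 + width B" unfolding its by simp
  qed (rule fA)
next
  fix A q a k b r B
  assume its: "its = A @ Free (q @ a # k @ b # r) # B" and y: "y = x + int (width A) + int (length
      q)"
    and w: "w = y + 1 + int (length k)"
  let ?x = "x + int (width A)" and ?ps = "q @ a # k @ b # r"
  have fA: "fits t x A" and fo: "free_ok t ?x ?ps" and fB: "fits t (?x + int (length ?ps)) B"
    using fit unfolding its fits_append by auto
  have cl: "closed_region t ?x (?x + int (length ?ps))" and len: "length ?ps < m" using fo by
      (auto simp: free_ok_def)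
  note split = closed_region_split[OF cl t, of y w]
  have pre: "?x \<le> y" "w < ?x + int (length ?ps)" "?x + int (length ?ps) \<le> ?x + int m" using y w
      len by auto
  have noc: "\<not> J t u v" if "?x \<le> u" "u < y" "w < v" "v < ?x + int (length ?ps)" for u v
  proof -
    have "v - u < int m" using that len by linarith
    then show ?thesis using vis that unfolding visible_def by blast
  qed
  have c1: "closed_region t ?x (?x + int (length q))"
    and c2: "closed_region t (?x + int (length q) + 1) (?x + int (length q) + 1 + int (length k))"
    and c3: "closed_region t (?x + int (length q) + int (length k) + 2) (?x + int (length ?ps))"
    and ever: "\<And>s. t0 \<le> s \<Longrightarrow> s \<le> t \<Longrightarrow> J s y w"
    using split[OF pre(1) yw(3) pre(2,3) yw(1) noc] unfolding y w by (simp_all add: ac_simps)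
  note parts = free_ok_parts[OF fo c1 c2 c3]
  have eq: "even (length q)" using closed_region_even[OF c1 t] len by simp
  have ek: "even (length k)" using joined_odd[OF matching m yw(1)] w by simp
  define l where "l = length k div 2"
  have l: "length k = 2 * l" using ek by (simp add: l_def)
  have wl: "w = y + 2 * int l + 1" using w l by simp
  have lh: "l < h" using yw(4) wl m_eq by simp
  have "\<not> used t y l"
  proof
    assume "used t y l"
    then obtain s where s: "t0 \<le> s" "s < t" "J s y w \<noteq> J (Suc s) y w"
      by (auto simp: used_def touched_def joined_def wl)
    then show False using ever[of s] ever[of "Suc s"] by simp
  qed
  then have na: "\<not> old_at l a" using parts(2) lh unfolding y by (simp add: row_ok_def)
  have "Cut (Gap (nat (y - x) div 2) l b) (Sides (rev (A @ free q [])) (mark l a) (free k [])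
      (free r B)) \<in> set (cuts [] 0 p its)"
  proof -
    have "even (width A)" using even_width[OF fits_proper[OF fA t]] .
    then have "nat (y - x) div 2 = width A div 2 + length q div 2"
      using y div_plus_div_distrib_dvd_left[of 2 "width A" "length q"] by (simp add:
          nat_add_distrib)
    then show ?thesis
      using cuts_Free[OF fits_proper[OF fA t] eq ek, of a 0 b "[]" r B p] na its free_rev[of q A]
          by (simp add: l_def)
  qed
  moreover have "fits t x (A @ free q [])" using fA parts(1) by (simp add: fits_append fits_free)
  moreover have "fits t (y + 1) (free k [])" using parts(3) unfolding y by (simp add: fits_free)
  moreover have "fits t (w + 1) (free r B)"
    using parts(5) fB unfolding y w by (simp add: fits_free ac_simps)
  moreover have "\<forall>j<h. old_at j (mark l a) \<longleftrightarrow> used t y j \<or> j = l"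
    using parts(2) unfolding y by (auto simp: old_at_mark row_ok_def)
  moreover have "row_ok t w b" using parts(4) unfolding y w by (simp add: ac_simps)
  moreover have "int (width (A @ free q [])) = y - x" unfolding y by simp
  moreover have "width (free k []) = 2 * l" using l by simp
  moreover have "width its = width (A @ free q []) + 2 * l + 2 + width (free r B)" unfolding its
      using l by simp
  ultimately show thesis using that wl lh by blast
qed

end

context even_flip_cycle
begin

definition gain :: "nat \<Rightarrow> int" where
  "gain t = (\<Sum>e\<in>M (Suc t) - M t. enter_weight h (edge_len m e div 2)) + (\<Sum>e\<in>M t - M (Suc t).
      leave_weight h (edge_len m e div 2))"

lemma quad_gain:
  assumes q: "quad t a b c d"
    and g: "b = a + 2 * int l1 + 1" "c = b + 2 * int l2 + 1" "d = c + 2 * int l3 + 1" "a + 2 * int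
        m = d + 2 * int l4 + 1"
  shows "gain t = leave_weight h l1 + enter_weight h l2 + leave_weight h l3 + enter_weight h l4"
proof -
  have c: "b - a < int m" "c - b < int m" "d - c < int m" "a + 2 * int m - d < int m"
    using quad_centered[OF q] by blast+
  have "int (edge_len m {pt m b, pt m c}) = int (2 * l2 + 1)" "int (edge_len m {pt m d, pt m a}) =
      int (2 * l4 + 1)"
    "int (edge_len m {pt m a, pt m b}) = int (2 * l1 + 1)" "int (edge_len m {pt m c, pt m d}) =
        int (2 * l3 + 1)"
    unfolding quad_lengths[OF q] using c g by auto
  then have "edge_len m {pt m b, pt m c} = 2 * l2 + 1" "edge_len m {pt m d, pt m a} = 2 * l4 + 1"
    "edge_len m {pt m a, pt m b} = 2 * l1 + 1" "edge_len m {pt m c, pt m d} = 2 * l3 + 1"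
    by (simp_all only: of_nat_eq_iff)
  then show ?thesis
    unfolding gain_def sum_quad(1)[OF q, of "\<lambda>i. enter_weight h (i div 2)"] sum_quad(2)[OF q, of
        "\<lambda>i. leave_weight h (i div 2)"]
    by simp
qed

end

context anchored_flip_cycle
begin

lemma noncornerI:
  assumes "quad t a b c d" "a < u" "u < a + 2 * int m" "u \<noteq> b" "u \<noteq> c" "u \<noteq> d"
  shows "\<not> corner a b c d u"
proof -
  have o: "a < b" "b < c" "c < d" "d < a + 2 * int m" using assms(1) by (auto simp: quad_def)
  have "pt m u \<noteq> pt m v" if "a \<le> v" "v < a + 2 * int m" "u \<noteq> v" for v
    using pt_neq[of u v] pt_neq[of v u] that assms(2,3) by (cases u v rule: linorder_cases) auto
  then show ?thesis using o assms by (auto simp: corner_def)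
qed

lemma changed_edge_iff:
  assumes "quad t a b c d" "t0 \<le> t"
  shows "touched (Suc t) e \<longleftrightarrow> touched t e \<or>
    e \<in> {{pt m a, pt m b}, {pt m c, pt m d}, {pt m b, pt m c}, {pt m d, pt m a}}"
proof -
  have "(e \<in> M t) \<noteq> (e \<in> M (Suc t)) \<longleftrightarrow> e \<in> (M (Suc t) - M t) \<union> (M t - M (Suc t))" by blast
  then show ?thesis unfolding touched_Suc[OF assms(2)] quad_enters[OF assms(1)] by auto
qed

text \<open>Rows record clockwise edges of fewer than \<open>m\<close> steps. Of the two edges that
  change at a corner only one is of this kind: the leaving one at \<open>a\<close> and
  \<open>c\<close>, the entering one at \<open>b\<close> and \<open>d\<close>.\<close>

lemma used_leaving_corner:
  assumes q: "quad t a b c d" and t: "t0 \<le> t" and l: "l < h"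
  shows "used (Suc t) a l \<longleftrightarrow> used t a l \<or> a + 2 * int l + 1 = b"
proof -
  have o: "a < b" "b < c" "c < d" "d < a + 2 * int m" using q by (auto simp: quad_def)
  have g: "b - a < int m" "a + 2 * int m - d < int m" using quad_centered[OF q] by blast+
  have lm: "2 * int l + 1 < int m" using l m_eq by simp
  let ?y = "a + 2 * int l + 1"
  have "pt m ?y = pt m v \<longleftrightarrow> ?y = v" if "a < v" "v < a + 2 * int m" for v
    using pt_neq[of ?y v] pt_neq[of v ?y] that lm by (cases ?y v rule: linorder_cases) auto
  then have "pt m ?y = pt m b \<longleftrightarrow> ?y = b" "pt m ?y = pt m d \<longleftrightarrow> ?y = d" using o by auto
  moreover have "?y \<noteq> d" using g lm by auto
  ultimately show ?thesis
    using quad_distinct[OF q] unfolding used_def changed_edge_iff[OF q t] by (auto simp: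
        doubleton_eq_iff)
qed

lemma used_entering_corner:
  assumes q: "quad t a b c d" and t: "t0 \<le> t" and l: "l < h"
  shows "used (Suc t) b l \<longleftrightarrow> used t b l \<or> b + 2 * int l + 1 = c"
proof -
  have o: "a < b" "b < c" "c < d" "d < a + 2 * int m" using q by (auto simp: quad_def)
  have g: "b - a < int m" "c - b < int m" using quad_centered[OF q] by blast+
  have lm: "2 * int l + 1 < int m" using l m_eq by simp
  let ?y = "b + 2 * int l + 1"
  have "pt m ?y = pt m v \<longleftrightarrow> ?y = v" if "b < v" "v < b + 2 * int m" for v
    using pt_neq[of ?y v] pt_neq[of v ?y] that lm by (cases ?y v rule: linorder_cases) auto
  then have "pt m ?y = pt m c \<longleftrightarrow> ?y = c" "pt m ?y = pt m (a + 2 * int m) \<longleftrightarrow> ?y = a + 2 * int m"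
      using o by auto
  moreover have "?y \<noteq> a + 2 * int m" using g lm by auto
  ultimately show ?thesis
    using quad_distinct[OF q] unfolding used_def changed_edge_iff[OF q t] by (auto simp:
        doubleton_eq_iff pt_add)
qed

text \<open>Both leaving edges have to start inside the window of the state, in the order in which
  the search finds them. If \<open>c\<close> falls outside after shifting \<open>a\<close> into the
  window, the two leaving edges exchange roles.\<close>

lemma quad_normalized:
  obtains a b c d where "quad t a b c d" "x \<le> a" "c < x + 2 * int m"
proof -
  let ?n = "2 * int m"
  obtain a b c d where q: "quad t a b c d" by (rule quad_ex)
  define k where "k = - ((a - x) div ?n)"
  have "a - x + k * ?n = (a - x) mod ?n"
    unfolding k_def by (simp add: minus_div_mult_eq_mod[symmetric])
  moreover have "0 \<le> (a - x) mod ?n" "(a - x) mod ?n < ?n" using m by auto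
  ultimately have a: "x \<le> a + k * ?n" "a + k * ?n < x + ?n" by linarith+
  have q1: "quad t (a + k * ?n) (b + k * ?n) (c + k * ?n) (d + k * ?n)" using quad_shift[OF q] .
  show thesis
  proof (cases "c + k * ?n < x + ?n")
    case True
    then show thesis using that q1 a by blast
  next
    case False
    have "quad t (c + k * ?n + (- 1) * ?n) (d + k * ?n + (- 1) * ?n) (a + k * ?n + ?n + (- 1) *
        ?n) (b + k * ?n + ?n + (- 1) * ?n)"
      by (rule quad_shift, rule quad_rotate, rule q1)
    then have "quad t (c + k * ?n - ?n) (d + k * ?n - ?n) (a + k * ?n) (b + k * ?n)" by simp
    then show thesis using that False a by fastforce
  qed
qed

lemma may_enter_new:
  assumes q: "quad t a b c d" and t: "t0 \<le> t" and r: "row_ok t b r" and c: "c = b + 2 * int l + 1"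
  shows "may_enter h l r"
proof -
  have "c - b < int m" using quad_centered[OF q] by blast
  then have l: "l < h" using c m_eq by simp
  have en: "enters t {pt m b, pt m c}" using quad_enters(1)[OF q] by (auto simp: enters_def)
  have "all_old h r" if "old_at l r"
  proof -
    have "touched t {pt m b, pt m c}" using that r l c by (auto simp: row_ok_def used_def)
    then have "touched t {pt m b, pt m (b + 2 * int j + 1)}" for j
      by (rule touched_reenters[OF t en, of _ "pt m b"]) (auto intro!: pt_odd_edge)
    then show ?thesis using r by (simp add: all_old_def row_ok_def used_def)
  qed
  then show ?thesis using l by (simp add: may_enter_def)
qed

definition consistent :: "nat \<Rightarrow> state \<Rightarrow> bool" where
  "consistent t st \<longleftrightarrow> (\<exists>x W p its. st = State W p its \<and> t0 \<le> t \<and> fits t x its \<and> row_ok t (x - 1) p \<and>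
     width its = 2 * m \<and> W = (\<Sum>s\<in>{t0..<t}. gain s))"

lemma odd_gap:
  assumes "odd (y - x)" "x < y"
  obtains l where "y = x + 2 * int l + 1"
proof -
  obtain k where "y - x = 2 * k + 1" using assms(1) by (elim oddE)
  then show thesis using that[of "nat k"] assms(2) by auto
qed

text \<open>The flip made at time \<open>t\<close> is one of the branches: its leaving edges are
  visible and hence among the cuts, its entering edges satisfy \<open>may_enter\<close>, and the new
  weight is a partial sum of gains, which is nonnegative.\<close>

lemma consistent_step:
  assumes con: "consistent t (State W p its)" and nonneg: "\<And>t. t0 \<le> t \<Longrightarrow> (\<Sum>s\<in>{t0..<t}. gain s) \<ge> 0"
  shows "\<exists>st \<in> set (first_cuts h W (cuts [] 0 p its)). consistent (Suc t) st"
proof -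
  let ?n = "2 * int m"
  obtain x where t: "t0 \<le> t" and fit: "fits t x its" and p: "row_ok t (x - 1) p" and wid: "width
      its = 2 * m"
    and W: "W = (\<Sum>s\<in>{t0..<t}. gain s)"
    using con unfolding consistent_def by blast
  obtain a b c d where q: "quad t a b c d" and xa: "x \<le> a" and cx: "c < x + ?n" by (rule
      quad_normalized)
  have o: "a < b" "b < c" "c < d" "d < a + ?n" using q by (auto simp: quad_def)
  have g: "b - a < int m" "c - b < int m" "d - c < int m" "a + ?n - d < int m" using
      quad_centered[OF q] by blast+
  have q': "quad t c d (a + ?n) (b + ?n)" using quad_rotate[OF q] .
  obtain l2 where l2: "c = b + 2 * int l2 + 1" using odd_gap quad_centered(6)[OF q] o by blast
  obtain l4 where l4: "a + ?n = d + 2 * int l4 + 1"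
    using odd_gap[of "a + ?n" d] quad_centered(8)[OF q] o by auto
  have old: "J t a b" "J t c d" using q by (auto simp: quad_def)
  have gone: "\<not> J (Suc t) a b" "\<not> J (Suc t) c d" using quad_enters(2)[OF q] by (auto simp:
      joined_def)
  have ax: "a < x + int (width its)" using wid cx o by simp
  obtain A a' k1 b' R l1 where cut1: "Cut (Gap (nat (a - x) div 2) l1 b') (Sides (rev A) a' k1 R)
      \<in> set (cuts [] 0 p its)"
    and l1: "b = a + 2 * int l1 + 1" "l1 < h" and A: "int (width A) = a - x" "fits t x A"
    and k1: "fits t (a + 1) k1" "width k1 = 2 * l1" and b': "row_ok t b b'"
    and a': "\<forall>j<h. old_at j a' \<longleftrightarrow> used t a j \<or> j = l1" and R: "fits t (b + 1) R"
    and wid1: "width its = width A + 2 * l1 + 2 + width R"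
    by (rule cut_exists[OF fit t p quad_visible[OF q] old(1) gone(1) o(1) g(1) xa ax]) (rule that)
  have wR: "b + 1 + int (width R) = x + ?n" using wid1 wid A(1) l1(1) by linarith
  have pb: "row_ok t (b + 1 - 1) b'" using b' by simp
  have cR: "b + 1 \<le> c" "c < b + 1 + int (width R)" using o cx wR by auto
  obtain B c' k3 d' C l3 where cut2: "Cut (Gap (nat (c - (b + 1)) div 2) l3 d') (Sides (rev B) c'
      k3 C) \<in> set (cuts [] 0 b' R)"
    and l3: "d = c + 2 * int l3 + 1" "l3 < h" and B: "int (width B) = c - (b + 1)" "fits t (b + 1)
        B"
    and k3: "fits t (c + 1) k3" "width k3 = 2 * l3" and d': "row_ok t d d'"
    and c': "\<forall>j<h. old_at j c' \<longleftrightarrow> used t c j \<or> j = l3" and C: "fits t (d + 1) C"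
    and wid2: "width R = width B + 2 * l3 + 2 + width C"
    by (rule cut_exists[OF R t pb quad_visible[OF q'] old(2) gone(2) o(3) g(3) cR]) (rule that)
  have half: "nat (c - (b + 1)) div 2 = l2" using l2 by simp
  have sum: "l1 + l2 + l3 + l4 + 2 = 2 * h" using l1 l2 l3 l4 m_eq by linarith
  have l4_eq: "l4 = h + h - Suc (Suc l1) - l2 - l3" using sum by linarith
  have h24: "l2 < h" "l4 < h" using g l2 l4 m_eq by auto
  have e2: "may_enter h l2 b'" using may_enter_new[OF q t b' l2] .
  have e4: "may_enter h l4 d'" using may_enter_new[OF q' t d' l4] .
  define W' where "W' = W + leave_weight h l1 + enter_weight h l2 + leave_weight h l3 +
      enter_weight h l4"
  have W'_sum: "W' = (\<Sum>s\<in>{t0..<Suc t}. gain s)"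
    using quad_gain[OF q l1(1) l2 l3(1) l4] t by (simp add: W'_def W)
  have "W' \<ge> 0" unfolding W'_sum using nonneg[of "Suc t"] t by simp
  let ?its = "k1 @ Arc l2 (mark l2 b') c' B # (k3 @ [Arc l4 (mark l4 d') a' (C @ A)])"
  have mem: "State W' a' ?its \<in> set (first_cuts h W (cuts [] 0 p its))"
    using first_cuts_mem[OF cut1 cut2[unfolded half] e2 l4_eq e4 W'_def \<open>W' \<ge> 0\<close>] by simp
  have nc: "\<not> corner a b c d u" if "a < u" "u < a + ?n" "u \<noteq> b" "u \<noteq> c" "u \<noteq> d" for u
    using noncornerI[OF q that] .
  have rb: "row_ok (Suc t) b (mark l2 b')"
    using used_entering_corner[OF q t] b' l2 by (auto simp: row_ok_def old_at_mark)
  have rd: "row_ok (Suc t) d (mark l4 d')"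
    using used_entering_corner[OF q' t] d' l4 by (auto simp: row_ok_def old_at_mark)
  have ra: "row_ok (Suc t) a a'"
    using used_leaving_corner[OF q t] a' l1 by (auto simp: row_ok_def)
  have rc: "row_ok (Suc t) c c'"
    using used_leaving_corner[OF q' t] c' l3 by (auto simp: row_ok_def)
  have fk1: "fits (Suc t) (a + 1) k1"
    using noncorner_fits[OF q t k1(1)] nc k1(2) l1(1) o by auto
  have fB: "fits (Suc t) (b + 1) B"
    using noncorner_fits[OF q t B(2)] nc B(1) o by auto
  have fk3: "fits (Suc t) (c + 1) k3"
    using noncorner_fits[OF q t k3(1)] nc k3(2) l3(1) o by auto
  have wC: "d + 1 + int (width C) = x + ?n" using wid2 wR B(1) l3(1) by linarith
  have fC: "fits (Suc t) (d + 1) C"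
    using noncorner_fits[OF q t C] nc wC xa o by auto
  have fA: "fits (Suc t) (x + ?n) A"
    using noncorner_fits[OF q t fits_shift[OF A(2)]] nc A(1) wC o by auto
  have used2: "used (Suc t) b l2" using used_entering_corner[OF q t h24(1)] l2 by simp
  have used4: "used (Suc t) d l4" using used_entering_corner[OF q' t h24(2)] l4 by simp
  have J2: "J (Suc t) b c" and J4: "J (Suc t) d (a + ?n)"
    using quad_new[OF q] joined_sym[of m "M (Suc t)" a d] by auto
  have ra': "row_ok (Suc t) (a + ?n) a'" using ra by (simp add: row_ok_shift)
  have wCA: "width (C @ A) = 2 * l4" using wC A(1) l4 by (simp add: algebra_simps)
  have wB: "width B = 2 * l2" using B(1) l2 by simp
  have last: "fits (Suc t) d [Arc l4 (mark l4 d') a' (C @ A)]"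
    using h24 J4 used4 rd ra' wCA fC fA wC unfolding l4 by (simp add: fits_append)
  have third: "fits (Suc t) (c + 1) (k3 @ [Arc l4 (mark l4 d') a' (C @ A)])"
    using fk3 last k3(2) l3(1) by (simp add: fits_append add.assoc add.commute)
  have second: "fits (Suc t) b (Arc l2 (mark l2 b') c' B # (k3 @ [Arc l4 (mark l4 d') a' (C @ A)]))"
    using h24 J2 used2 rb rc wB fB third unfolding l2 by (simp add: add.assoc)
  have "fits (Suc t) (a + 1) ?its"
    using fk1 second k1(2) l1(1) by (simp add: fits_append add.assoc add.commute)
  moreover have "width ?its = 2 * m" using k1 k3 sum m_eq by simp
  moreover have "row_ok (Suc t) (a + 1 - 1) a'" using ra by simp
  ultimately have "consistent (Suc t) (State W' a' ?its)"
    unfolding consistent_def using W'_sum t by (metis le_SucI)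
  then show ?thesis using mem by blast
qed

lemma refuted_inconsistent:
  assumes "refuted h st" and nonneg: "\<And>t. t0 \<le> t \<Longrightarrow> (\<Sum>s\<in>{t0..<t}. gain s) \<ge> 0"
  shows "\<not> consistent t st"
  using assms(1)
proof (induction h\<equiv>h st arbitrary: t rule: refuted.induct)
  case (1 W p its)
  show ?case
  proof
    assume "consistent t (State W p its)"
    then obtain st where "st \<in> set (first_cuts h W (cuts [] 0 p its))" "consistent (Suc t) st"
      using consistent_step[OF _ nonneg] by blast
    then show False using 1 by (auto simp: list_all_iff)
  qed
qed

section \<open>The state after the first flip\<close>

lemma not_touched_start: "\<not> touched t0 e"
  by (simp add: touched_def)

lemma row_ok_start: "row_ok t0 x Rest"
  by (simp add: row_ok_def used_def not_touched_start)

lemma joined_inside: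
  assumes "J t x y" "x < u" "u < y" "y < x + 2 * int m"
  obtains v where "x < v" "v < y" "J t u v"
proof -
  obtain v0 where v0: "J t u v0" using joined_ex[OF matching m] by blast
  obtain v where v: "x \<le> v" "v < x + 2 * int m" "pt m v = pt m v0" using pt_surj[OF pt_range[OF
      m]] by metis
  have uv: "J t u v" using v0 v by (simp add: joined_def)
  have "v \<noteq> y" using joined_partner'[OF uv, of x] assms pt_neq[of x u] by auto
  moreover have "v \<noteq> x"
    using joined_partner'[OF uv, of y] assms(1) joined_sym[of m "M t" x y] pt_neq[of u y] assms by
        auto
  moreover have "\<not> y < v" using joined_cross[OF assms(1) uv] assms v by auto
  ultimately show thesis using that[of v] uv v by auto
qed

lemma closed_region_old:
  assumes "J t0 x y" "x < y" "y < x + int m"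
  shows "closed_region t0 (x + 1) y"
  unfolding closed_region_def
proof (intro allI impI)
  fix u assume u: "x + 1 \<le> u \<and> u < y"
  then obtain v where "x < v" "v < y" "J t0 u v" using joined_inside[OF assms(1), of u] assms by
      auto
  then show "\<exists>v. x + 1 \<le> v \<and> v < y \<and> (\<forall>s. t0 \<le> s \<and> s \<le> t0 \<longrightarrow> J s u v)"
    by (intro exI[of _ v]) auto
qed

text \<open>The edge above the region enters only with the first flip, but the points below it are
  no corners and keep their partners, so the region was closed before.\<close>

lemma closed_region_new:
  assumes "J (Suc t0) x y" "x < y" "y < x + int m" and q: "quad t0 a b c d"
    and nc: "\<And>u. x < u \<Longrightarrow> u < y \<Longrightarrow> \<not> corner a b c d u"
  shows "closed_region t0 (x + 1) y"
  unfolding closed_region_def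
proof (intro allI impI)
  fix u assume u: "x + 1 \<le> u \<and> u < y"
  then obtain v where v: "x < v" "v < y" "J (Suc t0) u v" using joined_inside[OF assms(1), of u]
      assms by auto
  moreover have "J t0 u v" using noncorner_edge[OF q nc[of u]] v u by (simp add: joined_def)
  ultimately show "\<exists>v. x + 1 \<le> v \<and> v < y \<and> (\<forall>s. t0 \<le> s \<and> s \<le> t0 \<longrightarrow> J s u v)"
    by (intro exI[of _ v]) auto
qed

lemma free_ok_start:
  assumes "closed_region t0 x (x + 2 * int l)" "l < h"
  shows "free_ok t0 x (replicate (2 * l) Rest)"
proof -
  have "2 * l < m" using assms(2) unfolding m_eq by simp
  then show ?thesis using assms(1) row_ok_start by (simp add: free_ok_def)
qed

lemma consistent_initial:
  assumes q: "quad t0 a b c d"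
    and g: "b = a + 2 * int l1 + 1" "c = b + 2 * int l2 + 1" "d = c + 2 * int l3 + 1" "a + 2 * int
        m = d + 2 * int l4 + 1"
  shows "consistent (Suc t0) (initial_state h l1 l2 l3 l4)"
proof -
  let ?n = "2 * int m"
  have q': "quad t0 c d (a + ?n) (b + ?n)" using quad_rotate[OF q] .
  have o: "a < b" "b < c" "c < d" "d < a + ?n" using q by (auto simp: quad_def)
  have gm: "b - a < int m" "c - b < int m" "d - c < int m" "a + ?n - d < int m" using
      quad_centered[OF q] by blast+
  have lh: "l1 < h" "l2 < h" "l3 < h" "l4 < h" using gm g m_eq by auto
  have old: "J t0 a b" "J t0 c d" using q by (auto simp: quad_def)
  have J2: "J (Suc t0) b c" and J4: "J (Suc t0) d (a + ?n)"
    using quad_new[OF q] joined_sym[of m "M (Suc t0)" a d] by auto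
  have nc: "\<not> corner a b c d u" if "a < u" "u < a + ?n" "u \<noteq> b" "u \<noteq> c" "u \<noteq> d" for u
    using noncornerI[OF q that] .
  have t: "t0 \<le> t0" by simp
  have E: "b = a + 1 + 2 * int l1" "c = b + 1 + 2 * int l2" "d = c + 1 + 2 * int l3" "a + ?n = d +
      1 + 2 * int l4"
    using g by simp_all
  have "closed_region t0 (a + 1) (a + 1 + 2 * int l1)"
    using closed_region_old[OF old(1)] o gm E(1) by simp
  then have "free_ok t0 (a + 1) (replicate (2 * l1) Rest)" using free_ok_start lh by blast
  then have f1: "free_ok (Suc t0) (a + 1) (replicate (2 * l1) Rest)"
    by (rule noncorner_free_ok[OF q _ t, rotated]) (use nc o E(1) in auto)
  have "closed_region t0 (c + 1) (c + 1 + 2 * int l3)"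
    using closed_region_old[OF old(2)] o gm E(3) by simp
  then have "free_ok t0 (c + 1) (replicate (2 * l3) Rest)" using free_ok_start lh by blast
  then have f3: "free_ok (Suc t0) (c + 1) (replicate (2 * l3) Rest)"
    by (rule noncorner_free_ok[OF q _ t, rotated]) (use nc o E(3) in auto)
  have "closed_region t0 (b + 1) (b + 1 + 2 * int l2)"
    using closed_region_new[OF J2 _ _ q] nc o gm E(2) by simp
  then have "free_ok t0 (b + 1) (replicate (2 * l2) Rest)" using free_ok_start lh by blast
  then have f2: "free_ok (Suc t0) (b + 1) (replicate (2 * l2) Rest)"
    by (rule noncorner_free_ok[OF q _ t, rotated]) (use nc o E(2) in auto)
  have "closed_region t0 (d + 1) (d + 1 + 2 * int l4)"
    using closed_region_new[OF J4 _ _ q] nc o gm E(4) by simp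
  then have "free_ok t0 (d + 1) (replicate (2 * l4) Rest)" using free_ok_start lh by blast
  then have f4: "free_ok (Suc t0) (d + 1) (replicate (2 * l4) Rest)"
    by (rule noncorner_free_ok[OF q _ t, rotated]) (use nc o E(4) in auto)
  have rows: "row_ok (Suc t0) a (mark l1 Rest)" "row_ok (Suc t0) b (mark l2 Rest)"
    "row_ok (Suc t0) c (mark l3 Rest)" "row_ok (Suc t0) d (mark l4 Rest)"
    using used_leaving_corner[OF q t] used_entering_corner[OF q t] used_leaving_corner[OF q' t]
        used_entering_corner[OF q' t] g
    by (auto simp: row_ok_def old_at_mark used_def not_touched_start)
  have used: "used (Suc t0) b l2" "used (Suc t0) d l4"
    using used_entering_corner[OF q t lh(2)] used_entering_corner[OF q' t lh(4)] g by simp_all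
  let ?A2 = "Arc l2 (mark l2 Rest) (mark l3 Rest) (free (replicate (2 * l2) Rest) [])"
  let ?A4 = "Arc l4 (mark l4 Rest) (mark l1 Rest) (free (replicate (2 * l4) Rest) [])"
  have ra': "row_ok (Suc t0) (a + ?n) (mark l1 Rest)" using rows(1) by (simp add: row_ok_shift)
  have a4: "fits (Suc t0) d [?A4]"
    using lh J4 used rows ra' f4 unfolding g(4) by (simp add: fits_free)
  have a3: "fits (Suc t0) (c + 1) (free (replicate (2 * l3) Rest) [?A4])"
    using f3 a4 E(3) by (simp add: fits_free)
  have a2: "fits (Suc t0) b (?A2 # free (replicate (2 * l3) Rest) [?A4])"
    using lh J2 used rows f2 a3 unfolding g(2) by (simp add: fits_free add.assoc)
  have a1: "fits (Suc t0) (a + 1) (free (replicate (2 * l1) Rest) (?A2 # free (replicate (2 * l3)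
      Rest) [?A4]))"
    using f1 a2 E(1) by (simp add: fits_free)
  have app: "free ps its @ its' = free ps (its @ its')" for ps its its' by (cases ps) auto
  have sum: "l1 + l2 + l3 + l4 + 2 = 2 * h" using g m_eq by linarith
  have "consistent (Suc t0) (State (leave_weight h l1 + enter_weight h l2 + leave_weight h l3 +
      enter_weight h l4) (mark l1 Rest)
      (free (replicate (2 * l1) Rest) (?A2 # free (replicate (2 * l3) Rest) [?A4])))"
    unfolding consistent_def
  proof (intro exI conjI)
    show "fits (Suc t0) (a + 1) (free (replicate (2 * l1) Rest) (?A2 # free (replicate (2 * l3)
        Rest) [?A4]))" by (rule a1)
    show "width (free (replicate (2 * l1) Rest) (?A2 # free (replicate (2 * l3) Rest) [?A4])) = 2
        * m"
      using sum m_eq by simp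
    show "leave_weight h l1 + enter_weight h l2 + leave_weight h l3 + enter_weight h l4 =
        (\<Sum>s\<in>{t0..<Suc t0}. gain s)"
      using quad_gain[OF q g] by simp
    show "row_ok (Suc t0) (a + 1 - 1) (mark l1 Rest)" using rows by simp
  qed simp_all
  then show ?thesis by (simp add: initial_state_def app)
qed

lemma initial_states_complete:
  assumes nonneg: "\<And>t. t0 \<le> t \<Longrightarrow> (\<Sum>s\<in>{t0..<t}. gain s) \<ge> 0"
  shows "\<exists>st \<in> set (initial_states h). consistent (Suc t0) st"
proof -
  let ?n = "2 * int m"
  obtain a b c d where q: "quad t0 a b c d" by (rule quad_ex)
  have q': "quad t0 c d (a + ?n) (b + ?n)" using quad_rotate[OF q] .
  have o: "a < b" "b < c" "c < d" "d < a + ?n" using q by (auto simp: quad_def)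
  have gm: "b - a < int m" "c - b < int m" "d - c < int m" "a + ?n - d < int m" using
      quad_centered[OF q] by blast+
  obtain l1 where l1: "b = a + 2 * int l1 + 1" using odd_gap quad_centered(5)[OF q] o by blast
  obtain l2 where l2: "c = b + 2 * int l2 + 1" using odd_gap quad_centered(6)[OF q] o by blast
  obtain l3 where l3: "d = c + 2 * int l3 + 1" using odd_gap quad_centered(7)[OF q] o by blast
  obtain l4 where l4: "a + ?n = d + 2 * int l4 + 1"
    using odd_gap[of "a + ?n" d] quad_centered(8)[OF q] o by auto
  have lh: "l1 < h" "l2 < h" "l3 < h" "l4 < h" using gm l1 l2 l3 l4 m_eq by auto
  have sum: "l1 + l2 + l3 + l4 + 2 = h + h" using l1 l2 l3 l4 m_eq by linarith
  have con: "consistent (Suc t0) (initial_state h l1 l2 l3 l4)" using consistent_initial[OF q l1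
      l2 l3 l4] .
  have con': "consistent (Suc t0) (initial_state h l3 l4 l1 l2)"
    by (rule consistent_initial[OF q' l3 l4]) (use l1 l2 in simp_all)
  have W: "0 \<le> leave_weight h l1 + enter_weight h l2 + leave_weight h l3 + enter_weight h l4"
    using nonneg[of "Suc t0"] quad_gain[OF q l1 l2 l3 l4] by simp
  show ?thesis
  proof (cases "l3 < l1 \<or> (l3 = l1 \<and> l4 \<le> l2)")
    case True
    then have "initial_state h l1 l2 l3 l4 \<in> set (initial_states h)"
      using initial_states_mem lh sum W by simp
    then show ?thesis using con by blast
  next
    case False
    then have "l1 < l3 \<or> l1 = l3 \<and> l2 \<le> l4" by auto
    then have "initial_state h l3 l4 l1 l2 \<in> set (initial_states h)"
      by (rule initial_states_mem[OF lh(3,4,1,2), rotated]) (use sum W in simp_all)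
    then show ?thesis using con' by blast
  qed
qed

end

text \<open>Each length occurs \<open>4 * h\<close> times among the entering and among the leaving
  edges of a period, so balanced weights give total gain 0 and the cycle lemma supplies the start
  \<open>t0\<close>.\<close>

lemma (in even_flip_cycle) not_refuted:
  assumes h2: "2 \<le> h" and zero: "(\<Sum>k<h. enter_weight h k + leave_weight h k) = 0"
  shows "\<not> list_all (refuted h) (initial_states h)"
proof
  assume ref: "list_all (refuted h) (initial_states h)"
  have per: "gain (t + T) = gain t" for t
    using period[of t] period[of "Suc t"] by (simp add: gain_def)
  have "(\<Sum>t<T. gain t) = 4 * int h * (\<Sum>k<h. enter_weight h k) + 4 * int h * (\<Sum>k<h. leave_weight h
      k)"
    unfolding gain_def sum.distrib
    using sum_flips(1)[of "\<lambda>i. enter_weight h (i div 2)"] sum_flips(2)[of "\<lambda>i. leave_weight h (i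
        div 2)"] by simp
  also have "\<dots> = 4 * int h * (\<Sum>k<h. enter_weight h k + leave_weight h k)" by (simp add:
      sum.distrib distrib_left)
  finally have "(\<Sum>t<T. gain t) = 0" using zero by simp
  with per T obtain t0 where t0: "\<forall>k. (\<Sum>i<k. gain (t0 + i)) \<ge> 0" by (rule cycle_lemma[of gain T])
  interpret anchored_flip_cycle m T M h t0 by unfold_locales (rule h2)
  have nonneg: "(\<Sum>s\<in>{t0..<t}. gain s) \<ge> 0" if "t0 \<le> t" for t
  proof -
    have "(\<Sum>s\<in>{t0..<t}. gain s) = (\<Sum>i<t - t0. gain (t0 + i))"
      using sum.shift_bounds_nat_ivl[of gain 0 t0 "t - t0"] that by (simp add: atLeast0LessThan
          add.commute)
    then show ?thesis using t0 by simp
  qed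
  obtain st where "st \<in> set (initial_states h)" "consistent (Suc t0) st"
    using initial_states_complete[OF nonneg] by blast
  then show False using refuted_inconsistent[OF _ nonneg] ref by (auto simp: list_all_iff)
qed

lemma rainbow_flip_cycle:
  assumes "rainbow_cycle m 1 C" "m > 0"
  obtains T M where "flip_cycle m T M"
proof -
  obtain T M where "T > 0" "\<forall>t. M t \<in> noncrossing_matchings m" "\<forall>t. flip (M t) (M (Suc t))"
    "\<forall>t. M (t + T) = M t" "\<forall>e\<in>odd_edges m. card {t. t < T \<and> e \<in> M (Suc t) - M t} = 1"
    by (rule rainbow_cycle_sequence[OF assms(1)])
  then have "flip_cycle m T M" using assms(2) by (simp add: flip_cycle_def)
  then show thesis by (rule that)
qed

lemma no_rainbow_cycle_odd:
  assumes "odd m"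
  shows "\<not> rainbow_cycle m 1 C"
proof
  assume C: "rainbow_cycle m 1 C"
  have "m > 0" using assms by (rule odd_pos)
  with C obtain T M where "flip_cycle m T M" by (rule rainbow_flip_cycle)
  then show False using flip_cycle.even_m assms by blast
qed

lemma no_rainbow_cycle_refuted:
  assumes "2 \<le> h" "(\<Sum>k<h. enter_weight h k + leave_weight h k) = 0" "list_all (refuted h)
      (initial_states h)"
  shows "\<not> rainbow_cycle (2 * h) 1 C"
proof
  assume C: "rainbow_cycle (2 * h) 1 C"
  have "2 * h > 0" using assms(1) by simp
  with C obtain T M where "flip_cycle (2 * h) T M" by (rule rainbow_flip_cycle)
  then interpret even_flip_cycle "2 * h" T M h by (simp add: even_flip_cycle_def
      even_flip_cycle_axioms_def)
  show False using not_refuted assms by blast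
qed

lemma weights_balanced:
  "(\<Sum>k<3. enter_weight 3 k + leave_weight 3 k) = 0" "(\<Sum>k<4. enter_weight 4 k + leave_weight 4 k) =
      0" "(\<Sum>k<5. enter_weight 5 k + leave_weight 5 k) = 0"
  by (simp_all add: eval_nat_numeral enter_weight_def leave_weight_def)

section \<open>Explicit rainbow cycles\<close>

text \<open>A matching is tabulated as the list of pairs \<open>(i, partner of i)\<close>, and
  \<open>(a, b, c, d)\<close> stands for the flip that replaces the edges \<open>{a, b}\<close>,
  \<open>{c, d}\<close> by \<open>{a, c}\<close>, \<open>{b, d}\<close>.\<close>

type_synonym table = "(nat \<times> nat) list"
type_synonym quad = "nat \<times> nat \<times> nat \<times> nat"

definition table_edges :: "table \<Rightarrow> nat set set" where
  "table_edges tb = (\<lambda>(i, j). {i, j}) ` set tb"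

definition table_ok :: "nat \<Rightarrow> table \<Rightarrow> bool" where
  "table_ok m tb \<longleftrightarrow> map fst tb = [1..<2 * m + 1] \<and> (\<forall>(i, j) \<in> set tb. (j, i) \<in> set tb \<and> i \<noteq> j)"

definition nested :: "table \<Rightarrow> bool" where
  "nested tb \<longleftrightarrow> sorted_wrt (\<lambda>(i, j) (k, l). i < k \<and> (j < k \<or> l < j)) (filter (\<lambda>(i, j). i < j) tb)"

fun flip_table :: "quad \<Rightarrow> table \<Rightarrow> table" where
  "flip_table (a, b, c, d) tb =
     map (\<lambda>(i, j). (i, if i = a then c else if i = c then a else if i = b then d else if i = d
         then b else j)) tb"

lemma table_unique: "table_ok m tb \<Longrightarrow> (i, j) \<in> set tb \<Longrightarrow> (i, k) \<in> set tb \<Longrightarrow> j = k"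
  by (metis table_ok_def distinct_upt eq_key_imp_eq_value)

lemma table_range: "table_ok m tb \<Longrightarrow> (i, j) \<in> set tb \<Longrightarrow> i \<in> {1..2 * m} \<and> j \<in> {1..2 * m} \<and> i \<noteq> j"
proof -
  assume ok: "table_ok m tb" and ij: "(i, j) \<in> set tb"
  have "fst ` set tb = {1..2 * m}" using ok unfolding table_ok_def by (metis
      atLeastLessThanSuc_atLeastAtMost Suc_eq_plus1 set_map set_upt)
  moreover have "(j, i) \<in> set tb" "i \<noteq> j" using ok ij by (auto simp: table_ok_def)
  ultimately show ?thesis using ij by force
qed

lemma table_total: "table_ok m tb \<Longrightarrow> i \<in> {1..2 * m} \<Longrightarrow> \<exists>j. (i, j) \<in> set tb"
proof -
  assume ok: "table_ok m tb" and i: "i \<in> {1..2 * m}"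
  have "fst ` set tb = {1..2 * m}" using ok unfolding table_ok_def by (metis
      atLeastLessThanSuc_atLeastAtMost Suc_eq_plus1 set_map set_upt)
  then show ?thesis using i by force
qed

lemma table_sym: "table_ok m tb \<Longrightarrow> (i, j) \<in> set tb \<Longrightarrow> (j, i) \<in> set tb"
  by (auto simp: table_ok_def)

lemma mem_table_edges: "table_ok m tb \<Longrightarrow> {i, j} \<in> table_edges tb \<longleftrightarrow> (i, j) \<in> set tb"
  by (auto simp: table_edges_def doubleton_eq_iff dest: table_sym)

lemma table_edgeE:
  assumes "e \<in> table_edges tb"
  obtains i j where "e = {i, j}" "(i, j) \<in> set tb"
  using assms by (auto simp: table_edges_def)

lemma table_perfect: "table_ok m tb \<Longrightarrow> perfect_matching m (table_edges tb)"
  unfolding perfect_matching_def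
proof (intro conjI ballI)
  fix e assume ok: "table_ok m tb" and "e \<in> table_edges tb"
  then obtain i j where ij: "e = {i, j}" "(i, j) \<in> set tb" by (elim table_edgeE)
  show "e \<subseteq> {1..2 * m}" "card e = 2" using table_range[OF ok ij(2)] ij(1) by auto
next
  fix i assume ok: "table_ok m tb" and i: "i \<in> {1..2 * m}"
  obtain j where j: "(i, j) \<in> set tb" using table_total[OF ok i] by blast
  show "\<exists>!e. e \<in> table_edges tb \<and> i \<in> e"
  proof (rule ex1I[of _ "{i, j}"])
    show "{i, j} \<in> table_edges tb \<and> i \<in> {i, j}" using j mem_table_edges[OF ok] by simp
    fix f assume f: "f \<in> table_edges tb \<and> i \<in> f"
    then obtain k l where kl: "f = {k, l}" "(k, l) \<in> set tb" by (auto elim: table_edgeE)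
    then consider "i = k" | "i = l" using f by auto
    then show "f = {i, j}"
      using kl table_unique[OF ok j] table_sym[OF ok kl(2)] by cases (auto simp: insert_commute)
  qed
qed

lemma sorted_wrt_mem: "sorted_wrt P xs \<Longrightarrow> x \<in> set xs \<Longrightarrow> y \<in> set xs \<Longrightarrow> x = y \<or> P x y \<or> P y x"
  by (induction xs) auto

lemma table_noncrossing:
  assumes ok: "table_ok m tb" and nest: "nested tb"
  shows "table_edges tb \<in> noncrossing_matchings m"
proof -
  have up: "\<exists>i j. e = {i, j} \<and> (i, j) \<in> set tb \<and> i < j" if e: "e \<in> table_edges tb" for e
  proof -
    obtain i j where ij: "e = {i, j}" "(i, j) \<in> set tb" using e by (rule table_edgeE)
    show ?thesis
    proof (cases "i < j")
      case True
      then show ?thesis using ij by blast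
    next
      case False
      then have "j < i" using table_range[OF ok ij(2)] by auto
      then show ?thesis using ij table_sym[OF ok ij(2)] by (intro exI[of _ j] exI[of _ i]) auto
    qed
  qed
  have sep: "edge_segment m {i, j} \<inter> edge_segment m {k, l} = {}"
    if "(i, j) \<in> set tb" "(k, l) \<in> set tb" "i < j" "k < l" "i < k" "j < k \<or> l < j" for i j k l
    using table_range[OF ok that(1)] table_range[OF ok that(2)] that
    by (intro separated_segments_disjoint) auto
  have "edge_segment m e \<inter> edge_segment m f = {}" if ef: "e \<in> table_edges tb" "f \<in> table_edges tb"
      "e \<noteq> f" for e f
  proof -
    obtain i j where e: "e = {i, j}" "(i, j) \<in> set tb" "i < j" using up[OF ef(1)] by blast
    obtain k l where f: "f = {k, l}" "(k, l) \<in> set tb" "k < l" using up[OF ef(2)] by blast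
    have ne: "(i, j) \<noteq> (k, l)" using e f ef by auto
    then consider "i < k \<and> (j < k \<or> l < j)" | "k < i \<and> (l < i \<or> j < l)"
      using sorted_wrt_mem[OF nest[unfolded nested_def], of "(i, j)" "(k, l)"] e f by auto
    then show ?thesis
    proof cases
      case 1
      then show ?thesis using sep[OF e(2) f(2) e(3) f(3)] e f by simp
    next
      case 2
      then show ?thesis using sep[OF f(2) e(2) f(3) e(3)] e f by (simp add: Int_commute)
    qed
  qed
  then show ?thesis using table_perfect[OF ok] by (simp add: noncrossing_matchings_def
      noncrossing_def)
qed

text \<open>Tables are sorted by label and thus canonical, so that distinctness of the vertices of a
  cycle can be tested on tables.\<close>

lemma table_edges_inj:
  assumes "table_ok m tb" "table_ok m tb'" "table_edges tb = table_edges tb'"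
  shows "tb = tb'"
proof -
  have "(i, j) \<in> set tb \<longleftrightarrow> (i, j) \<in> set tb'" for i j
    using mem_table_edges[OF assms(1), of i j] mem_table_edges[OF assms(2), of i j] assms(3) by simp
  then have "set tb = set tb'" by auto
  have k: "map fst tb = map fst tb'" using assms by (simp add: table_ok_def)
  show ?thesis
  proof (rule nth_equalityI)
    show len: "length tb = length tb'" using map_eq_imp_length_eq[OF k] .
    fix i assume i: "i < length tb"
    have f: "fst (tb ! i) = fst (tb' ! i)" using nth_map[of i tb fst] nth_map[of i tb' fst] k i
        len by simp
    have m1: "tb ! i \<in> set tb" using i by (rule nth_mem)
    have m2: "tb' ! i \<in> set tb" unfolding \<open>set tb = set tb'\<close> using i unfolding len by (rule nth_mem)
    have "(fst (tb ! i), snd (tb ! i)) \<in> set tb" using m1 by simp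
    moreover have "(fst (tb ! i), snd (tb' ! i)) \<in> set tb" unfolding f using m2 by simp
    ultimately have "snd (tb ! i) = snd (tb' ! i)" by (rule table_unique[OF assms(1)])
    with f show "tb ! i = tb' ! i" by (rule prod_eqI)
  qed
qed

lemma flip_table_ok:
  assumes ok: "table_ok m tb" and ab: "(a, b) \<in> set tb" and cd: "(c, d) \<in> set tb" and ne: "a \<noteq> c"
      "a \<noteq> d"
  shows "table_ok m (flip_table (a, b, c, d) tb)"
    and "table_edges (flip_table (a, b, c, d) tb) = table_edges tb - {{a, b}, {c, d}} \<union> {{a, c},
        {b, d}}"
    and "table_edges (flip_table (a, b, c, d) tb) - table_edges tb = {{a, c}, {b, d}}"
    and "flip (table_edges tb) (table_edges (flip_table (a, b, c, d) tb))"
proof -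
  let ?tb = "flip_table (a, b, c, d) tb"
  have ba: "(b, a) \<in> set tb" and dc: "(d, c) \<in> set tb" using table_sym[OF ok] ab cd by auto
  have uniq: "\<And>i j k. (i, j) \<in> set tb \<Longrightarrow> (i, k) \<in> set tb \<Longrightarrow> j = k" using table_unique[OF ok] .
  have dist: "a \<noteq> b" "c \<noteq> d" using table_range[OF ok] ab cd by auto
  have bd: "b \<noteq> d" "b \<noteq> c" using uniq[OF ba] dc cd ne by auto
  have mem: "(i, j) \<in> set ?tb \<longleftrightarrow> (i, j) \<in> {(a, c), (c, a), (b, d), (d, b)} \<or> (i, j) \<in> set tb \<and> i \<notin>
      {a, b, c, d}" for i j
  proof -
    define g where "g i j = (if i = a then c else if i = c then a else if i = b then d else if i =
        d then b else j)" for i j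
    have "?tb = map (\<lambda>(i, j). (i, g i j)) tb" by (simp add: g_def)
    then have img: "(i, j) \<in> set ?tb \<longleftrightarrow> (\<exists>j0. (i, j0) \<in> set tb \<and> j = g i j0)" by (auto simp del:
        flip_table.simps)
    have g: "g a j = c" "g b j = d" "g c j = a" "g d j = b" "i \<notin> {a, b, c, d} \<Longrightarrow> g i j = j" for i j
      using dist bd ne by (auto simp: g_def)
    consider "i = a" | "i = b" | "i = c" | "i = d" | "i \<notin> {a, b, c, d}" by blast
    then show ?thesis
    proof cases
      case 1
      then show ?thesis unfolding img using ab dist bd ne by (auto simp: g)
    next
      case 2
      then show ?thesis unfolding img using ba dist bd ne by (auto simp: g)
    next
      case 3
      then show ?thesis unfolding img using cd dist bd ne by (auto simp: g)
    next
      case 4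
      then show ?thesis unfolding img using dc dist bd ne by (auto simp: g)
    next
      case 5
      then show ?thesis unfolding img using g(5)[OF 5] by auto
    qed
  qed
  have sym: "(j, i) \<in> set ?tb \<and> i \<noteq> j" if ij: "(i, j) \<in> set ?tb" for i j
  proof -
    consider "(i, j) \<in> {(a, c), (c, a), (b, d), (d, b)}" | "(i, j) \<in> set tb" "i \<notin> {a, b, c, d}"
      using iffD1[OF mem ij] by blast
    then show ?thesis
    proof cases
      case 1
      then show ?thesis unfolding mem[of j i] using bd ne by auto
    next
      case 2
      then have "(j, i) \<in> set tb" "i \<noteq> j" using table_sym[OF ok] table_range[OF ok] by auto
      moreover have "j \<noteq> a" using uniq[OF ab, of i] \<open>(j, i) \<in> set tb\<close> 2(2) by blast
      moreover have "j \<noteq> b" using uniq[OF ba, of i] \<open>(j, i) \<in> set tb\<close> 2(2) by blast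
      moreover have "j \<noteq> c" using uniq[OF cd, of i] \<open>(j, i) \<in> set tb\<close> 2(2) by blast
      moreover have "j \<noteq> d" using uniq[OF dc, of i] \<open>(j, i) \<in> set tb\<close> 2(2) by blast
      ultimately show ?thesis using mem[of j i] by simp
    qed
  qed
  show ok': "table_ok m ?tb"
  proof -
    have "map fst ?tb = map fst tb" by (simp add: comp_def case_prod_unfold)
    then show ?thesis using ok sym unfolding table_ok_def by (auto simp del: flip_table.simps)
  qed
  have abM: "{a, b} \<in> table_edges tb" and cdM: "{c, d} \<in> table_edges tb" using mem_table_edges[OF
      ok] ab cd by auto
  show E: "table_edges ?tb = table_edges tb - {{a, b}, {c, d}} \<union> {{a, c}, {b, d}}"
  proof (intro set_eqI iffI)
    fix e assume "e \<in> table_edges ?tb"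
    then obtain i j where ij: "e = {i, j}" "(i, j) \<in> set ?tb" by (rule table_edgeE)
    consider "(i, j) \<in> {(a, c), (c, a), (b, d), (d, b)}" | "(i, j) \<in> set tb" "i \<notin> {a, b, c, d}"
      using iffD1[OF mem ij(2)] by blast
    then show "e \<in> table_edges tb - {{a, b}, {c, d}} \<union> {{a, c}, {b, d}}"
    proof cases
      case 1
      then show ?thesis using ij(1) by (auto simp: insert_commute)
    next
      case 2
      then show ?thesis using ij(1) mem_table_edges[OF ok, of i j] by auto
    qed
  next
    fix e assume "e \<in> table_edges tb - {{a, b}, {c, d}} \<union> {{a, c}, {b, d}}"
    then consider "e = {a, c}" | "e = {b, d}" | "e \<in> table_edges tb" "e \<noteq> {a, b}" "e \<noteq> {c, d}" by
        blast
    then show "e \<in> table_edges ?tb"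
    proof cases
      case 1
      then show ?thesis using mem_table_edges[OF ok', of a c] mem[of a c] by simp
    next
      case 2
      then show ?thesis using mem_table_edges[OF ok', of b d] mem[of b d] by simp
    next
      case 3
      then obtain i j where ij: "e = {i, j}" "(i, j) \<in> set tb" by (elim table_edgeE)
      have "i \<noteq> a" using uniq[OF ab, of j] ij 3(2) by blast
      moreover have "i \<noteq> b" using uniq[OF ba, of j] ij 3(2) by blast
      moreover have "i \<noteq> c" using uniq[OF cd, of j] ij 3(3) by blast
      moreover have "i \<noteq> d" using uniq[OF dc, of j] ij 3(3) by blast
      ultimately show ?thesis using ij mem_table_edges[OF ok', of i j] mem[of i j] by simp
    qed
  qed
  have "(a, c) \<notin> set tb" "(b, d) \<notin> set tb" using uniq[OF ab, of c] uniq[OF ba, of d] bd ne by blast+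
  then have "{a, c} \<notin> table_edges tb" "{b, d} \<notin> table_edges tb" using mem_table_edges[OF ok] by auto
  then show "table_edges ?tb - table_edges tb = {{a, c}, {b, d}}" unfolding E by auto
  have "{a, b} \<noteq> {c, d}" using ne by (auto simp: doubleton_eq_iff)
  then show "flip (table_edges tb) (table_edges ?tb)"
    unfolding flip_def using abM cdM E by blast
qed

section \<open>Sequences of flips of tables\<close>

fun tables :: "table \<Rightarrow> quad list \<Rightarrow> table list" where
  "tables tb [] = []"
| "tables tb (q # qs) = tb # tables (flip_table q tb) qs"

fun final :: "table \<Rightarrow> quad list \<Rightarrow> table" where
  "final tb [] = tb"
| "final tb (q # qs) = final (flip_table q tb) qs"

fun legal :: "table \<Rightarrow> quad list \<Rightarrow> bool" where
  "legal tb [] \<longleftrightarrow> nested tb"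
| "legal tb ((a, b, c, d) # qs) \<longleftrightarrow> (a, b) \<in> set tb \<and> (c, d) \<in> set tb \<and> a \<noteq> c \<and> a \<noteq> d \<and> nested tb \<and>
     legal (flip_table (a, b, c, d) tb) qs"

fun flip_arcs :: "table \<Rightarrow> quad list \<Rightarrow> (nat set set \<times> nat set set) list" where
  "flip_arcs tb [] = []"
| "flip_arcs tb (q # qs) = (table_edges tb, table_edges (flip_table q tb)) # flip_arcs (flip_table
    q tb) qs"

definition hits :: "nat \<Rightarrow> nat \<Rightarrow> quad list \<Rightarrow> nat" where
  "hits i j qs = length (filter (\<lambda>(a, b, c, d). i = a \<and> j = c \<or> i = c \<and> j = a \<or> i = b \<and> j = d \<or> i
      = d \<and> j = b) qs)"

lemma legal_nested: "legal tb qs \<Longrightarrow> nested tb"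
  by (cases "(tb, qs)" rule: legal.cases) auto

lemma flip_arcs_walk:
  assumes "table_ok m tb" "legal tb qs"
  shows "set (flip_arcs tb qs) \<subseteq> arcs (matching_flip_graph m) \<and>
    pre_digraph.cas (matching_flip_graph m) (table_edges tb) (flip_arcs tb qs) (table_edges (final
        tb qs)) \<and>
    pre_digraph.awalk_verts (matching_flip_graph m) (table_edges tb) (flip_arcs tb qs)
      = map table_edges (tables tb qs) @ [table_edges (final tb qs)] \<and>
    length (filter (\<lambda>x. {i, j} \<in> entering_edges x) (flip_arcs tb qs)) = hits i j qs \<and>
    (\<forall>tb' \<in> set (tables tb qs). table_ok m tb')"
  using assms
proof (induction tb qs rule: legal.induct)
  case (1 tb)
  then show ?case by (simp add: pre_digraph.cas.simps pre_digraph.awalk_verts.simps hits_def)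
next
  case (2 tb a b c d qs)
  let ?tb = "flip_table (a, b, c, d) tb"
  have l: "(a, b) \<in> set tb" "(c, d) \<in> set tb" "a \<noteq> c" "a \<noteq> d" "nested tb" "legal ?tb qs" using 2
      by auto
  note ft = flip_table_ok[OF "2.prems"(1) l(1-4)]
  have arc: "(table_edges tb, table_edges ?tb) \<in> arcs (matching_flip_graph m)"
    using table_noncrossing[OF "2.prems"(1) l(5)] table_noncrossing[OF ft(1) legal_nested[OF
        l(6)]] ft(4)
    by (simp add: matching_flip_graph_def)
  have th: "tail (matching_flip_graph m) = fst" "head (matching_flip_graph m) = snd" by (simp_all
      add: matching_flip_graph_def)
  have ent: "{i, j} \<in> entering_edges (table_edges tb, table_edges ?tb) \<longleftrightarrow>
      i = a \<and> j = c \<or> i = c \<and> j = a \<or> i = b \<and> j = d \<or> i = d \<and> j = b"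
    unfolding entering_edges_def using ft(3) by (auto simp: doubleton_eq_iff)
  show ?case
    using "2.IH"[OF ft(1) l(6)] arc ent "2.prems"(1)
    by (simp del: flip_table.simps add: pre_digraph.cas.simps pre_digraph.awalk_verts.simps th
        hits_def)
qed

text \<open>All premises can be decided by evaluation. The labels are checked as pairs of an odd and
  an even point, since an edge of odd length has one end of each kind.\<close>

lemma rainbow_cycleI:
  assumes ok: "table_ok m tb" and "legal tb qs" "final tb qs = tb" "distinct (tables tb qs)" "qs \<noteq>
      []"
    and hit: "\<forall>i \<in> set (filter odd [1..<2 * m + 1]). \<forall>j \<in> set (filter even [1..<2 * m + 1]). hits
        i j qs = r"
  shows "rainbow_cycle m r (flip_arcs tb qs)"
proof -
  let ?G = "matching_flip_graph m"
  have nest: "nested tb" using legal_nested assms(2) .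
  have walk: "set (flip_arcs tb qs) \<subseteq> arcs ?G"
    "pre_digraph.cas ?G (table_edges tb) (flip_arcs tb qs) (table_edges tb)"
    "pre_digraph.awalk_verts ?G (table_edges tb) (flip_arcs tb qs) = map table_edges (tables tb
        qs) @ [table_edges tb]"
    "\<forall>tb' \<in> set (tables tb qs). table_ok m tb'"
    using flip_arcs_walk[OF ok assms(2)] assms(3) by auto
  have count: "length (filter (\<lambda>x. {i, j} \<in> entering_edges x) (flip_arcs tb qs)) = hits i j qs"
      for i j
    using flip_arcs_walk[OF ok assms(2)] by blast
  have "inj_on table_edges (set (tables tb qs))"
    by (rule inj_onI) (use walk(4) table_edges_inj in blast)
  then have d: "distinct (map table_edges (tables tb qs))" using assms(4) by (simp add:
      distinct_map)
  obtain q qs' where q: "qs = q # qs'" using assms(5) by (cases qs) auto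
  have "distinct (tl (map table_edges (tables tb qs) @ [table_edges tb]))" using d q by auto
  moreover have "table_edges tb \<in> verts ?G" using table_noncrossing[OF ok nest] by (simp add:
      matching_flip_graph_def)
  moreover have "flip_arcs tb qs \<noteq> []" using q by simp
  ultimately have "pre_digraph.cycle ?G (flip_arcs tb qs)"
    unfolding pre_digraph.cycle_def pre_digraph.awalk_def using walk by metis
  moreover have "length (filter (\<lambda>x. e \<in> entering_edges x) (flip_arcs tb qs)) = r" if e: "e \<in>
      odd_edges m" for e
  proof -
    obtain i j where ij: "e = {i, j}" "i \<in> {1..2 * m}" "j \<in> {1..2 * m}" "odd (int j - int i)"
      using e unfolding odd_edges_def by blast
    have "\<exists>i j. e = {i, j} \<and> odd i \<and> even j \<and> i \<in> {1..2 * m} \<and> j \<in> {1..2 * m}"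
    proof (cases "odd i")
      case True
      then show ?thesis using ij by (intro exI[of _ i] exI[of _ j]) simp
    next
      case False
      then show ?thesis using ij by (intro exI[of _ j] exI[of _ i]) (simp add: insert_commute)
    qed
    then obtain k l where kl: "e = {k, l}" "odd k" "even l" "k \<in> {1..2 * m}" "l \<in> {1..2 * m}" by
        blast
    have "k \<in> set (filter odd [1..<2 * m + 1])" "l \<in> set (filter even [1..<2 * m + 1])" using kl
        by auto
    then have "hits k l qs = r" using hit by blast
    then show ?thesis unfolding kl(1) count .
  qed
  ultimately show ?thesis by (simp add: rainbow_cycle_def)
qed

text \<open>The cycles below are invariant under the rotation by two points.\<close>

fun turn :: "nat \<Rightarrow> nat \<Rightarrow> nat" where
  "turn n i = (if i + 2 \<le> n then i + 2 else i + 2 - n)"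

fun turn_quad :: "nat \<Rightarrow> quad \<Rightarrow> quad" where
  "turn_quad n (a, b, c, d) = (turn n a, turn n b, turn n c, turn n d)"

fun turns :: "nat \<Rightarrow> nat \<Rightarrow> quad list \<Rightarrow> quad list" where
  "turns n 0 qs = []"
| "turns n (Suc k) qs = qs @ turns n k (map (turn_quad n) qs)"

lemma rainbow_cycle_2:
  "rainbow_cycle 2 1 (flip_arcs
     [(1, 2), (2, 1), (3, 4), (4, 3)]
     [(1, 2, 4, 3), (1, 4, 2, 3)])"
  by (rule rainbow_cycleI; code_simp)

lemma rainbow_cycle_4:
  "rainbow_cycle 4 1 (flip_arcs
     [(1, 8), (2, 7), (3, 4), (4, 3), (5, 6), (6, 5), (7, 2), (8, 1)]
     (turns 8 4 [(2, 7, 3, 4), (1, 8, 4, 7)]))"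
  by (rule rainbow_cycleI; code_simp)

text \<open>A 2-rainbow cycle has \<open>m * m\<close> flips, here 36: six are listed and turned six
  times.\<close>

lemma rainbow_cycle_6:
  "rainbow_cycle 6 2 (flip_arcs
     [(1, 12), (2, 11), (3, 10), (4, 7), (5, 6), (6, 5), (7, 4), (8, 9), (9, 8), (10, 3),
      (11, 2), (12, 1)]
     (turns 12 6 [(3, 10, 8, 9), (2, 11, 3, 8), (4, 7, 11, 8), (4, 11, 9, 10), (1, 12, 4, 9),
       (5, 6, 12, 9)]))"
  by (rule rainbow_cycleI; code_simp)

lemma rainbow_cycle_8:
  "rainbow_cycle 8 2 (flip_arcs
     [(1, 2), (2, 1), (3, 14), (4, 7), (5, 6), (6, 5), (7, 4), (8, 9), (9, 8), (10, 11), (11,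
      10), (12, 13), (13, 12), (14, 3), (15, 16), (16, 15)]
     (turns 16 8 [(3, 14, 10, 11), (3, 10, 16, 15), (4, 7, 15, 10), (4, 15, 11, 14), (3, 16,
       4, 11), (7, 10, 16, 11), (7, 16, 8, 9), (5, 6, 16, 9)]))"
  by (rule rainbow_cycleI; code_simp)

theorem theorem9:
  fixes m :: nat
  assumes "m \<ge> 2"
  shows "(odd m \<longrightarrow> \<not> (\<exists>C. rainbow_cycle m 1 C)) \<and>
    (m \<in> {6, 8, 10} \<longrightarrow> \<not> (\<exists>C. rainbow_cycle m 1 C)) \<and>
    (m \<in> {2, 4} \<longrightarrow> (\<exists>C. rainbow_cycle m 1 C)) \<and>
    (m \<in> {6, 8} \<longrightarrow> (\<exists>C. rainbow_cycle m 2 C))"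
proof (intro conjI impI)
  show "\<not> (\<exists>C. rainbow_cycle m 1 C)" if "odd m"
    using no_rainbow_cycle_odd[OF that] by blast
  have none: "\<not> rainbow_cycle 6 1 C" "\<not> rainbow_cycle 8 1 C" "\<not> rainbow_cycle 10 1 C" for C
    using no_rainbow_cycle_refuted[of 3 C] refuted_initial_3 no_rainbow_cycle_refuted[of 4 C]
        refuted_initial_4
      no_rainbow_cycle_refuted[of 5 C] refuted_initial_5 weights_balanced by simp_all
  show "\<not> (\<exists>C. rainbow_cycle m 1 C)" if "m \<in> {6, 8, 10}"
    using that none by blast
  show "\<exists>C. rainbow_cycle m 1 C" if "m \<in> {2, 4}"
    using that rainbow_cycle_2 rainbow_cycle_4 by blast
  show "\<exists>C. rainbow_cycle m 2 C" if "m \<in> {6, 8}"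
    using that rainbow_cycle_6 rainbow_cycle_8 by blast
qed

end
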